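(* Let $n=\dim M\ge 3$ be odd and let $g$ be a smoothly conformally compactifiable, asymptotically hyperbolic metric on $M$ which is partially even in the special defining function $x$ inducing the metric $h_{(0)}=h_0$ on $\partial_\infty M$, so that $g=\frac{1}{x^2}(dx^2\oplus h_x)$ near $\partial_\infty M$ and $$h_x=h_{(0)}+x^2h_{(2)}+\dots+\frac{1}{n-1}\theta x^{n-1}+\frac1n\kappa x^n+\mathcal O(x^{n+1}),$$ where no term odd in $x$ of order less than $x^{n-1}$ occurs. Let $\hat x$ be another special defining function, with $g=\frac{1}{\hat x^2}(d\hat x^2\oplus\hat h_{\hat x})$ near $\partial_\infty M$, such that $\hat h_0=e^{2\omega_0}h_0$ on $\partial_\infty M$ for a function $\omega_0$ on $\partial_\infty M$. Then $\hat h_{\hat x}$ is partially even in $\hat x$, and $\mu:=\mathrm{tr}_{h_{(0)}}\kappa$ is conformally invariant with weight $-n$; i.e., writing $\frac1n\hat\kappa$ for the coefficient of $\hat x^n$ in the expansion of $\hat h_{\hat x}$ in powers of $\hat x$, $$\hat\mu:=\mathrm{tr}_{\hat h_{(0)}}\hat\kappa=e^{-n\omega_0}\mu .$$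
   Context: $(M,g)$ is smoothly conformally compactifiable if $M$ embeds in a manifold-with-boundary $\bar M$ with $\bar M\setminus M=\partial\bar M=:\partial_\infty M$ and there is a positive function $x$ on $M$ extending smoothly to $\bar M$ with $x=0$, $dx\neq0$ on $\partial_\infty M$, such that $x^2g$ extends smoothly to a metric on $\bar M$. Such an $x$ is a special defining function if $|dx|^2_{x^2g}=1$ on a collar neighbourhood of $\partial_\infty M$; $g$ is asymptotically hyperbolic if such an $x$ exists. Then near $\partial_\infty M$ the metric has the normal form $g=x^{-2}(dx^2\oplus h_x)$, with $h_x$ a one-parameter family of metrics on $\partial_\infty M$. $g$ is partially even in $x$ if $h_x$ has no term odd in $x$ of order less than $x^{n-1}$ in its expansion at $x=0$, i.e. $h_x=h_{(0)}+x^2h_{(2)}+\dots+x^{n-1}h_{(n-1)}+x^nh_{(n)}+\mathcal O(x^{n+1})$ where only even powers of $x$ occur below order $x^{n-1}$ (so for $n$ odd all odd powers below $x^n$ are absent). Here $\theta=(n-1)h_{(n-1)}$ and $\kappa=n h_{(n)}$ are symmetric 2-tensors on $\partial_\infty M$. *)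

theory Defs
  imports "HOL-Analysis.Analysis" "HOL-Library.Landau_Symbols"
begin

section \<open>Smooth functions\<close>

primrec Ck_on :: "nat \<Rightarrow> 'a::euclidean_space set \<Rightarrow> ('a \<Rightarrow> 'b::real_normed_vector) \<Rightarrow> bool" where
  "Ck_on 0 S f \<longleftrightarrow> continuous_on S f"
| "Ck_on (Suc k) S f \<longleftrightarrow>
     (\<forall>z\<in>S. f differentiable (at z)) \<and>
     (\<forall>v. Ck_on k S (\<lambda>z. frechet_derivative f (at z) v))"

text \<open>
  \<open>Ck_on\<close> is meant for open sets.  On other sets (relatively open subsets of a half-space),
  smoothness means the local existence of smooth extensions, as usual for manifolds with boundary.
\<close>

definition smooth_on :: "'a::euclidean_space set \<Rightarrow> ('a \<Rightarrow> 'b::real_normed_vector) \<Rightarrow> bool" where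
  "smooth_on S f \<longleftrightarrow>
     (\<forall>z\<in>S. \<exists>U F. open U \<and> z \<in> U \<and> (\<forall>k. Ck_on k U F) \<and> (\<forall>w\<in>S \<inter> U. F w = f w))"

section \<open>Manifolds with boundary\<close>

text \<open>
  A chart is a pair of its domain and its coordinate map.  The model space \<open>H\<close> is \<open>half_space\<close>
  for manifolds with boundary and \<open>UNIV\<close> for manifolds without boundary.  A manifold is
  represented by an atlas, which need not be maximal; its underlying space is \<open>carrier A\<close>
  with the subspace topology.
\<close>

type_synonym ('m, 'v) chart = "'m set \<times> ('m \<Rightarrow> 'v)"

abbreviation dom_of :: "('m, 'v) chart \<Rightarrow> 'm set" where
  "dom_of \<equiv> fst"

abbreviation coord :: "('m, 'v) chart \<Rightarrow> 'm \<Rightarrow> 'v" where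
  "coord \<equiv> snd"

definition coord_inv :: "('m, 'v) chart \<Rightarrow> 'v \<Rightarrow> 'm" where
  "coord_inv c = inv_into (dom_of c) (coord c)"

definition carrier :: "('m, 'v) chart set \<Rightarrow> 'm set" where
  "carrier A = (\<Union>c\<in>A. dom_of c)"

definition half_space :: "(real \<times> 'e::euclidean_space) set" where
  "half_space = {z. 0 \<le> fst z}"

definition smooth_atlas ::
    "'v::euclidean_space set \<Rightarrow> ('m::{t2_space, second_countable_topology}, 'v) chart set \<Rightarrow> bool" where
  "smooth_atlas H A \<longleftrightarrow>
     (\<forall>c\<in>A. openin (top_of_set (carrier A)) (dom_of c) \<and>
             openin (top_of_set H) (coord c ` dom_of c) \<and>
             homeomorphism (dom_of c) (coord c ` dom_of c) (coord c) (coord_inv c)) \<and>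
     (\<forall>c\<in>A. \<forall>c'\<in>A. smooth_on (coord c ` (dom_of c \<inter> dom_of c')) (coord c' \<circ> coord_inv c))"

definition boundary :: "('m, real \<times> 'e::euclidean_space) chart set \<Rightarrow> 'm set" where
  "boundary A = {p. \<exists>c\<in>A. p \<in> dom_of c \<and> fst (coord c p) = 0}"

definition bulk :: "('m, real \<times> 'e::euclidean_space) chart set \<Rightarrow> 'm set" where
  "bulk A = carrier A - boundary A"

definition boundary_atlas ::
    "('m, real \<times> 'e::euclidean_space) chart set \<Rightarrow> ('m, 'e) chart set" where
  "boundary_atlas A = (\<lambda>c. (dom_of c \<inter> boundary A, snd \<circ> coord c)) ` A"

text \<open>The product of the half-line \<open>[0,\<infinity>)\<close> with a manifold without boundary.\<close>

definition cylinder_chart :: "('m, 'e) chart \<Rightarrow> (real \<times> 'm, real \<times> 'e) chart" where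
  "cylinder_chart b = ({0..} \<times> dom_of b, \<lambda>(s, p). (s, coord b p))"

definition cylinder_atlas :: "('m, 'e) chart set \<Rightarrow> (real \<times> 'm, real \<times> 'e) chart set" where
  "cylinder_atlas B = cylinder_chart ` B"

section \<open>Smooth maps and derivatives in charts\<close>

definition smooth_real_on :: "('m, 'v::euclidean_space) chart set \<Rightarrow> 'm set \<Rightarrow> ('m \<Rightarrow> real) \<Rightarrow> bool" where
  "smooth_real_on A Y f \<longleftrightarrow> (\<forall>c\<in>A. smooth_on (coord c ` (dom_of c \<inter> Y)) (f \<circ> coord_inv c))"

definition smooth_map ::
    "('m::topological_space, 'v::euclidean_space) chart set \<Rightarrow> 'm set \<Rightarrow>
     ('k::topological_space, 'w::euclidean_space) chart set \<Rightarrow> ('m \<Rightarrow> 'k) \<Rightarrow> bool" where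
  "smooth_map A Y A' F \<longleftrightarrow>
     continuous_on Y F \<and> F ` Y \<subseteq> carrier A' \<and>
     (\<forall>c\<in>A. \<forall>c'\<in>A'. smooth_on (coord c ` (dom_of c \<inter> Y \<inter> F -` dom_of c')) (coord c' \<circ> F \<circ> coord_inv c))"

definition diffeo ::
    "('m::topological_space, 'v::euclidean_space) chart set \<Rightarrow> 'm set \<Rightarrow>
     ('k::topological_space, 'w::euclidean_space) chart set \<Rightarrow> 'k set \<Rightarrow> ('m \<Rightarrow> 'k) \<Rightarrow> bool" where
  "diffeo A Y A' Y' F \<longleftrightarrow>
     bij_betw F Y Y' \<and> smooth_map A Y A' F \<and> smooth_map A' Y' A (inv_into Y F)"

text \<open>
  Derivatives are taken within the model space \<open>H\<close>, hence one-sided at boundary points,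
  where they are still unique.
\<close>

definition chart_deriv ::
    "'v::euclidean_space set \<Rightarrow> ('m, 'v) chart \<Rightarrow> ('k, 'w::euclidean_space) chart \<Rightarrow>
     ('m \<Rightarrow> 'k) \<Rightarrow> 'm \<Rightarrow> 'v \<Rightarrow> 'w" where
  "chart_deriv H c c' F p = frechet_derivative (coord c' \<circ> F \<circ> coord_inv c) (at (coord c p) within H)"

definition differential ::
    "'v::euclidean_space set \<Rightarrow> ('m, 'v) chart \<Rightarrow> ('m \<Rightarrow> real) \<Rightarrow> 'm \<Rightarrow> 'v \<Rightarrow> real" where
  "differential H c f p = frechet_derivative (f \<circ> coord_inv c) (at (coord c p) within H)"

section \<open>Covariant 2-tensors and Riemannian metrics\<close>

text \<open>
  A covariant 2-tensor field is given by its components: \<open>t c p u v\<close> is its value at \<open>p\<close> on the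
  two tangent vectors represented by \<open>u\<close> and \<open>v\<close> in the chart \<open>c\<close>.
\<close>

type_synonym ('m, 'v) tensor2 = "('m, 'v) chart \<Rightarrow> 'm \<Rightarrow> 'v \<Rightarrow> 'v \<Rightarrow> real"

definition tensor_law ::
    "'v::euclidean_space set \<Rightarrow> ('m, 'v) chart set \<Rightarrow> 'm set \<Rightarrow> ('m, 'v) tensor2 \<Rightarrow> bool" where
  "tensor_law H A Y t \<longleftrightarrow>
     (\<forall>c\<in>A. \<forall>c'\<in>A. \<forall>p\<in>dom_of c \<inter> dom_of c' \<inter> Y. \<forall>u v.
        t c p u v = t c' p (chart_deriv H c c' id p u) (chart_deriv H c c' id p v))"

definition metric_on ::
    "'v::euclidean_space set \<Rightarrow> ('m, 'v) chart set \<Rightarrow> 'm set \<Rightarrow> ('m, 'v) tensor2 \<Rightarrow> bool" where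
  "metric_on H A Y t \<longleftrightarrow>
     (\<forall>c\<in>A. \<forall>p\<in>dom_of c \<inter> Y.
        bilinear (t c p) \<and> (\<forall>u v. t c p u v = t c p v u) \<and> (\<forall>u. u \<noteq> 0 \<longrightarrow> t c p u u > 0)) \<and>
     tensor_law H A Y t \<and>
     (\<forall>c\<in>A. \<forall>u v. smooth_on (coord c ` (dom_of c \<inter> Y)) (\<lambda>z. t c (coord_inv c z) u v))"

text \<open>
  Raising an index with a nondegenerate bilinear form \<open>b\<close>, the induced squared norm
  \<open>b\<^sup>i\<^sup>j \<alpha>\<^sub>i \<alpha>\<^sub>j\<close> of a covector, and the trace \<open>b\<^sup>i\<^sup>j k\<^sub>i\<^sub>j\<close>.
\<close>

definition sharp :: "('v \<Rightarrow> 'v \<Rightarrow> real) \<Rightarrow> ('v \<Rightarrow> real) \<Rightarrow> 'v::euclidean_space" where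
  "sharp b \<alpha> = (THE w. \<forall>v. b w v = \<alpha> v)"

definition conorm2 :: "('v::euclidean_space \<Rightarrow> 'v \<Rightarrow> real) \<Rightarrow> ('v \<Rightarrow> real) \<Rightarrow> real" where
  "conorm2 b \<alpha> = \<alpha> (sharp b \<alpha>)"

definition trace_wrt :: "('v::euclidean_space \<Rightarrow> 'v \<Rightarrow> real) \<Rightarrow> ('v \<Rightarrow> 'v \<Rightarrow> real) \<Rightarrow> real" where
  "trace_wrt b k = (\<Sum>i\<in>Basis. sharp b (k i) \<bullet> i)"

section \<open>Conformal compactifications and special defining functions\<close>

text \<open>
  The atlas \<open>A\<close> describes the ambient manifold with boundary; \<open>M\<close> is identified with \<open>bulk A\<close>,
  and \<open>\<partial>\<^sub>\<infinity>M\<close> is \<open>boundary A\<close>.  The function \<open>x\<close> denotes the extended function on all of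
  \<open>carrier A\<close>.
\<close>

definition extends_conformally ::
    "('m, real \<times> 'e::euclidean_space) chart set \<Rightarrow> ('m, real \<times> 'e) tensor2 \<Rightarrow> ('m \<Rightarrow> real) \<Rightarrow>
     ('m, real \<times> 'e) tensor2 \<Rightarrow> bool" where
  "extends_conformally A g x gbar \<longleftrightarrow>
     metric_on half_space A (carrier A) gbar \<and>
     (\<forall>c\<in>A. \<forall>p\<in>dom_of c \<inter> bulk A. \<forall>u v. gbar c p u v = (x p)\<^sup>2 * g c p u v)"

definition defining_function ::
    "('m, real \<times> 'e::euclidean_space) chart set \<Rightarrow> ('m, real \<times> 'e) tensor2 \<Rightarrow> ('m \<Rightarrow> real) \<Rightarrow> bool" where
  "defining_function A g x \<longleftrightarrow>
     smooth_real_on A (carrier A) x \<and>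
     (\<forall>p\<in>bulk A. x p > 0) \<and>
     (\<forall>p\<in>boundary A. x p = 0) \<and>
     (\<forall>c\<in>A. \<forall>p\<in>dom_of c \<inter> boundary A. differential half_space c x p \<noteq> (\<lambda>v. 0)) \<and>
     (\<exists>gbar. extends_conformally A g x gbar)"

definition conformally_compactifiable ::
    "('m, real \<times> 'e::euclidean_space) chart set \<Rightarrow> ('m, real \<times> 'e) tensor2 \<Rightarrow> bool" where
  "conformally_compactifiable A g \<longleftrightarrow> (\<exists>x. defining_function A g x)"

definition collar ::
    "('m::topological_space, real \<times> 'e::euclidean_space) chart set \<Rightarrow> (real \<times> 'm) set \<Rightarrow>
     (real \<times> 'm \<Rightarrow> 'm) \<Rightarrow> bool" where
  "collar A W \<Phi> \<longleftrightarrow>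
     openin (top_of_set ({0..} \<times> boundary A)) W \<and>
     {0} \<times> boundary A \<subseteq> W \<and>
     openin (top_of_set (carrier A)) (\<Phi> ` W) \<and>
     diffeo (cylinder_atlas (boundary_atlas A)) W A (\<Phi> ` W) \<Phi> \<and>
     (\<forall>p\<in>boundary A. \<Phi> (0, p) = p)"

definition collar_neighbourhood ::
    "('m::topological_space, real \<times> 'e::euclidean_space) chart set \<Rightarrow> 'm set \<Rightarrow> bool" where
  "collar_neighbourhood A U \<longleftrightarrow>
     (\<exists>\<Phi>. collar A ({0..<1} \<times> boundary A) \<Phi> \<and> U = \<Phi> ` ({0..<1} \<times> boundary A))"

definition special_defining_function ::
    "('m::topological_space, real \<times> 'e::euclidean_space) chart set \<Rightarrow> ('m, real \<times> 'e) tensor2 \<Rightarrow>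
     ('m \<Rightarrow> real) \<Rightarrow> bool" where
  "special_defining_function A g x \<longleftrightarrow>
     defining_function A g x \<and>
     (\<exists>gbar U. extends_conformally A g x gbar \<and> collar_neighbourhood A U \<and>
        (\<forall>c\<in>A. \<forall>p\<in>dom_of c \<inter> U. conorm2 (gbar c p) (differential half_space c x p) = 1))"

definition asymptotically_hyperbolic ::
    "('m::topological_space, real \<times> 'e::euclidean_space) chart set \<Rightarrow> ('m, real \<times> 'e) tensor2 \<Rightarrow> bool" where
  "asymptotically_hyperbolic A g \<longleftrightarrow> (\<exists>x. special_defining_function A g x)"

section \<open>Normal form and expansion at the boundary\<close>

text \<open>
  \<open>W\<close> is an arbitrary open neighbourhood of \<open>{0} \<times> boundary A\<close>: if the boundary is not compact,
  the normal form need not hold on a product \<open>[0,\<epsilon>) \<times> boundary A\<close>.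
  Accordingly \<open>h s\<close> is a metric on the open subset of those \<open>p\<close> with \<open>(s, p) \<in> W\<close>.
\<close>

definition metric_family ::
    "('m, real \<times> 'e::euclidean_space) chart set \<Rightarrow> (real \<times> 'm) set \<Rightarrow>
     (real \<Rightarrow> ('m, 'e) tensor2) \<Rightarrow> bool" where
  "metric_family A W h \<longleftrightarrow>
     (\<forall>s. metric_on UNIV (boundary_atlas A) {p. (s, p) \<in> W} (h s)) \<and>
     (\<forall>b\<in>boundary_atlas A. \<forall>u v.
        smooth_on (coord (cylinder_chart b) ` (dom_of (cylinder_chart b) \<inter> W))
          (\<lambda>z. h (fst z) b (coord_inv b (snd z)) u v))"

text \<open>
  The collar \<open>\<Phi>\<close> has \<open>x\<close> as its first coordinate, and pulls back \<open>g\<close> to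
  \<open>s\<^sup>-\<^sup>2 (ds\<^sup>2 \<oplus> h\<^sub>s)\<close> where \<open>s > 0\<close>.
\<close>

definition normal_form ::
    "('m::topological_space, real \<times> 'e::euclidean_space) chart set \<Rightarrow> ('m, real \<times> 'e) tensor2 \<Rightarrow>
     ('m \<Rightarrow> real) \<Rightarrow> (real \<times> 'm) set \<Rightarrow> (real \<times> 'm \<Rightarrow> 'm) \<Rightarrow> (real \<Rightarrow> ('m, 'e) tensor2) \<Rightarrow> bool" where
  "normal_form A g x W \<Phi> h \<longleftrightarrow>
     collar A W \<Phi> \<and>
     metric_family A W h \<and>
     (\<forall>(s, p)\<in>W. x (\<Phi> (s, p)) = s) \<and>
     (\<forall>b\<in>boundary_atlas A. \<forall>c\<in>A. \<forall>s p. (s, p) \<in> W \<and> s > 0 \<and> p \<in> dom_of b \<and> \<Phi> (s, p) \<in> dom_of c \<longrightarrow>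
        (let L = chart_deriv half_space (cylinder_chart b) c \<Phi> (s, p) in
         \<forall>\<sigma> u \<tau> v. g c (\<Phi> (s, p)) (L (\<sigma>, u)) (L (\<tau>, v)) = 1 / s\<^sup>2 * (\<sigma> * \<tau> + h s b p u v)))"

text \<open>
  \<open>H k\<close> is the coefficient of \<open>s\<^sup>k\<close>.  The coefficients with \<open>k \<le> n\<close> are uniquely determined at
  each point by \<open>h\<close>, and so they are symmetric tensors if every \<open>h s\<close> is.
\<close>

definition has_expansion ::
    "nat \<Rightarrow> ('m, 'e) chart set \<Rightarrow> (real \<Rightarrow> ('m, 'e) tensor2) \<Rightarrow> (nat \<Rightarrow> ('m, 'e) tensor2) \<Rightarrow> bool" where
  "has_expansion n B h H \<longleftrightarrow>
     (\<forall>b\<in>B. \<forall>p\<in>dom_of b. \<forall>u v.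
        (\<lambda>s. h s b p u v - (\<Sum>k\<le>n. s ^ k * H k b p u v)) \<in> O[at_right 0](\<lambda>s. s ^ (n + 1)))"

definition partially_even ::
    "nat \<Rightarrow> ('m, 'e) chart set \<Rightarrow> (real \<Rightarrow> ('m, 'e) tensor2) \<Rightarrow> bool" where
  "partially_even n B h \<longleftrightarrow>
     (\<exists>H. has_expansion n B h H \<and>
        (\<forall>k<n - 1. odd k \<longrightarrow> (\<forall>b\<in>B. \<forall>p\<in>dom_of b. \<forall>u v. H k b p u v = 0)))"

definition kappa :: "nat \<Rightarrow> (nat \<Rightarrow> ('m, 'e) tensor2) \<Rightarrow> ('m, 'e) tensor2" where
  "kappa n H = (\<lambda>b p u v. real n * H n b p u v)"

definition mu :: "nat \<Rightarrow> (nat \<Rightarrow> ('m, 'e::euclidean_space) tensor2) \<Rightarrow> ('m, 'e) chart \<Rightarrow> 'm \<Rightarrow> real" where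
  "mu n H b p = trace_wrt (H 0 b p) (kappa n H b p)"

end

theory Submission
  imports Defs
begin

text \<open>
  The transition map between the two collars is an isometry \<open>(s, y) \<mapsto> (X, Y)\<close> with
  \<open>X = 0\<close>, \<open>Y = y\<close> at \<open>s = 0\<close>, and its normal, mixed and tangential components read
  \<open>s\<^sup>2 (X\<^sub>s\<^sup>2 + h\<^sub>X(Y\<^sub>s, Y\<^sub>s)) = X\<^sup>2\<close>, \<open>X\<^sub>s X\<^sub>u + h\<^sub>X(Y\<^sub>s, Y\<^sub>u) = 0\<close> and
  \<open>s\<^sup>2 (X\<^sub>u X\<^sub>v + h\<^sub>X(Y\<^sub>u, Y\<^sub>v)) = X\<^sup>2 hh\<^sub>s(u, v)\<close>.  All functions are extended smoothly to
  \<open>s < 0\<close>, where the equations persist modulo functions that are flat at \<open>s = 0\<close>, so that evenness and oddness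
  can be tested by the reflection \<open>s \<mapsto> - s\<close>.  Since \<open>h\<close> is even modulo \<open>O(s\<^sup>n)\<close>, the second equation
  improves the order to which \<open>Y\<close> is even, the first one the order to which \<open>X\<close> is odd, and after
  \<open>n\<close> steps \<open>X\<close> is odd modulo \<open>O(s\<^sup>n\<^sup>+\<^sup>2)\<close> and \<open>Y\<close> even modulo \<open>O(s\<^sup>n\<^sup>+\<^sup>1)\<close>.  In the third equation the
  first odd contribution therefore comes from the term \<open>X\<^sup>n h\<^sub>n\<close> of \<open>h\<^sub>X\<close>, which gives
  \<open>hh\<^sub>n = a\<^sup>n\<^sup>-\<^sup>2 h\<^sub>n\<close> with \<open>a = X\<^sub>s(0, y) = exp (- \<omega>0)\<close>; the trace contributes the remaining factor \<open>a\<^sup>2\<close>.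
\<close>

section \<open>Calculus of smooth functions\<close>

text \<open>Each improvement rests on factors that vanish at the boundary: \<open>Y\<^sub>s\<close>
  and \<open>X\<^sub>u\<close> are \<open>O(s)\<close>, so a parity error of
  \<open>h\<^sub>X\<close> enters the mixed equation multiplied by \<open>s\<close> and the normal
  one multiplied by \<open>s\<^sup>2\<close>. In the normal equation the defect
  \<open>D(s) = X(s) + X(- s)\<close> satisfies \<open>s D' - D = O(s ^ (m + 2))\<close>. A leading
  term \<open>d s ^ (m + 1)\<close> of \<open>D\<close> contributes \<open>m d s ^ (m + 1)\<close>
  to the left side, so \<open>d = 0\<close> as soon as \<open>m \<ge> 1\<close>. The linear
  coefficient \<open>a\<close> of \<open>X\<close> escapes this singular equation; it is determined
  by comparing the two boundary metrics, and its sign by \<open>X > 0\<close>. Two obstacles shape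
  the proof. Growth bounds cannot be differentiated, while the equations contain derivatives along
  the boundary; hence bounds on the lines \<open>y = const\<close> are turned into vanishing Taylor
  coefficients at all boundary points near \<open>y0\<close>, differentiated there, and turned back.
  Moreover \<open>h\<close> is evaluated at the moving point \<open>(X, Y)\<close>, so its expansion
  must be uniform in the boundary point, and \<open>(X(- s), Y(- s))\<close> must be compared with
  \<open>(- X(s), Y(s))\<close> by a Lipschitz estimate.\<close>

lemma Ck_on_SucD: "Ck_on (Suc k) S f \<Longrightarrow> Ck_on k S f"
proof (induction k arbitrary: f)
  case 0
  then show ?case
    by (auto intro!: continuous_at_imp_continuous_on differentiable_imp_continuous_within)
next
  case (Suc k)
  have "\<forall>z\<in>S. f differentiable (at z)" using Suc.prems by simp
  moreover have "Ck_on k S (\<lambda>z. frechet_derivative f (at z) v)" for v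
  proof -
    have "Ck_on (Suc k) S (\<lambda>z. frechet_derivative f (at z) v)"
      using Suc.prems Ck_on.simps(2) by blast
    then show ?thesis by (rule Suc.IH)
  qed
  ultimately show ?case by simp
qed

lemma Ck_on_cong:
  assumes "open S" "\<And>z. z \<in> S \<Longrightarrow> f z = g z" "Ck_on k S f"
  shows "Ck_on k S g"
  using assms(2,3)
proof (induction k arbitrary: f g)
  case 0
  then show ?case using continuous_on_cong by fastforce
next
  case (Suc k)
  have fd: "f differentiable (at z)" if "z \<in> S" for z using Suc.prems that by simp
  have "g differentiable (at z)" if "z \<in> S" for z
    using fd[OF that] Suc.prems(1) assms(1) that
    by (meson differentiable_def has_derivative_transform_within_open)
  moreover have "Ck_on k S (\<lambda>z. frechet_derivative g (at z) v)" for v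
  proof (rule Suc.IH)
    show "frechet_derivative f (at z) v = frechet_derivative g (at z) v" if "z \<in> S" for z
      using frechet_derivative_transform_within_open[OF fd[OF that] assms(1) that] Suc.prems(1) by metis
    show "Ck_on k S (\<lambda>z. frechet_derivative f (at z) v)" using Suc.prems(2) by simp
  qed
  ultimately show ?case by simp
qed

lemma Ck_on_subset: "Ck_on k S f \<Longrightarrow> T \<subseteq> S \<Longrightarrow> Ck_on k T f"
  by (induction k arbitrary: f) (auto intro: continuous_on_subset)

lemma Ck_on_const: "Ck_on k S (\<lambda>z. c)"
  by (induction k arbitrary: c) (auto simp: frechet_derivative_const)

text \<open>Lets derivatives produced by the calculus rules be used directly: derivatives are
  unique, so they agree on \<open>S\<close> with the chosen
  \<open>frechet_derivative\<close>.\<close>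

lemma Ck_on_SucI:
  assumes "open S" "\<And>z. z \<in> S \<Longrightarrow> (f has_derivative f' z) (at z)"
    "\<And>v. Ck_on k S (\<lambda>z. f' z v)"
  shows "Ck_on (Suc k) S f"
proof -
  have "f differentiable (at z)" if "z \<in> S" for z
    using assms(2)[OF that] differentiable_def by blast
  moreover have "Ck_on k S (\<lambda>z. frechet_derivative f (at z) v)" for v
    by (rule Ck_on_cong[OF assms(1) _ assms(3)[of v]])
      (use frechet_derivative_at[OF assms(2)] in metis)
  ultimately show ?thesis by simp
qed

lemma Ck_on_bounded_linear:
  assumes "open S" "bounded_linear L"
  shows "Ck_on k S L"
proof (cases k)
  case 0
  then show ?thesis using assms(2) by (simp add: linear_continuous_on)
next
  case (Suc m)
  show ?thesis unfolding Suc
    by (rule Ck_on_SucI[OF assms(1) bounded_linear_imp_has_derivative[OF assms(2)] Ck_on_const])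
qed

lemma Ck_on_has_derivative:
  "Ck_on (Suc k) S f \<Longrightarrow> z \<in> S \<Longrightarrow> (f has_derivative frechet_derivative f (at z)) (at z)"
  by (simp add: frechet_derivative_works)

lemma Ck_on_compose_bounded_linear:
  assumes S: "open S" and L: "bounded_linear L" and f: "Ck_on k S f"
  shows "Ck_on k S (\<lambda>z. L (f z))"
  using f
proof (induction k arbitrary: f)
  case 0
  then show ?case by (simp add: L bounded_linear.continuous_on)
next
  case (Suc k)
  show ?case
  proof (rule Ck_on_SucI[OF S])
    show "((\<lambda>z. L (f z)) has_derivative (\<lambda>v. L (frechet_derivative f (at z) v))) (at z)" if "z \<in> S" for z
      using bounded_linear.has_derivative[OF L Ck_on_has_derivative[OF Suc.prems that]] .
    show "Ck_on k S (\<lambda>z. L (frechet_derivative f (at z) v))" for v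
      using Suc.IH[of "\<lambda>z. frechet_derivative f (at z) v"] Suc.prems by simp
  qed
qed

lemma Ck_on_add:
  assumes S: "open S" and f: "Ck_on k S f" and g: "Ck_on k S g"
  shows "Ck_on k S (\<lambda>z. f z + g z)"
  using f g
proof (induction k arbitrary: f g)
  case 0
  then show ?case by (simp add: continuous_on_add)
next
  case (Suc k)
  show ?case
    by (rule Ck_on_SucI[OF S has_derivative_add[OF Ck_on_has_derivative[OF Suc.prems(1)]
      Ck_on_has_derivative[OF Suc.prems(2)]]])
      (auto intro!: Suc.IH simp del: Ck_on.simps simp: Suc.prems[unfolded Ck_on.simps])
qed

lemma Ck_on_sum:
  assumes S: "open S" and f: "\<And>i. i \<in> I \<Longrightarrow> Ck_on k S (f i)"
  shows "Ck_on k S (\<lambda>z. \<Sum>i\<in>I. f i z)"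
  using f
proof (induction I rule: infinite_finite_induct)
  case (insert i I)
  then show ?case by (simp add: Ck_on_add[OF S])
qed (simp_all add: Ck_on_const)

lemma Ck_on_scaleR:
  assumes S: "open S" and f: "Ck_on k S f" and g: "Ck_on k S g"
  shows "Ck_on k S (\<lambda>z. f z *\<^sub>R g z)"
  using f g
proof (induction k arbitrary: f g)
  case 0
  then show ?case by (simp add: continuous_on_scaleR)
next
  case (Suc k)
  note f = Ck_on_SucD[OF Suc.prems(1)] and g = Ck_on_SucD[OF Suc.prems(2)]
  show ?case
    by (rule Ck_on_SucI[OF S has_derivative_scaleR[OF Ck_on_has_derivative[OF Suc.prems(1)]
      Ck_on_has_derivative[OF Suc.prems(2)]]])
      (auto intro!: Ck_on_add[OF S] Suc.IH f g simp del: Ck_on.simps simp: Suc.prems[unfolded Ck_on.simps])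
qed

lemma Ck_on_compose:
  assumes S: "open S" and g: "Ck_on k S g" and f: "Ck_on k T f" and sub: "g ` S \<subseteq> T"
  shows "Ck_on k S (\<lambda>z. f (g z))"
  using f g
proof (induction k arbitrary: f)
  case 0
  then show ?case using sub by (auto intro: continuous_on_compose2)
next
  case (Suc k)
  let ?f' = "\<lambda>z. frechet_derivative f (at z)" and ?g' = "\<lambda>z. frechet_derivative g (at z)"
  have g': "Ck_on k S g" using Ck_on_SucD[OF Suc.prems(2)] .
  show ?case
  proof (rule Ck_on_SucI[OF S])
    fix z assume z: "z \<in> S"
    have f1: "(f has_derivative ?f' (g z)) (at (g z))"
      using Ck_on_has_derivative[OF Suc.prems(1)] sub z by blast
    have 1: "((\<lambda>z. f (g z)) has_derivative (\<lambda>v. ?f' (g z) (?g' z v))) (at z)"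
      using diff_chain_at[OF Ck_on_has_derivative[OF Suc.prems(2) z] f1] by (simp add: o_def)
    \<comment> \<open>The direction \<open>w\<close> will be \<open>?g' z v\<close>, which moves
      with \<open>z\<close>, whereas \<open>Ck_on\<close> speaks of derivatives in fixed directions.
      Expansion in the basis turns the chain rule into a sum of products, accessible to the
      induction hypothesis and the product rule.\<close>
    have 2: "?f' (g z) w = (\<Sum>i\<in>Basis. (w \<bullet> i) *\<^sub>R ?f' (g z) i)" for w
    proof -
      have lin: "linear (?f' (g z))" using has_derivative_linear[OF f1] .
      have "?f' (g z) w = ?f' (g z) (\<Sum>i\<in>Basis. (w \<bullet> i) *\<^sub>R i)"
        by (simp only: euclidean_representation)
      then show ?thesis by (simp only: linear_sum[OF lin] linear_cmul[OF lin])
    qed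
    show "((\<lambda>z. f (g z)) has_derivative (\<lambda>v. \<Sum>i\<in>Basis. (?g' z v \<bullet> i) *\<^sub>R ?f' (g z) i)) (at z)"
      by (rule has_derivative_eq_rhs[OF 1]) (rule ext, rule 2)
  next
    fix v
    have "Ck_on k S (\<lambda>z. ?g' z v \<bullet> i)" for i
      by (rule Ck_on_compose_bounded_linear[OF S bounded_linear_inner_left]) (use Suc.prems in simp)
    moreover have "Ck_on k S (\<lambda>z. ?f' (g z) i)" for i
      using Suc.IH[of "\<lambda>z. ?f' z i"] Suc.prems g' by simp
    ultimately show "Ck_on k S (\<lambda>z. \<Sum>i\<in>Basis. (?g' z v \<bullet> i) *\<^sub>R ?f' (g z) i)"
      by (intro Ck_on_sum[OF S] Ck_on_scaleR[OF S])
  qed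
qed

text \<open>Openness of the domain is part of the notion, so the class is closed under
  \<open>frechet_derivative\<close> in a fixed direction. \<open>smooth_on\<close> is the local
  existence of extensions of this kind.\<close>

definition Cinf_on :: "'a::euclidean_space set \<Rightarrow> ('a \<Rightarrow> 'b::real_normed_vector) \<Rightarrow> bool" where
  "Cinf_on S f \<longleftrightarrow> open S \<and> (\<forall>k. Ck_on k S f)"

lemma Cinf_on_open: "Cinf_on S f \<Longrightarrow> open S"
  by (simp add: Cinf_on_def)

lemma Cinf_on_has_derivative:
  "Cinf_on S f \<Longrightarrow> z \<in> S \<Longrightarrow> (f has_derivative frechet_derivative f (at z)) (at z)"
  unfolding Cinf_on_def using Ck_on_has_derivative by blast

lemma Cinf_on_frechet_derivative:
  "Cinf_on S f \<Longrightarrow> Cinf_on S (\<lambda>z. frechet_derivative f (at z) v)"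
  unfolding Cinf_on_def using Ck_on.simps(2) by blast

lemma Cinf_on_isCont: "Cinf_on S f \<Longrightarrow> z \<in> S \<Longrightarrow> isCont f z"
  using Cinf_on_has_derivative has_derivative_continuous by blast

lemma Cinf_on_subset: "Cinf_on S f \<Longrightarrow> open T \<Longrightarrow> T \<subseteq> S \<Longrightarrow> Cinf_on T f"
  unfolding Cinf_on_def using Ck_on_subset by blast

lemma Cinf_on_const: "open S \<Longrightarrow> Cinf_on S (\<lambda>z. c)"
  by (simp add: Cinf_on_def Ck_on_const)

lemma Cinf_on_bounded_linear: "open S \<Longrightarrow> bounded_linear L \<Longrightarrow> Cinf_on S L"
  by (simp add: Cinf_on_def Ck_on_bounded_linear)

lemma Cinf_on_compose_bounded_linear:
  "bounded_linear L \<Longrightarrow> Cinf_on S f \<Longrightarrow> Cinf_on S (\<lambda>z. L (f z))"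
  by (simp add: Cinf_on_def Ck_on_compose_bounded_linear)

lemma Cinf_on_add: "Cinf_on S f \<Longrightarrow> Cinf_on S g \<Longrightarrow> Cinf_on S (\<lambda>z. f z + g z)"
  by (simp add: Cinf_on_def Ck_on_add)

lemma Cinf_on_minus: "Cinf_on S f \<Longrightarrow> Cinf_on S (\<lambda>z. - f z)"
  using Cinf_on_compose_bounded_linear[OF bounded_linear_minus[OF bounded_linear_ident]] .

lemma Cinf_on_diff: "Cinf_on S f \<Longrightarrow> Cinf_on S g \<Longrightarrow> Cinf_on S (\<lambda>z. f z - g z)"
  using Cinf_on_add[of S f "\<lambda>z. - g z"] Cinf_on_minus[of S g] by simp

lemma Cinf_on_sum:
  "open S \<Longrightarrow> (\<And>i. i \<in> I \<Longrightarrow> Cinf_on S (f i)) \<Longrightarrow> Cinf_on S (\<lambda>z. \<Sum>i\<in>I. f i z)"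
  by (simp add: Cinf_on_def Ck_on_sum)

lemma Cinf_on_scaleR: "Cinf_on S f \<Longrightarrow> Cinf_on S g \<Longrightarrow> Cinf_on S (\<lambda>z. f z *\<^sub>R g z)"
  by (simp add: Cinf_on_def Ck_on_scaleR)

lemma Cinf_on_mult:
  fixes f g :: "_ \<Rightarrow> real"
  shows "Cinf_on S f \<Longrightarrow> Cinf_on S g \<Longrightarrow> Cinf_on S (\<lambda>z. f z * g z)"
  using Cinf_on_scaleR[of S f g] by simp

lemma Cinf_on_inner: "Cinf_on S f \<Longrightarrow> Cinf_on S (\<lambda>z. f z \<bullet> i)"
  using Cinf_on_compose_bounded_linear[OF bounded_linear_inner_left] .

lemma Cinf_on_compose:
  "Cinf_on T f \<Longrightarrow> Cinf_on S g \<Longrightarrow> g ` S \<subseteq> T \<Longrightarrow> Cinf_on S (\<lambda>z. f (g z))"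
  unfolding Cinf_on_def using Ck_on_compose by blast

lemma Cinf_on_Pair:
  assumes "Cinf_on S f" "Cinf_on S g"
  shows "Cinf_on S (\<lambda>z. (f z, g z))"
proof -
  have 1: "bounded_linear (\<lambda>x. (x, 0::'c))" for x :: 'b
    by (intro bounded_linear_Pair bounded_linear_ident bounded_linear_zero)
  have 2: "bounded_linear (\<lambda>x. (0::'b, x))" for x :: 'c
    by (intro bounded_linear_Pair bounded_linear_ident bounded_linear_zero)
  show ?thesis
    using Cinf_on_add[OF Cinf_on_compose_bounded_linear[OF 1 assms(1)]
      Cinf_on_compose_bounded_linear[OF 2 assms(2)]] by simp
qed

section \<open>Symmetry of second derivatives\<close>

text \<open>Two applications of the mean value theorem: along \<open>a\<close> to the increment of
  \<open>f\<close> in direction \<open>b\<close>, and then along \<open>b\<close> to the derivative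
  of \<open>f\<close> in direction \<open>a\<close>. The parallelogram has to lie in
  \<open>S\<close>, which \<open>sub\<close> provides.\<close>

lemma second_difference_mvt:
  fixes f :: "'a::euclidean_space \<Rightarrow> real"
  assumes f: "Cinf_on S f" and t: "0 < t"
    and sub: "\<And>p q. 0 \<le> p \<Longrightarrow> p \<le> t \<Longrightarrow> 0 \<le> q \<Longrightarrow> q \<le> t \<Longrightarrow> z + p *\<^sub>R a + q *\<^sub>R b \<in> S"
  shows "\<exists>p q. 0 \<le> p \<and> p \<le> t \<and> 0 \<le> q \<and> q \<le> t \<and>
    f (z + t *\<^sub>R a + t *\<^sub>R b) - f (z + t *\<^sub>R a) - f (z + t *\<^sub>R b) + f z =
    t * t * frechet_derivative (\<lambda>z. frechet_derivative f (at z) a) (at (z + p *\<^sub>R a + q *\<^sub>R b)) b"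
proof -
  define fa where "fa = (\<lambda>z. frechet_derivative f (at z) a)"
  have fa: "Cinf_on S fa" unfolding fa_def by (rule Cinf_on_frechet_derivative[OF f])
  have d1: "((\<lambda>p. f (z + p *\<^sub>R a + q *\<^sub>R b)) has_real_derivative fa (z + p *\<^sub>R a + q *\<^sub>R b)) (at p)"
    if "0 \<le> p" "p \<le> t" "0 \<le> q" "q \<le> t" for p q
  proof -
    have "((\<lambda>p. z + p *\<^sub>R a + q *\<^sub>R b) has_derivative (\<lambda>h. h *\<^sub>R a)) (at p)"
      by (auto intro!: derivative_eq_intros)
    from diff_chain_at[OF this Cinf_on_has_derivative[OF f sub[OF that]]]
    have "((\<lambda>p. f (z + p *\<^sub>R a + q *\<^sub>R b)) has_derivative
        (\<lambda>h. frechet_derivative f (at (z + p *\<^sub>R a + q *\<^sub>R b)) (h *\<^sub>R a))) (at p)"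
      by (simp add: o_def)
    moreover have "frechet_derivative f (at (z + p *\<^sub>R a + q *\<^sub>R b)) (h *\<^sub>R a) = fa (z + p *\<^sub>R a + q *\<^sub>R b) * h" for h
      using linear_cmul[OF has_derivative_linear[OF Cinf_on_has_derivative[OF f sub[OF that]]]]
      by (simp add: fa_def)
    ultimately show ?thesis unfolding has_field_derivative_def by simp
  qed
  have d2: "((\<lambda>q. fa (z + p *\<^sub>R a + q *\<^sub>R b)) has_real_derivative
      frechet_derivative fa (at (z + p *\<^sub>R a + q *\<^sub>R b)) b) (at q)"
    if "0 \<le> p" "p \<le> t" "0 \<le> q" "q \<le> t" for p q
  proof -
    have "((\<lambda>q. z + p *\<^sub>R a + q *\<^sub>R b) has_derivative (\<lambda>h. h *\<^sub>R b)) (at q)"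
      by (auto intro!: derivative_eq_intros)
    from diff_chain_at[OF this Cinf_on_has_derivative[OF fa sub[OF that]]]
    have "((\<lambda>q. fa (z + p *\<^sub>R a + q *\<^sub>R b)) has_derivative
        (\<lambda>h. frechet_derivative fa (at (z + p *\<^sub>R a + q *\<^sub>R b)) (h *\<^sub>R b))) (at q)"
      by (simp add: o_def)
    moreover have "frechet_derivative fa (at (z + p *\<^sub>R a + q *\<^sub>R b)) (h *\<^sub>R b) =
        frechet_derivative fa (at (z + p *\<^sub>R a + q *\<^sub>R b)) b * h" for h
      using linear_cmul[OF has_derivative_linear[OF Cinf_on_has_derivative[OF fa sub[OF that]]]]
      by simp
    ultimately show ?thesis unfolding has_field_derivative_def by simp
  qed
  define \<phi> where "\<phi> = (\<lambda>p. f (z + p *\<^sub>R a + t *\<^sub>R b) - f (z + p *\<^sub>R a + 0 *\<^sub>R b))"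
  have "\<exists>p. 0 < p \<and> p < t \<and> \<phi> t - \<phi> 0 =
      (t - 0) * (fa (z + p *\<^sub>R a + t *\<^sub>R b) - fa (z + p *\<^sub>R a + 0 *\<^sub>R b))"
    by (rule MVT2[OF t]) (unfold \<phi>_def, intro DERIV_diff d1, use t in auto)
  then obtain p where p: "0 < p" "p < t"
    and e1: "\<phi> t - \<phi> 0 = t * (fa (z + p *\<^sub>R a + t *\<^sub>R b) - fa (z + p *\<^sub>R a + 0 *\<^sub>R b))" by auto
  have "\<exists>q. 0 < q \<and> q < t \<and> fa (z + p *\<^sub>R a + t *\<^sub>R b) - fa (z + p *\<^sub>R a + 0 *\<^sub>R b) =
      (t - 0) * frechet_derivative fa (at (z + p *\<^sub>R a + q *\<^sub>R b)) b"
    by (rule MVT2[OF t]) (intro d2, use p in auto)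
  then obtain q where q: "0 < q" "q < t"
    and e2: "fa (z + p *\<^sub>R a + t *\<^sub>R b) - fa (z + p *\<^sub>R a + 0 *\<^sub>R b) =
      t * frechet_derivative fa (at (z + p *\<^sub>R a + q *\<^sub>R b)) b" by auto
  have "f (z + t *\<^sub>R a + t *\<^sub>R b) - f (z + t *\<^sub>R a) - f (z + t *\<^sub>R b) + f z = \<phi> t - \<phi> 0"
    by (simp add: \<phi>_def)
  then show ?thesis using e1 e2 p q unfolding fa_def[symmetric]
    by (intro exI[of _ p] exI[of _ q]) (simp add: less_imp_le)
qed

text \<open>The second difference of \<open>f\<close> is symmetric in the two directions, and its quotient tends to the
  mixed derivative.\<close>

lemma frechet_derivative_commute:
  fixes f :: "'a::euclidean_space \<Rightarrow> real"
  assumes f: "Cinf_on S f" and z: "z \<in> S"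
  shows "frechet_derivative (\<lambda>z. frechet_derivative f (at z) a) (at z) b =
    frechet_derivative (\<lambda>z. frechet_derivative f (at z) b) (at z) a"
proof -
  define P where "P = (\<lambda>a b z. frechet_derivative (\<lambda>z. frechet_derivative f (at z) a) (at z) b)"
  define \<Delta> where "\<Delta> = (\<lambda>a b t. (f (z + t *\<^sub>R a + t *\<^sub>R b) - f (z + t *\<^sub>R a) - f (z + t *\<^sub>R b) + f z) / (t * t))"
  have lim: "(\<Delta> a b \<longlongrightarrow> P a b z) (at_right 0)" for a b
  proof (rule tendstoI)
    fix e :: real assume e: "0 < e"
    have "isCont (P a b) z" unfolding P_def
      by (rule Cinf_on_isCont[OF _ z]) (intro Cinf_on_frechet_derivative f)
    then obtain d1 where d1: "d1 > 0" "\<And>w. dist w z < d1 \<Longrightarrow> dist (P a b w) (P a b z) < e"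
      unfolding continuous_at_eps_delta using e by (metis dist_commute)
    obtain d2 where d2: "d2 > 0" "\<And>w. dist w z < d2 \<Longrightarrow> w \<in> S"
      using Cinf_on_open[OF f] z unfolding open_dist by blast
    \<comment> \<open>Small enough for the whole parallelogram of side parameter
      \<open>t < d\<close> to stay within both radii; the summand 1 keeps the denominator positive
      when \<open>a\<close> and \<open>b\<close> are both zero.\<close>
    define d where "d = min d1 d2 / (norm a + norm b + 1)"
    have nn: "0 < norm a + norm b + 1" using norm_ge_zero[of a] norm_ge_zero[of b] by linarith
    have dpos: "d > 0" using d1 d2 nn by (simp add: d_def)
    have near: "dist (z + p *\<^sub>R a + q *\<^sub>R b) z < min d1 d2"
      if "0 \<le> p" "p \<le> t" "0 \<le> q" "q \<le> t" "t < d" for p q t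
    proof -
      have "dist (z + p *\<^sub>R a + q *\<^sub>R b) z = norm (p *\<^sub>R a + q *\<^sub>R b)"
        by (simp add: dist_norm)
      also have "\<dots> \<le> p * norm a + q * norm b"
        using norm_triangle_ineq[of "p *\<^sub>R a" "q *\<^sub>R b"] that by simp
      also have "\<dots> \<le> t * norm a + t * norm b"
        using that by (intro add_mono mult_right_mono) auto
      also have "\<dots> \<le> t * (norm a + norm b + 1)" using that by (simp add: algebra_simps)
      also have "\<dots> < d * (norm a + norm b + 1)" using that nn by simp
      also have "\<dots> = min d1 d2" using nn by (simp add: d_def)
      finally show ?thesis .
    qed
    have "dist (\<Delta> a b t) (P a b z) < e" if t: "0 < t" "t < d" for t
    proof -
      have "z + p *\<^sub>R a + q *\<^sub>R b \<in> S" if "0 \<le> p" "p \<le> t" "0 \<le> q" "q \<le> t" for p q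
        using d2(2) near[OF that t(2)] by simp
      from second_difference_mvt[OF f t(1) this]
      obtain p q where pq: "0 \<le> p" "p \<le> t" "0 \<le> q" "q \<le> t"
        and "f (z + t *\<^sub>R a + t *\<^sub>R b) - f (z + t *\<^sub>R a) - f (z + t *\<^sub>R b) + f z = t * t * P a b (z + p *\<^sub>R a + q *\<^sub>R b)"
        unfolding P_def by blast
      then have "\<Delta> a b t = P a b (z + p *\<^sub>R a + q *\<^sub>R b)" using t by (simp add: \<Delta>_def)
      then show ?thesis using d1(2) near[OF pq t(2)] by simp
    qed
    then show "\<forall>\<^sub>F t in at_right 0. dist (\<Delta> a b t) (P a b z) < e"
      unfolding eventually_at_right_field using dpos by blast
  qed
  have sym: "\<Delta> a b = \<Delta> b a" unfolding \<Delta>_def by (intro ext) (simp add: algebra_simps)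
  have "P a b z = P b a z"
    by (rule tendsto_unique[OF _ lim[of a b]]) (use lim[of b a] in \<open>simp_all add: sym\<close>)
  then show ?thesis by (simp add: P_def)
qed

section \<open>Taylor expansion in the first variable\<close>

definition ds :: "(real \<times> 'e::euclidean_space \<Rightarrow> real) \<Rightarrow> real \<times> 'e \<Rightarrow> real" where
  "ds F z = frechet_derivative F (at z) (1, 0)"

text \<open>The order of vanishing is recorded by Taylor coefficients and not by growth, because
  only in this form can it be differentiated along the boundary.\<close>

definition vanishes :: "nat \<Rightarrow> (real \<times> 'e::euclidean_space \<Rightarrow> real) \<Rightarrow> 'e \<Rightarrow> bool" where
  "vanishes m F y \<longleftrightarrow> (\<forall>k<m. (ds ^^ k) F (0, y) = 0)"

lemma Cinf_on_ds: "Cinf_on S F \<Longrightarrow> Cinf_on S (ds F)"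
  unfolding ds_def using Cinf_on_frechet_derivative .

lemma Cinf_on_ds_pow: "Cinf_on S F \<Longrightarrow> Cinf_on S ((ds ^^ k) F)"
  by (induction k) (auto intro: Cinf_on_ds)

lemma has_real_derivative_line:
  fixes F :: "'a::euclidean_space \<Rightarrow> real"
  assumes "Cinf_on S F" "a + t *\<^sub>R v \<in> S"
  shows "((\<lambda>t. F (a + t *\<^sub>R v)) has_real_derivative frechet_derivative F (at (a + t *\<^sub>R v)) v) (at t)"
proof -
  note D = Cinf_on_has_derivative[OF assms]
  have "((\<lambda>t. a + t *\<^sub>R v) has_derivative (\<lambda>h. h *\<^sub>R v)) (at t)"
    by (auto intro!: derivative_eq_intros)
  from diff_chain_at[OF this D]
  have "((\<lambda>t. F (a + t *\<^sub>R v)) has_derivative (\<lambda>h. frechet_derivative F (at (a + t *\<^sub>R v)) (h *\<^sub>R v))) (at t)"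
    by (simp add: o_def)
  moreover have "(\<lambda>h. frechet_derivative F (at (a + t *\<^sub>R v)) (h *\<^sub>R v)) = (*) (frechet_derivative F (at (a + t *\<^sub>R v)) v)"
    by (rule ext) (simp only: linear_cmul[OF has_derivative_linear[OF D]] real_scaleR_def mult.commute)
  ultimately show ?thesis by (simp only: has_field_derivative_def)
qed

lemma has_real_derivative_ds:
  assumes "Cinf_on S F" "(t, y) \<in> S"
  shows "((\<lambda>t. F (t, y)) has_real_derivative ds F (t, y)) (at t)"
  using has_real_derivative_line[of S F "(0, y)" t "(1, 0)"] assms by (simp add: ds_def)

lemma filterlim_slice: "filterlim (\<lambda>s::real. (s, y)) (nhds (0, y)) (at 0)"
  by (intro tendsto_Pair tendsto_ident_at tendsto_const)

text \<open>The remainder is uniform in \<open>snd z\<close>, because \<open>h\<close> has to be expanded along the moving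
  points \<open>(X, Y)\<close>.\<close>

lemma taylor_uniform:
  assumes F: "Cinf_on S F" and y: "(0, y) \<in> S"
  shows "(\<lambda>z. F z - (\<Sum>k<m. (ds ^^ k) F (0, snd z) / fact k * fst z ^ k)) \<in> O[nhds (0, y)](\<lambda>z. fst z ^ m)"
proof -
  have "isCont ((ds ^^ m) F) (0, y)" using Cinf_on_isCont[OF Cinf_on_ds_pow[OF F] y] .
  then obtain d1 where d1: "d1 > 0"
    "\<And>z. dist z (0, y) < d1 \<Longrightarrow> dist ((ds ^^ m) F z) ((ds ^^ m) F (0, y)) < 1"
    unfolding continuous_at_eps_delta using zero_less_one by blast
  obtain d2 where d2: "d2 > 0" "\<And>z. dist z (0, y) < d2 \<Longrightarrow> z \<in> S"
    using Cinf_on_open[OF F] y unfolding open_dist by blast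
  define C where "C = \<bar>(ds ^^ m) F (0, y)\<bar> + 1"
  have "norm (F z - (\<Sum>k<m. (ds ^^ k) F (0, snd z) / fact k * fst z ^ k)) \<le> C * norm (fst z ^ m)"
    if z: "dist z (0, y) < min d1 d2" for z
  proof -
    obtain s w where zs: "z = (s, w)" by force
    \<comment> \<open>The segment from \<open>(0, w)\<close> to \<open>(s, w)\<close> is nowhere
      farther from \<open>(0, y)\<close> than its end, so the Lagrange remainder is taken at a point
      where \<open>C\<close> bounds the derivative of order \<open>m\<close>.\<close>
    have near: "dist (t, w) (0, y) < min d1 d2" if "\<bar>t\<bar> \<le> \<bar>s\<bar>" for t
    proof -
      have "dist (t, w) (0, y) \<le> dist z (0, y)"
        unfolding zs dist_Pair_Pair using that by (intro real_sqrt_le_mono add_mono power_mono) auto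
      then show ?thesis using z by simp
    qed
    have "\<exists>t. \<bar>t\<bar> \<le> \<bar>s\<bar> \<and> F (s, w) = (\<Sum>k<m. (ds ^^ k) F (0, w) / fact k * s ^ k) + (ds ^^ m) F (t, w) / fact m * s ^ m"
    proof (rule Maclaurin_bi_le[where f = "\<lambda>t. F (t, w)" and diff = "\<lambda>k t. (ds ^^ k) F (t, w)"])
      show "\<forall>k t. k < m \<and> \<bar>t\<bar> \<le> \<bar>s\<bar> \<longrightarrow>
          ((\<lambda>t. (ds ^^ k) F (t, w)) has_real_derivative (ds ^^ Suc k) F (t, w)) (at t)"
        using has_real_derivative_ds[OF Cinf_on_ds_pow[OF F] d2(2)] near by simp
    qed simp
    then obtain t where t: "\<bar>t\<bar> \<le> \<bar>s\<bar>"
      "F (s, w) - (\<Sum>k<m. (ds ^^ k) F (0, w) / fact k * s ^ k) = (ds ^^ m) F (t, w) / fact m * s ^ m" by auto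
    have "\<bar>(ds ^^ m) F (t, w)\<bar> \<le> C"
      using d1(2)[of "(t, w)"] near[OF t(1)] unfolding C_def dist_real_def by simp
    moreover have "\<bar>(ds ^^ m) F (t, w) / fact m\<bar> \<le> \<bar>(ds ^^ m) F (t, w)\<bar>"
      by (simp add: divide_le_eq mult_le_cancel_left1)
    ultimately have "\<bar>(ds ^^ m) F (t, w) / fact m\<bar> \<le> C" by linarith
    then show ?thesis unfolding zs fst_conv snd_conv t(2) real_norm_def abs_mult by (rule mult_right_mono) simp
  qed
  then have "\<forall>\<^sub>F z in nhds (0, y). norm (F z - (\<Sum>k<m. (ds ^^ k) F (0, snd z) / fact k * fst z ^ k)) \<le> C * norm (fst z ^ m)"
    unfolding eventually_nhds_metric using d1 d2 by (intro exI[of _ "min d1 d2"]) auto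
  then show ?thesis by (rule bigoI)
qed

lemma taylor_slice:
  assumes F: "Cinf_on S F" and y: "(0, y) \<in> S"
  shows "(\<lambda>s. F (s, y) - (\<Sum>k<m. (ds ^^ k) F (0, y) / fact k * s ^ k)) \<in> O[at 0](\<lambda>s. s ^ m)"
  using landau_o.big.compose[OF taylor_uniform[OF F y] filterlim_slice] by simp

lemma power_bigo_mono: "k \<le> m \<Longrightarrow> (\<lambda>s::real. s ^ m) \<in> O[at 0](\<lambda>s. s ^ k)"
proof (rule bigoI[where c = 1])
  assume k: "k \<le> m"
  show "\<forall>\<^sub>F s::real in at 0. norm (s ^ m) \<le> 1 * norm (s ^ k)"
    unfolding eventually_at
    by (rule exI[of _ 1]) (auto simp: power_abs intro!: power_decreasing k)
qed

lemma bigo_power_mono: "f \<in> O[at 0](\<lambda>s::real. s ^ m) \<Longrightarrow> k \<le> m \<Longrightarrow> f \<in> O[at 0](\<lambda>s. s ^ k)"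
  by (rule landau_o.big_trans[OF _ power_bigo_mono])

lemma bigo_at_imp_at_right: "f \<in> O[at (0::real)](g) \<Longrightarrow> f \<in> O[at_right 0](g)"
  by (rule landau_o.big.filter_mono[OF at_le[OF subset_UNIV]])

lemma bigo_tendsto_zero:
  fixes f g :: "'a \<Rightarrow> real"
  assumes "f \<in> O[F](g)" "(g \<longlongrightarrow> 0) F"
  shows "(f \<longlongrightarrow> 0) F"
proof -
  obtain c where c: "\<forall>\<^sub>F x in F. norm (f x) \<le> c * norm (g x)" using assms(1) by (elim landau_o.bigE)
  have "((\<lambda>x. c * norm (g x)) \<longlongrightarrow> 0) F" using tendsto_mult_right_zero[OF tendsto_norm_zero[OF assms(2)]] .
  then show ?thesis by (rule Lim_null_comparison[OF c])
qed

text \<open>The limit at 0 kills the constant coefficient; dividing by \<open>s\<close> gives the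
  same situation with one coefficient fewer. The right-hand filter suffices, so this also yields
  uniqueness of the one-sided boundary expansions.\<close>

lemma polynomial_bigo_imp_zero:
  fixes c :: "nat \<Rightarrow> real"
  assumes "(\<lambda>s. \<Sum>k<m. c k * s ^ k) \<in> O[at_right 0](\<lambda>s. s ^ m)" "k < m"
  shows "c k = 0"
  using assms
proof (induction m arbitrary: c k)
  case 0
  from \<open>k < 0\<close> show ?case by simp
next
  case (Suc m)
  have "((\<lambda>s::real. s ^ Suc m) \<longlongrightarrow> 0 ^ Suc m) (at_right 0)"
    by (intro tendsto_intros)
  then have 1: "((\<lambda>s. \<Sum>k<Suc m. c k * s ^ k) \<longlongrightarrow> 0) (at_right 0)"
    by (intro bigo_tendsto_zero[OF Suc.prems(1)]) simp
  have 2: "((\<lambda>s. \<Sum>k<Suc m. c k * s ^ k) \<longlongrightarrow> (\<Sum>k<Suc m. c k * 0 ^ k)) (at_right 0)"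
    by (intro tendsto_intros)
  have "(\<Sum>k<Suc m. c k * 0 ^ k) = 0"
    by (rule tendsto_unique[OF trivial_limit_at_right_real 2 1])
  then have c0: "c 0 = 0" by (simp add: sum.lessThan_Suc_shift)
  have "(\<Sum>k<Suc m. c k * s ^ k) = s * (\<Sum>k<m. c (Suc k) * s ^ k)" for s
    by (simp add: sum.lessThan_Suc_shift c0 sum_distrib_left mult_ac del: sum.lessThan_Suc)
  with Suc.prems(1) have "(\<lambda>s. s * (\<Sum>k<m. c (Suc k) * s ^ k)) \<in> O[at_right 0](\<lambda>s. s * s ^ m)"
    by (simp only: power_Suc)
  then have "(\<lambda>s. \<Sum>k<m. c (Suc k) * s ^ k) \<in> O[at_right 0](\<lambda>s. s ^ m)"
    by (subst (asm) landau_o.big.mult_cancel_left) (auto simp: eventually_at_filter)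
  then have "c (Suc j) = 0" if "j < m" for j
    using Suc.IH[of "\<lambda>k. c (Suc k)" j] that by blast
  then show ?case using c0 Suc.prems(2) by (cases k) auto
qed

lemma vanishes_bigo:
  assumes "Cinf_on S F" "(0, y) \<in> S" "vanishes m F y"
  shows "(\<lambda>s. F (s, y)) \<in> O[at 0](\<lambda>s. s ^ m)"
  using taylor_slice[OF assms(1,2), of m] assms(3) by (simp add: vanishes_def)

text \<open>Derivatives at \<open>s = 0\<close> are already determined from one side: the Taylor
  polynomial inherits the bound for \<open>s > 0\<close>, which forces its coefficients to vanish.
  With \<open>vanishes_bigo\<close> this carries information from \<open>s > 0\<close>, where it is
  geometric, to \<open>s < 0\<close>.\<close>

lemma bigo_right_vanishes:
  assumes F: "Cinf_on S F" and y: "(0, y) \<in> S" and O: "(\<lambda>s. F (s, y)) \<in> O[at_right 0](\<lambda>s. s ^ m)"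
  shows "vanishes m F y"
proof -
  have "(\<lambda>s. F (s, y) - (F (s, y) - (\<Sum>k<m. (ds ^^ k) F (0, y) / fact k * s ^ k))) \<in> O[at_right 0](\<lambda>s. s ^ m)"
    by (intro sum_in_bigo O bigo_at_imp_at_right taylor_slice[OF F y])
  then have "(\<lambda>s. \<Sum>k<m. (ds ^^ k) F (0, y) / fact k * s ^ k) \<in> O[at_right 0](\<lambda>s. s ^ m)" by simp
  from polynomial_bigo_imp_zero[OF this] show ?thesis by (simp add: vanishes_def)
qed

lemma bigo_vanishes:
  "Cinf_on S F \<Longrightarrow> (0, y) \<in> S \<Longrightarrow> (\<lambda>s. F (s, y)) \<in> O[at 0](\<lambda>s. s ^ m) \<Longrightarrow> vanishes m F y"
  by (rule bigo_right_vanishes[OF _ _ bigo_at_imp_at_right])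

text \<open>For \<open>s > 0\<close> close to 0 the bound is trivial, so all Taylor coefficients
  vanish, and Taylor's formula then gives the bound on both sides, whatever extension to
  \<open>s < 0\<close> was chosen.\<close>

lemma flat_bigo:
  fixes F :: "real \<times> 'e::euclidean_space \<Rightarrow> real"
  assumes F: "Cinf_on S F" and y: "(0, y) \<in> S" and z: "\<And>s. s > 0 \<Longrightarrow> (s, y) \<in> S \<Longrightarrow> F (s, y) = 0"
  shows "(\<lambda>s. F (s, y)) \<in> O[at 0](\<lambda>s. s ^ m)"
proof -
  have "\<forall>\<^sub>F z in nhds (0, y). z \<in> S" using Cinf_on_open[OF F] y eventually_nhds by blast
  then have "\<forall>\<^sub>F s in at (0::real). (s, y) \<in> S" using filterlim_slice[of y] unfolding filterlim_iff by blast
  then have "\<forall>\<^sub>F s in at_right 0. (s, y) \<in> S"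
    by (rule filter_leD[OF at_le[OF subset_UNIV]])
  then have "\<forall>\<^sub>F s in at_right 0. F (s, y) = 0"
    using eventually_at_right_less[of "0::real"] by eventually_elim (use z in auto)
  then have "(\<lambda>s. F (s, y)) \<in> O[at_right 0](\<lambda>s. s ^ m)"
    by (intro bigoI[where c = 0]) (auto elim: eventually_mono)
  then show ?thesis by (intro vanishes_bigo[OF F y] bigo_right_vanishes[OF F y])
qed

lemma vanishes_Suc: "vanishes (Suc m) F y \<longleftrightarrow> F (0, y) = 0 \<and> vanishes m (ds F) y"
  unfolding vanishes_def by (auto simp: less_Suc_eq_0_disj funpow_swap1)

text \<open>Symmetry of second derivatives, applied once for each \<open>ds\<close>. The induction
  hypothesis is an identity on the open set \<open>S\<close>, hence may itself be
  differentiated.\<close>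

lemma ds_pow_frechet_derivative:
  assumes F: "Cinf_on S F" and z: "z \<in> S"
  shows "(ds ^^ k) (\<lambda>z. frechet_derivative F (at z) v) z = frechet_derivative ((ds ^^ k) F) (at z) v"
  using z
proof (induction k arbitrary: z)
  case (Suc k)
  have "ds ((ds ^^ k) (\<lambda>z. frechet_derivative F (at z) v)) z = ds (\<lambda>z. frechet_derivative ((ds ^^ k) F) (at z) v) z"
    unfolding ds_def[abs_def]
    using frechet_derivative_transform_within_open[OF _ Cinf_on_open[OF F] Suc.prems,
        of "(ds ^^ k) (\<lambda>z. frechet_derivative F (at z) v)" "\<lambda>z. frechet_derivative ((ds ^^ k) F) (at z) v"]
      Suc.IH Cinf_on_has_derivative[OF Cinf_on_ds_pow[OF Cinf_on_frechet_derivative[OF F]] Suc.prems]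
    unfolding ds_def[abs_def, symmetric] by (metis differentiableI)
  also have "\<dots> = frechet_derivative (ds ((ds ^^ k) F)) (at z) v"
    unfolding ds_def[of "\<lambda>z. frechet_derivative ((ds ^^ k) F) (at z) v"] ds_def[of "(ds ^^ k) F", abs_def]
    using frechet_derivative_commute[OF Cinf_on_ds_pow[OF F] Suc.prems] .
  finally show ?case by simp
qed simp

text \<open>The coefficients \<open>(ds ^^ k) F (0, y)\<close> are identically zero on the open set
  \<open>T\<close>, so their derivatives along the boundary are zero as well, and \<open>ds\<close>
  commutes with these. A hypothesis at the single point \<open>y\<close> would not do.\<close>

lemma vanishes_tangential:
  assumes F: "Cinf_on S F" and T: "open T" and sub: "\<And>y. y \<in> T \<Longrightarrow> (0, y) \<in> S"
    and van: "\<And>y. y \<in> T \<Longrightarrow> vanishes m F y" and y: "y \<in> T"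
  shows "vanishes m (\<lambda>z. frechet_derivative F (at z) (0, u)) y"
  unfolding vanishes_def
proof (intro allI impI)
  fix k assume k: "k < m"
  have "isCont (\<lambda>t. y + t *\<^sub>R u) 0" by (intro continuous_intros)
  then have "((\<lambda>t. y + t *\<^sub>R u) \<longlongrightarrow> y) (nhds 0)"
    by (simp add: continuous_at tendsto_nhds_iff isCont_def)
  then have ev: "\<forall>\<^sub>F t in nhds 0. y + t *\<^sub>R u \<in> T"
    using T y topological_tendstoD by blast
  have "((\<lambda>t. (ds ^^ k) F ((0, y) + t *\<^sub>R (0, u))) has_real_derivative
      frechet_derivative ((ds ^^ k) F) (at ((0, y) + 0 *\<^sub>R (0, u))) (0, u)) (at 0)"
    using has_real_derivative_line[OF Cinf_on_ds_pow[OF F], of "(0, y)" 0 "(0, u)" k] sub[OF y] by simp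
  moreover have "((\<lambda>t. (ds ^^ k) F ((0, y) + t *\<^sub>R (0, u))) has_real_derivative 0) (at 0)"
  proof (subst DERIV_cong_ev[OF refl _ refl])
    show "\<forall>\<^sub>F t in nhds 0. (ds ^^ k) F ((0, y) + t *\<^sub>R (0, u)) = 0"
      using ev by eventually_elim (use van k in \<open>auto simp: vanishes_def\<close>)
  qed simp
  ultimately have "frechet_derivative ((ds ^^ k) F) (at (0, y)) (0, u) = 0"
    using DERIV_unique by fastforce
  then show "(ds ^^ k) (\<lambda>z. frechet_derivative F (at z) (0, u)) (0, y) = 0"
    using ds_pow_frechet_derivative[OF F sub[OF y]] by metis
qed

text \<open>Mean value inequality on a ball around \<open>z0\<close>, where the partial derivatives
  are bounded by continuity; both curves eventually stay in that ball.\<close>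

lemma lipschitz_bigo:
  fixes F :: "'a::euclidean_space \<Rightarrow> real"
  assumes F: "Cinf_on S F" and z0: "z0 \<in> S"
    and \<gamma>: "filterlim \<gamma> (nhds z0) \<F>" and \<delta>: "filterlim \<delta> (nhds z0) \<F>"
  shows "(\<lambda>s. F (\<gamma> s) - F (\<delta> s)) \<in> O[\<F>](\<lambda>s. norm (\<gamma> s - \<delta> s))"
proof -
  have "\<forall>b\<in>Basis. \<forall>\<^sub>F z in nhds z0. \<bar>frechet_derivative F (at z) b\<bar> < \<bar>frechet_derivative F (at z0) b\<bar> + 1"
  proof
    fix b :: 'a assume "b \<in> Basis"
    have "isCont (\<lambda>z. \<bar>frechet_derivative F (at z) b\<bar>) z0"
      using Cinf_on_isCont[OF Cinf_on_frechet_derivative[OF F] z0] by (intro continuous_intros)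
    then have "((\<lambda>z. \<bar>frechet_derivative F (at z) b\<bar>) \<longlongrightarrow> \<bar>frechet_derivative F (at z0) b\<bar>) (nhds z0)"
      by (simp add: tendsto_nhds_iff isCont_def)
    then show "\<forall>\<^sub>F z in nhds z0. \<bar>frechet_derivative F (at z) b\<bar> < \<bar>frechet_derivative F (at z0) b\<bar> + 1"
      by (rule order_tendstoD) simp
  qed
  then have "\<forall>\<^sub>F z in nhds z0. \<forall>b\<in>Basis. \<bar>frechet_derivative F (at z) b\<bar> < \<bar>frechet_derivative F (at z0) b\<bar> + 1"
    by (simp add: eventually_ball_finite)
  moreover have "\<forall>\<^sub>F z in nhds z0. z \<in> S" using Cinf_on_open[OF F] z0 eventually_nhds by blast
  ultimately have "\<forall>\<^sub>F z in nhds z0. z \<in> S \<and> (\<forall>b\<in>Basis. \<bar>frechet_derivative F (at z) b\<bar> < \<bar>frechet_derivative F (at z0) b\<bar> + 1)"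
    by eventually_elim auto
  then obtain d where d: "d > 0"
    "\<And>z. dist z z0 < d \<Longrightarrow> z \<in> S \<and> (\<forall>b\<in>Basis. \<bar>frechet_derivative F (at z) b\<bar> < \<bar>frechet_derivative F (at z0) b\<bar> + 1)"
    unfolding eventually_nhds_metric by blast
  \<comment> \<open>Each coordinate of \<open>v\<close> is at most \<open>norm v\<close>, so the sum
    of the bounds for the partial derivatives dominates the operator norm.\<close>
  define C where "C = (\<Sum>b\<in>(Basis::'a set). \<bar>frechet_derivative F (at z0) b\<bar> + 1)"
  have onorm: "onorm (frechet_derivative F (at z)) \<le> C" if z: "z \<in> ball z0 d" for z
  proof (rule onorm_le)
    fix v
    have zS: "z \<in> S" and zb: "\<And>b. b \<in> Basis \<Longrightarrow> \<bar>frechet_derivative F (at z) b\<bar> \<le> \<bar>frechet_derivative F (at z0) b\<bar> + 1"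
      using d(2)[of z] z by (auto simp: dist_commute less_imp_le)
    have lin: "linear (frechet_derivative F (at z))"
      using has_derivative_linear[OF Cinf_on_has_derivative[OF F zS]] .
    have "frechet_derivative F (at z) v = frechet_derivative F (at z) (\<Sum>b\<in>Basis. (v \<bullet> b) *\<^sub>R b)"
      by (simp only: euclidean_representation)
    also have "\<dots> = (\<Sum>b\<in>Basis. (v \<bullet> b) * frechet_derivative F (at z) b)"
      by (simp add: linear_sum[OF lin] linear_cmul[OF lin])
    finally have "norm (frechet_derivative F (at z) v) \<le> (\<Sum>b\<in>Basis. norm ((v \<bullet> b) * frechet_derivative F (at z) b))"
      by (simp only: sum_norm_le order_refl)
    also have "\<dots> \<le> (\<Sum>b\<in>Basis. norm v * (\<bar>frechet_derivative F (at z0) b\<bar> + 1))"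
      unfolding norm_mult by (intro sum_mono mult_mono) (auto simp: Basis_le_norm zb)
    finally show "norm (frechet_derivative F (at z) v) \<le> C * norm v"
      by (simp add: C_def sum_distrib_left sum_distrib_right mult.commute)
  qed
  have bd: "norm (F z - F z') \<le> C * norm (z - z')" if "z \<in> ball z0 d" "z' \<in> ball z0 d" for z z'
    by (rule differentiable_bound[OF convex_ball _ onorm that])
      (use d(2) Cinf_on_has_derivative[OF F] in \<open>auto simp: dist_commute intro: has_derivative_at_withinI\<close>)
  have "\<forall>\<^sub>F s in \<F>. \<gamma> s \<in> ball z0 d" "\<forall>\<^sub>F s in \<F>. \<delta> s \<in> ball z0 d"
    using topological_tendstoD[OF \<gamma>, of "ball z0 d"] topological_tendstoD[OF \<delta>, of "ball z0 d"] d(1) by auto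
  then have "\<forall>\<^sub>F s in \<F>. norm (F (\<gamma> s) - F (\<delta> s)) \<le> C * norm (norm (\<gamma> s - \<delta> s))"
    by eventually_elim (use bd in auto)
  then show ?thesis by (rule bigoI)
qed

lemma bigo_mult_cancel:
  fixes f w g :: "real \<Rightarrow> real"
  assumes w: "(w \<longlongrightarrow> c) F" and c: "c \<noteq> 0" and O: "(\<lambda>s. w s * f s) \<in> O[F](g)"
  shows "f \<in> O[F](g)"
proof -
  have ev: "\<forall>\<^sub>F s in F. w s \<noteq> 0" using tendsto_imp_eventually_ne[OF w c] .
  have "((\<lambda>s. inverse (w s)) \<longlongrightarrow> inverse c) F" using w c by (rule tendsto_inverse)
  then have "(\<lambda>s. inverse (w s)) \<in> O[F](\<lambda>_. 1)"
    by (intro bigoI_tendsto[where c = "inverse c"]) auto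
  from landau_o.big.mult[OF this O] have "(\<lambda>s. inverse (w s) * (w s * f s)) \<in> O[F](g)" by simp
  then show ?thesis
    by (rule landau_o.big.in_cong[THEN iffD1, rotated]) (use ev in eventually_elim, auto)
qed

section \<open>Orders of vanishing and parity\<close>

text \<open>The filter is two-sided, so that \<open>s \<mapsto> - s\<close> preserves it, and omits
  the point 0, so that dividing by powers of \<open>s\<close> is harmless.\<close>

definition ord0 :: "nat \<Rightarrow> (real \<Rightarrow> real) \<Rightarrow> bool" where
  "ord0 m f \<longleftrightarrow> f \<in> O[at 0](\<lambda>s. s ^ m)"

lemma ord0_mono: "ord0 m f \<Longrightarrow> k \<le> m \<Longrightarrow> ord0 k f"
  unfolding ord0_def by (rule bigo_power_mono)

lemma ord0_add: "ord0 m f \<Longrightarrow> ord0 m g \<Longrightarrow> ord0 m (\<lambda>s. f s + g s)"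
  unfolding ord0_def by (rule sum_in_bigo)

lemma ord0_diff: "ord0 m f \<Longrightarrow> ord0 m g \<Longrightarrow> ord0 m (\<lambda>s. f s - g s)"
  unfolding ord0_def by (rule sum_in_bigo)

lemma ord0_sum: "(\<And>i. i \<in> I \<Longrightarrow> ord0 m (f i)) \<Longrightarrow> ord0 m (\<lambda>s. \<Sum>i\<in>I. f i s)"
  unfolding ord0_def by (rule big_sum_in_bigo)

lemma ord0_mult: "ord0 a f \<Longrightarrow> ord0 b g \<Longrightarrow> k \<le> a + b \<Longrightarrow> ord0 k (\<lambda>s. f s * g s)"
proof (rule ord0_mono)
  assume "ord0 a f" "ord0 b g"
  then show "ord0 (a + b) (\<lambda>s. f s * g s)"
    unfolding ord0_def power_add by (rule landau_o.big.mult)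
qed

lemma ord0_power: "k \<le> m \<Longrightarrow> ord0 k (\<lambda>s. s ^ m)"
  unfolding ord0_def by (rule power_bigo_mono)

lemma ord0_const: "ord0 0 (\<lambda>s. c)"
  unfolding ord0_def by (rule bigoI[where c = "\<bar>c\<bar>"]) simp

lemma ord0_cmult: "ord0 m f \<Longrightarrow> ord0 m (\<lambda>s. c * f s)"
  using ord0_mult[OF ord0_const, of m f m c] by simp

lemma ord0_uminus: "ord0 m f \<Longrightarrow> ord0 m (\<lambda>s. f (- s))"
proof -
  assume f: "ord0 m f"
  have "((\<lambda>s::real. - s) \<longlongrightarrow> - 0) (at 0)" by (intro tendsto_intros)
  then have "filterlim uminus (at (0::real)) (at 0)"
    by (simp add: filterlim_at eventually_at_filter)
  from landau_o.big.compose[OF f[unfolded ord0_def] this]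
  have "(\<lambda>s. f (- s)) \<in> O[at 0](\<lambda>s. (- s) ^ m)" .
  then obtain c where "\<forall>\<^sub>F s in at 0. norm (f (- s)) \<le> c * norm ((- s) ^ m)" by (elim landau_o.bigE)
  then have "\<forall>\<^sub>F s in at 0. norm (f (- s)) \<le> c * norm (s ^ m)" by (simp add: power_abs)
  then show ?thesis unfolding ord0_def by (rule bigoI)
qed

lemma ord0_cong: "ord0 m f \<Longrightarrow> \<forall>\<^sub>F s in at 0. f s = g s \<Longrightarrow> ord0 m g"
  unfolding ord0_def using landau_o.big.in_cong by blast

lemma ord0_eq: "ord0 m f \<Longrightarrow> (\<And>s. f s = g s) \<Longrightarrow> ord0 m g"
  by (metis ext)

lemma ord0_cancel:
  assumes "ord0 (k + m) (\<lambda>s. s ^ k * f s)"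
  shows "ord0 m f"
proof -
  obtain c where c: "\<forall>\<^sub>F s in at 0. norm (s ^ k * f s) \<le> c * norm (s ^ (k + m))"
    using assms unfolding ord0_def by (elim landau_o.bigE)
  have "\<forall>\<^sub>F s in at (0::real). s \<noteq> 0" by (simp add: eventually_at_filter)
  with c have "\<forall>\<^sub>F s in at 0. norm (f s) \<le> c * norm (s ^ m)"
  proof eventually_elim
    case (elim s)
    then have "norm (s ^ k) * norm (f s) \<le> norm (s ^ k) * (c * norm (s ^ m))"
      by (simp only: norm_mult power_add mult.left_commute[of c])
    then show ?case by (rule mult_left_le_imp_le) (use elim in simp)
  qed
  then show ?thesis unfolding ord0_def by (rule bigoI)
qed

lemma ord0_cancel_tendsto:
  "(w \<longlongrightarrow> c) (at 0) \<Longrightarrow> c \<noteq> 0 \<Longrightarrow> ord0 m (\<lambda>s. w s * f s) \<Longrightarrow> ord0 m f"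
  unfolding ord0_def by (rule bigo_mult_cancel)

lemma ord0_polynomial_zero: "ord0 m (\<lambda>s. \<Sum>k<m. c k * s ^ k) \<Longrightarrow> k < m \<Longrightarrow> c k = 0"
  unfolding ord0_def by (rule polynomial_bigo_imp_zero[OF bigo_at_imp_at_right])

lemma ord0_tendsto: "ord0 (Suc m) f \<Longrightarrow> (f \<longlongrightarrow> 0) (at 0)"
  unfolding ord0_def
proof (rule bigo_tendsto_zero)
  have "((\<lambda>s::real. s ^ Suc m) \<longlongrightarrow> 0 ^ Suc m) (at 0)" by (intro tendsto_intros)
  then show "((\<lambda>s::real. s ^ Suc m) \<longlongrightarrow> 0) (at 0)" by simp
qed

text \<open>Induction with \<open>f ^ (k + 1) - (a s) ^ (k + 1) = f (f ^ k - (a s) ^ k) + (f - a s)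
  (a s) ^ k\<close>; each summand has one factor that exceeds its expected order by one.\<close>

lemma ord0_leading_power:
  assumes f: "ord0 2 (\<lambda>s. f s - a * s)"
  shows "ord0 (Suc k) (\<lambda>s. f s ^ k - a ^ k * s ^ k)"
proof (induction k)
  case 0
  show ?case by (rule ord0_eq[OF ord0_power[of "Suc 0" 1, THEN ord0_cmult[where c = 0]]]) simp_all
next
  case (Suc k)
  have s1: "ord0 1 (\<lambda>s. s)" by (rule ord0_eq[OF ord0_power[of 1 1]]) simp_all
  have f1: "ord0 1 f"
    by (rule ord0_eq[OF ord0_add[OF ord0_mono[OF f] ord0_cmult[OF s1, of a]]]) simp_all
  have "ord0 (Suc (Suc k)) (\<lambda>s. f s * (f s ^ k - a ^ k * s ^ k))"
    by (rule ord0_mult[OF f1 Suc]) simp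
  moreover have "ord0 (Suc (Suc k)) (\<lambda>s. (f s - a * s) * (a ^ k * s ^ k))"
    by (rule ord0_mult[OF f ord0_cmult[OF ord0_power[OF order_refl]]]) simp
  ultimately show ?case
    by (rule ord0_eq[OF ord0_add]) (simp add: algebra_simps)
qed

text \<open>The sign \<sigma> = 1 tests evenness and \<sigma> = -1 oddness, in both cases up to an
  error of order \<open>m\<close>.\<close>

definition parity_mod :: "real \<Rightarrow> nat \<Rightarrow> (real \<Rightarrow> real) \<Rightarrow> bool" where
  "parity_mod \<sigma> m f \<longleftrightarrow> ord0 m (\<lambda>s. f s - \<sigma> * f (- s))"

lemma parity_mod_mono: "parity_mod \<sigma> m f \<Longrightarrow> k \<le> m \<Longrightarrow> parity_mod \<sigma> k f"
  unfolding parity_mod_def by (rule ord0_mono)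

lemma parity_mod_diff: "parity_mod \<sigma> m f \<Longrightarrow> parity_mod \<sigma> m g \<Longrightarrow> parity_mod \<sigma> m (\<lambda>s. f s - g s)"
  unfolding parity_mod_def by (drule (1) ord0_diff) (simp add: algebra_simps)

lemma parity_mod_sum: "(\<And>i. i \<in> I \<Longrightarrow> parity_mod \<sigma> m (f i)) \<Longrightarrow> parity_mod \<sigma> m (\<lambda>s. \<Sum>i\<in>I. f i s)"
  unfolding parity_mod_def sum_distrib_left sum_subtractf[symmetric] by (rule ord0_sum)

lemma ord0_imp_par: "ord0 m f \<Longrightarrow> parity_mod \<sigma> m f"
  unfolding parity_mod_def by (intro ord0_diff ord0_cmult ord0_uminus)

text \<open>From \<open>f g - \<sigma> \<tau> f(-) g(-) = (f - \<sigma> f(-)) g + \<sigma> f(-) (g -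
  \<tau> g(-))\<close>: the order of vanishing of each factor is added to the parity order of the
  other. All gains in the improvement steps come from this.\<close>

lemma parity_mod_mult:
  assumes f: "parity_mod \<sigma> m f" "ord0 a f" and g: "parity_mod \<tau> l g" "ord0 b g"
    and k: "k \<le> m + b" "k \<le> l + a" and st: "\<rho> = \<sigma> * \<tau>"
  shows "parity_mod \<rho> k (\<lambda>s. f s * g s)"
proof -
  have "ord0 k (\<lambda>s. (f s - \<sigma> * f (- s)) * g s)"
    using ord0_mult[OF f(1)[unfolded parity_mod_def] g(2) k(1)] .
  moreover have "ord0 k (\<lambda>s. (\<sigma> * f (- s)) * (g s - \<tau> * g (- s)))"
    by (rule ord0_mult[OF ord0_cmult[OF ord0_uminus[OF f(2)]] g(1)[unfolded parity_mod_def]]) (use k in simp)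
  ultimately show ?thesis unfolding parity_mod_def
    by (rule ord0_eq[OF ord0_add]) (simp add: st algebra_simps)
qed

lemma parity_mod_cong: "parity_mod \<sigma> m f \<Longrightarrow> (\<And>s. f s = g s) \<Longrightarrow> parity_mod \<sigma> m g"
  by (metis ext)

section \<open>Reflection in the first variable\<close>

definition slab :: "real \<Rightarrow> 'e::euclidean_space \<Rightarrow> (real \<times> 'e) set" where
  "slab r y0 = {-r<..<r} \<times> ball y0 r"

definition reflect :: "real \<times> 'e \<Rightarrow> real \<times> 'e" where
  "reflect z = (- fst z, snd z)"

text \<open>The function behind \<open>parity_mod\<close> as a function of both variables; it is as
  smooth as \<open>F\<close>, so its Taylor coefficients can be differentiated along the
  boundary.\<close>

definition parity_defect :: "real \<Rightarrow> (real \<times> 'e \<Rightarrow> real) \<Rightarrow> real \<times> 'e \<Rightarrow> real" where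
  "parity_defect \<sigma> F z = F z - \<sigma> * F (reflect z)"

lemma open_slab: "open (slab r y0)"
  unfolding slab_def by (intro open_Times) auto

lemma slab_zero: "0 < r \<Longrightarrow> (0, y) \<in> slab r y0 \<longleftrightarrow> y \<in> ball y0 r"
  by (auto simp: slab_def)

lemma reflect_slab: "reflect z \<in> slab r y0 \<longleftrightarrow> z \<in> slab r y0"
  by (cases z) (auto simp: reflect_def slab_def)

lemma has_derivative_reflect: "(reflect has_derivative reflect) (at (z :: real \<times> 'e::euclidean_space))"
  unfolding reflect_def[abs_def] by (auto intro!: derivative_eq_intros)

lemma Cinf_on_reflect: "Cinf_on (slab r y0) (reflect :: real \<times> 'e::euclidean_space \<Rightarrow> real \<times> 'e)"
  by (rule Cinf_on_bounded_linear[OF open_slab has_derivative_bounded_linear[OF has_derivative_reflect]])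

lemma Cinf_on_compose_reflect: "Cinf_on (slab r y0) F \<Longrightarrow> Cinf_on (slab r y0) (\<lambda>z. F (reflect z))"
  by (rule Cinf_on_compose[OF _ Cinf_on_reflect]) (auto simp: reflect_slab)

lemma Cinf_on_parity_defect: "Cinf_on (slab r y0) F \<Longrightarrow> Cinf_on (slab r y0) (parity_defect \<sigma> F)"
  unfolding parity_defect_def[abs_def]
  by (intro Cinf_on_diff Cinf_on_mult Cinf_on_const open_slab Cinf_on_compose_reflect)

lemma frechet_derivative_parity_defect:
  assumes F: "Cinf_on (slab r y0) F" and z: "z \<in> slab r y0"
  shows "frechet_derivative (parity_defect \<sigma> F) (at z) v =
    frechet_derivative F (at z) v - \<sigma> * frechet_derivative F (at (reflect z)) (reflect v)"
proof -
  have D1: "(F has_derivative frechet_derivative F (at z)) (at z)"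
    using Cinf_on_has_derivative[OF F z] .
  have D2: "((\<lambda>z. F (reflect z)) has_derivative (\<lambda>v. frechet_derivative F (at (reflect z)) (reflect v))) (at z)"
    using diff_chain_at[OF has_derivative_reflect Cinf_on_has_derivative[OF F, of "reflect z"]] z
    by (simp add: o_def reflect_slab)
  have "(parity_defect \<sigma> F has_derivative
      (\<lambda>v. frechet_derivative F (at z) v - \<sigma> * frechet_derivative F (at (reflect z)) (reflect v))) (at z)"
    unfolding parity_defect_def[abs_def]
    by (rule has_derivative_diff[OF D1 has_derivative_mult_right[OF D2]])
  from frechet_derivative_at[OF this] show ?thesis by (metis (no_types))
qed

lemma ds_parity_defect:
  assumes F: "Cinf_on (slab r y0) F" and z: "z \<in> slab r y0"
  shows "ds (parity_defect \<sigma> F) z = parity_defect (- \<sigma>) (ds F) z"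
proof -
  have "- (1, 0) = (reflect (1, 0) :: real \<times> 'a)" by (simp add: reflect_def)
  moreover have "linear (frechet_derivative F (at (reflect z)))"
    using has_derivative_linear[OF Cinf_on_has_derivative[OF F]] z by (simp add: reflect_slab)
  ultimately have "frechet_derivative F (at (reflect z)) (reflect (1, 0)) = - ds F (reflect z)"
    unfolding ds_def by (metis linear_neg)
  then show ?thesis
    unfolding ds_def[of "parity_defect \<sigma> F"] frechet_derivative_parity_defect[OF F z]
    by (simp add: parity_defect_def ds_def)
qed

text \<open>Each derivative in \<open>s\<close> flips the sign carried by the reflection. Hence at
  \<open>s = 0\<close> the defect for \<sigma> = 1 keeps just the odd derivatives of
  \<open>F\<close>, doubled, and the defect for \<sigma> = -1 just the even ones.\<close>

lemma ds_pow_parity_defect: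
  assumes F: "Cinf_on (slab r y0) F" and z: "z \<in> slab r y0"
  shows "(ds ^^ k) (parity_defect \<sigma> F) z = parity_defect (\<sigma> * (-1) ^ k) ((ds ^^ k) F) z"
  using z
proof (induction k arbitrary: z)
  case (Suc k)
  let ?f = "(ds ^^ k) (parity_defect \<sigma> F)" and ?g = "parity_defect (\<sigma> * (-1) ^ k) ((ds ^^ k) F)"
  have "frechet_derivative ?f (at z) = frechet_derivative ?g (at z)"
  proof (rule frechet_derivative_transform_within_open[OF _ open_slab Suc.prems])
    show "?f differentiable (at z)"
      by (rule differentiableI[OF Cinf_on_has_derivative[OF
        Cinf_on_ds_pow[OF Cinf_on_parity_defect[OF F]] Suc.prems]])
  qed (rule Suc.IH)
  then have "ds ?f z = ds ?g z" by (simp add: ds_def)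
  also have "\<dots> = parity_defect (\<sigma> * (-1) ^ Suc k) ((ds ^^ Suc k) F) z"
    using ds_parity_defect[OF Cinf_on_ds_pow[OF F] Suc.prems] by simp
  finally show ?case by simp
qed simp

lemma eventually_slab:
  assumes "0 < r" "y \<in> ball y0 r"
  shows "\<forall>\<^sub>F s in at 0. (s, y) \<in> slab r y0"
  unfolding eventually_at using assms by (intro exI[of _ r]) (auto simp: slab_def)

lemma ord0_slice:
  assumes "Cinf_on (slab r y0) F" "0 < r" "y \<in> ball y0 r"
  shows "ord0 0 (\<lambda>s. F (s, y))"
  using taylor_slice[OF assms(1), of y 0] assms(2,3) by (simp add: ord0_def slab_zero)

lemma ord0_slice_diff:
  assumes "Cinf_on (slab r y0) F" "0 < r" "y \<in> ball y0 r"
  shows "ord0 1 (\<lambda>s. F (s, y) - F (0, y))"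
  using taylor_slice[OF assms(1), of y 1] assms(2,3) by (simp add: ord0_def slab_zero)

lemma ord0_slice_diff2:
  assumes "Cinf_on (slab r y0) F" "0 < r" "y \<in> ball y0 r"
  shows "ord0 2 (\<lambda>s. F (s, y) - (F (0, y) + ds F (0, y) * s))"
  using taylor_slice[OF assms(1), of y 2] assms(2,3)
  by (simp add: ord0_def slab_zero numeral_2_eq_2)

lemma ord0_iff_vanishes:
  assumes "Cinf_on (slab r y0) F" "0 < r" "y \<in> ball y0 r"
  shows "ord0 m (\<lambda>s. F (s, y)) \<longleftrightarrow> vanishes m F y"
  unfolding ord0_def
  using vanishes_bigo[OF assms(1)] bigo_vanishes[OF assms(1)] assms(2,3) by (auto simp: slab_zero)

lemma parity_mod_iff_vanishes:
  assumes "Cinf_on (slab r y0) F" "0 < r" "y \<in> ball y0 r"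
  shows "parity_mod \<sigma> m (\<lambda>s. F (s, y)) \<longleftrightarrow> vanishes m (parity_defect \<sigma> F) y"
  unfolding parity_mod_def
  using ord0_iff_vanishes[OF Cinf_on_parity_defect[OF assms(1)] assms(2,3), of m \<sigma>]
  by (simp add: parity_defect_def reflect_def)

text \<open>Differentiating a growth bound is legitimate here because \<open>F\<close> is smooth:
  the bound is the vanishing of Taylor coefficients, and \<open>ds\<close> merely shifts
  these.\<close>

lemma parity_mod_ds:
  assumes F: "Cinf_on (slab r y0) F" and r: "0 < r" "y \<in> ball y0 r" and p: "parity_mod \<sigma> (Suc m) (\<lambda>s. F (s, y))"
  shows "parity_mod (- \<sigma>) m (\<lambda>s. ds F (s, y))"
proof -
  have "vanishes (Suc m) (parity_defect \<sigma> F) y" using p parity_mod_iff_vanishes[OF F r] by blast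
  then have "vanishes m (ds (parity_defect \<sigma> F)) y" by (simp add: vanishes_Suc)
  then have "ord0 m (\<lambda>s. ds (parity_defect \<sigma> F) (s, y))"
    using ord0_iff_vanishes[OF Cinf_on_ds[OF Cinf_on_parity_defect[OF F]] r] by blast
  then have "ord0 m (\<lambda>s. parity_defect (- \<sigma>) (ds F) (s, y))"
    by (rule ord0_cong) (use eventually_slab[OF r] in eventually_elim, rule ds_parity_defect[OF F])
  then show ?thesis by (simp add: parity_mod_def parity_defect_def reflect_def)
qed

text \<open>Integration in \<open>s\<close>, which gains an order. The condition \<open>F0\<close>
  controls the constant that \<open>ds\<close> forgets: it is automatic for \<sigma> = 1 and says
  \<open>F (0, y) = 0\<close> for \<sigma> = -1.\<close>

lemma parity_mod_ds_conv:
  assumes F: "Cinf_on (slab r y0) F" and r: "0 < r" "y \<in> ball y0 r" and p: "parity_mod (- \<sigma>) m (\<lambda>s. ds F (s, y))"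
    and F0: "F (0, y) = \<sigma> * F (0, y)"
  shows "parity_mod \<sigma> (Suc m) (\<lambda>s. F (s, y))"
proof -
  have "ord0 m (\<lambda>s. parity_defect (- \<sigma>) (ds F) (s, y))"
    using p by (simp add: parity_mod_def parity_defect_def reflect_def)
  then have "ord0 m (\<lambda>s. ds (parity_defect \<sigma> F) (s, y))"
    by (rule ord0_cong) (use eventually_slab[OF r] in eventually_elim, rule ds_parity_defect[OF F, symmetric])
  then have "vanishes m (ds (parity_defect \<sigma> F)) y"
    using ord0_iff_vanishes[OF Cinf_on_ds[OF Cinf_on_parity_defect[OF F]] r] by blast
  then have "vanishes (Suc m) (parity_defect \<sigma> F) y"
    using F0 by (simp add: vanishes_Suc parity_defect_def reflect_def)
  then show ?thesis using parity_mod_iff_vanishes[OF F r] by blast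
qed

text \<open>A derivative along the boundary costs no order, provided that the parity is known at all
  boundary points of the ball. This is why the induction on the order treats all \<open>y\<close> at
  once.\<close>

lemma parity_mod_tangential:
  assumes F: "Cinf_on (slab r y0) F" and r: "0 < r"
    and p: "\<And>y. y \<in> ball y0 r \<Longrightarrow> parity_mod \<sigma> m (\<lambda>s. F (s, y))" and y: "y \<in> ball y0 r"
  shows "parity_mod \<sigma> m (\<lambda>s. frechet_derivative F (at (s, y)) (0, u))"
proof -
  have "vanishes m (\<lambda>z. frechet_derivative (parity_defect \<sigma> F) (at z) (0, u)) y"
    by (rule vanishes_tangential[OF Cinf_on_parity_defect[OF F] open_ball[of y0 r] _ _ y])
      (use p parity_mod_iff_vanishes[OF F r] r in \<open>auto simp: slab_zero\<close>)
  then have "ord0 m (\<lambda>s. frechet_derivative (parity_defect \<sigma> F) (at (s, y)) (0, u))"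
    using ord0_iff_vanishes[OF Cinf_on_frechet_derivative[OF Cinf_on_parity_defect[OF F]] r y] by blast
  then show ?thesis unfolding parity_mod_def
    by (rule ord0_cong)
      (use eventually_slab[OF r y] in eventually_elim, simp add: frechet_derivative_parity_defect[OF F] reflect_def)
qed

lemma ord0_tangential:
  assumes F: "Cinf_on (slab r y0) F" and r: "0 < r"
    and p: "\<And>y. y \<in> ball y0 r \<Longrightarrow> ord0 m (\<lambda>s. F (s, y))" and y: "y \<in> ball y0 r"
  shows "ord0 m (\<lambda>s. frechet_derivative F (at (s, y)) (0, u))"
proof -
  have "vanishes m (\<lambda>z. frechet_derivative F (at z) (0, u)) y"
    by (rule vanishes_tangential[OF F open_ball[of y0 r] _ _ y])
      (use p ord0_iff_vanishes[OF F r] r in \<open>auto simp: slab_zero\<close>)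
  then show ?thesis using ord0_iff_vanishes[OF Cinf_on_frechet_derivative[OF F] r y] by blast
qed

lemma ord0_flat:
  assumes F: "Cinf_on (slab r y0) F" and r: "0 < r" "y \<in> ball y0 r"
    and "\<And>s. s > 0 \<Longrightarrow> (s, y) \<in> slab r y0 \<Longrightarrow> F (s, y) = 0"
  shows "ord0 m (\<lambda>s. F (s, y))"
  unfolding ord0_def by (rule flat_bigo[OF F]) (use assms in \<open>auto simp: slab_zero\<close>)

text \<open>Positivity makes the map given by the matrix \<open>g\<close> injective, hence
  surjective in finite dimension; symmetry of \<open>g\<close> does not enter.\<close>

lemma posdef_dual_vector:
  fixes g :: "'e::euclidean_space \<Rightarrow> 'e \<Rightarrow> real"
  assumes pos: "\<And>u. u \<noteq> 0 \<Longrightarrow> (\<Sum>i\<in>Basis. \<Sum>j\<in>Basis. g i j * (u \<bullet> i) * (u \<bullet> j)) > 0"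
  shows "\<exists>w. \<forall>i\<in>Basis. (\<Sum>j\<in>Basis. g i j * (w \<bullet> j)) = v \<bullet> i"
proof -
  define L where "L = (\<lambda>w::'e. \<Sum>i\<in>Basis. (\<Sum>j\<in>Basis. g i j * (w \<bullet> j)) *\<^sub>R i)"
  have Li: "L w \<bullet> i = (\<Sum>j\<in>Basis. g i j * (w \<bullet> j))" if "i \<in> Basis" for w i
    using that by (simp add: L_def)
  have lin: "linear L"
    by (rule linearI) (simp_all add: L_def inner_simps algebra_simps sum.distrib scaleR_sum_right sum_distrib_left)
  have "L w = 0 \<Longrightarrow> w = 0" for w
  proof (rule ccontr)
    assume "L w = 0" "w \<noteq> 0"
    then have "(\<Sum>i\<in>Basis. (w \<bullet> i) * (\<Sum>j\<in>Basis. g i j * (w \<bullet> j))) = 0"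
      using Li[of _ w] by (intro sum.neutral) auto
    then show False using pos[OF \<open>w \<noteq> 0\<close>] by (simp add: sum_distrib_left mult_ac)
  qed
  then have "inj L" using linear_injective_0[OF lin] by blast
  then have "surj L" using linear_injective_imp_surjective[OF lin] by blast
  then obtain w where "L w = v" by (metis surjD)
  then show ?thesis using Li by metis
qed

section \<open>The transition between two collars\<close>

lemma sum_Basis_Basis:
  fixes M :: "'e::euclidean_space \<Rightarrow> 'e \<Rightarrow> real"
  assumes "i \<in> Basis" "j \<in> Basis"
  shows "(\<Sum>k\<in>Basis. \<Sum>l\<in>Basis. M k l * (i \<bullet> k) * (j \<bullet> l)) = M i j"
proof -
  have "(\<Sum>l\<in>Basis. M k l * (i \<bullet> k) * (j \<bullet> l)) = M k j * (i \<bullet> k)" for k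
    using assms by (simp add: inner_Basis if_distrib[where f = "\<lambda>t. _ * t"] sum.delta cong: if_cong)
  then show ?thesis
    using assms by (simp add: inner_Basis if_distrib[where f = "\<lambda>t. _ * t"] sum.delta cong: if_cong)
qed

text \<open>
  \<open>(X, Y)\<close> is the transition between the collars in a boundary chart centred at \<open>y0\<close>, and \<open>G i j\<close> and \<open>K i j\<close>
  are the components of \<open>h\<close> and \<open>hh\<close>.  Only for \<open>fst z \<ge> 0\<close> do the values of these functions have a
  geometric meaning; for \<open>fst z < 0\<close> they are arbitrary smooth extensions.
\<close>

locale collar_change =
  fixes r r' :: real and y0 :: "'e::euclidean_space"
    and X :: "real \<times> 'e \<Rightarrow> real" and Y :: "real \<times> 'e \<Rightarrow> 'e"
    and G K :: "'e \<Rightarrow> 'e \<Rightarrow> real \<times> 'e \<Rightarrow> real" and n :: nat and \<omega> :: "'e \<Rightarrow> real"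
  assumes r: "0 < r" and r': "0 < r'" and odd_n: "odd n" and n2: "2 \<le> n"
    and X: "Cinf_on (slab r y0) X" and Y: "Cinf_on (slab r y0) Y"
    and G: "i \<in> Basis \<Longrightarrow> j \<in> Basis \<Longrightarrow> Cinf_on (slab r' y0) (G i j)"
    and K: "i \<in> Basis \<Longrightarrow> j \<in> Basis \<Longrightarrow> Cinf_on (slab r y0) (K i j)"
    and maps: "z \<in> slab r y0 \<Longrightarrow> (X z, Y z) \<in> slab r' y0"
    and X0: "y \<in> ball y0 r \<Longrightarrow> X (0, y) = 0"
    and Y0: "y \<in> ball y0 r \<Longrightarrow> Y (0, y) = y"
    and Xpos: "z \<in> slab r y0 \<Longrightarrow> 0 < fst z \<Longrightarrow> 0 < X z"
    and posdef: "y \<in> ball y0 r' \<Longrightarrow> u \<noteq> 0 \<Longrightarrow>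
      0 < (\<Sum>i\<in>Basis. \<Sum>j\<in>Basis. G i j (0, y) * (u \<bullet> i) * (u \<bullet> j))"
    and conformal: "y \<in> ball y0 r \<Longrightarrow> i \<in> Basis \<Longrightarrow> j \<in> Basis \<Longrightarrow> K i j (0, y) = exp (2 * \<omega> y) * G i j (0, y)"
    and evenG: "y \<in> ball y0 r' \<Longrightarrow> i \<in> Basis \<Longrightarrow> j \<in> Basis \<Longrightarrow> k < n \<Longrightarrow> odd k \<Longrightarrow> (ds ^^ k) (G i j) (0, y) = 0"
    and isometry: "z \<in> slab r y0 \<Longrightarrow> 0 < fst z \<Longrightarrow>
      (fst z)\<^sup>2 * (frechet_derivative X (at z) \<xi> * frechet_derivative X (at z) \<eta> +
        (\<Sum>i\<in>Basis. \<Sum>j\<in>Basis. G i j (X z, Y z) *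
          frechet_derivative (\<lambda>z. Y z \<bullet> i) (at z) \<xi> * frechet_derivative (\<lambda>z. Y z \<bullet> j) (at z) \<eta>)) =
      (X z)\<^sup>2 * (fst \<xi> * fst \<eta> + (\<Sum>i\<in>Basis. \<Sum>j\<in>Basis. K i j z * (snd \<xi> \<bullet> i) * (snd \<eta> \<bullet> j)))"
begin

section \<open>Derivatives of the transition and their values at the boundary\<close>

definition DX :: "'e \<Rightarrow> real \<times> 'e \<Rightarrow> real" where
  "DX u z = frechet_derivative X (at z) (0, u)"

definition DY :: "'e \<Rightarrow> 'e \<Rightarrow> real \<times> 'e \<Rightarrow> real" where
  "DY i u z = frechet_derivative (\<lambda>z. Y z \<bullet> i) (at z) (0, u)"

definition dsY :: "'e \<Rightarrow> real \<times> 'e \<Rightarrow> real" where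
  "dsY i = ds (\<lambda>z. Y z \<bullet> i)"

definition GP :: "'e \<Rightarrow> 'e \<Rightarrow> real \<times> 'e \<Rightarrow> real" where
  "GP i j z = G i j (X z, Y z)"

lemma Yi: "Cinf_on (slab r y0) (\<lambda>z. Y z \<bullet> i)"
  using Cinf_on_inner[OF Y] .

lemma DX: "Cinf_on (slab r y0) (DX u)"
  unfolding DX_def[abs_def] using Cinf_on_frechet_derivative[OF X] .

lemma DY: "Cinf_on (slab r y0) (DY i u)"
  unfolding DY_def[abs_def] using Cinf_on_frechet_derivative[OF Yi] .

lemma dsY: "Cinf_on (slab r y0) (dsY i)"
  unfolding dsY_def using Cinf_on_ds[OF Yi] .

lemma GP: "i \<in> Basis \<Longrightarrow> j \<in> Basis \<Longrightarrow> Cinf_on (slab r y0) (GP i j)"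
  unfolding GP_def[abs_def] by (rule Cinf_on_compose[OF G Cinf_on_Pair[OF X Y]]) (use maps in auto)

lemma ball_sub: "y \<in> ball y0 r \<Longrightarrow> y \<in> ball y0 r'"
  using maps[of "(0, y)"] X0[of y] Y0[of y] r r' by (simp add: slab_zero)

lemma GP0: "y \<in> ball y0 r \<Longrightarrow> GP i j (0, y) = G i j (0, y)"
  by (simp add: GP_def X0 Y0)

lemma ord_X: "y \<in> ball y0 r \<Longrightarrow> ord0 1 (\<lambda>s. X (s, y))"
  using ord0_slice_diff[OF X r] X0 by simp

lemma ord_X2: "y \<in> ball y0 r \<Longrightarrow> ord0 2 (\<lambda>s. X (s, y) - ds X (0, y) * s)"
  using ord0_slice_diff2[OF X r] X0 by simp

lemma ord_DX: "y \<in> ball y0 r \<Longrightarrow> ord0 1 (\<lambda>s. DX u (s, y))"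
  unfolding DX_def by (rule ord0_tangential[OF X r ord_X])

lemma DX0: "y \<in> ball y0 r \<Longrightarrow> DX u (0, y) = 0"
  using ord0_iff_vanishes[OF DX r, of y 1 u] ord_DX[of y u] by (simp add: vanishes_def)

text \<open>The function \<open>Y z \<bullet> i - snd z \<bullet> i\<close> vanishes at all boundary
  points of the ball, hence so do its derivatives along the boundary.\<close>

lemma DY0: assumes y: "y \<in> ball y0 r" shows "DY i u (0, y) = u \<bullet> i"
proof -
  define F where "F = (\<lambda>z::real \<times> 'e. Y z \<bullet> i - snd z \<bullet> i)"
  have bl: "bounded_linear (\<lambda>z::real \<times> 'e. snd z \<bullet> i)"
    by (intro bounded_linear_inner_left_comp bounded_linear_snd)
  have F: "Cinf_on (slab r y0) F" unfolding F_def
    by (intro Cinf_on_diff Yi Cinf_on_bounded_linear open_slab bl)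
  have z: "(0, y) \<in> slab r y0" using y r by (simp add: slab_zero)
  have "ord0 1 (\<lambda>s. F (s, y))" if "y \<in> ball y0 r" for y
    using ord0_slice_diff[OF F r that] Y0[OF that] by (simp add: F_def)
  from ord0_tangential[OF F r this y]
  have "vanishes 1 (\<lambda>z. frechet_derivative F (at z) (0, u)) y"
    using ord0_iff_vanishes[OF Cinf_on_frechet_derivative[OF F] r y] by blast
  then have "frechet_derivative F (at (0, y)) (0, u) = 0" by (simp add: vanishes_def)
  moreover have D: "(F has_derivative (\<lambda>v. frechet_derivative (\<lambda>z. Y z \<bullet> i) (at (0, y)) v - snd v \<bullet> i)) (at (0, y))"
    unfolding F_def
    by (rule has_derivative_diff[OF Cinf_on_has_derivative[OF Yi z] bounded_linear_imp_has_derivative[OF bl]])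
  ultimately have "frechet_derivative (\<lambda>z. Y z \<bullet> i) (at (0, y)) (0, u) - snd (0 :: real, u) \<bullet> i = 0"
    using fun_cong[OF frechet_derivative_at[OF D], of "(0, u)"] by simp
  then show ?thesis by (simp add: DY_def)
qed

lemma ord_DY: "y \<in> ball y0 r \<Longrightarrow> ord0 0 (\<lambda>s. DY i u (s, y))"
  by (rule ord0_slice[OF DY r])

lemma ord_DY_diff: "y \<in> ball y0 r \<Longrightarrow> ord0 1 (\<lambda>s. DY i u (s, y) - u \<bullet> i)"
  using ord0_slice_diff[OF DY r] DY0 by simp

lemma ord_GP: "y \<in> ball y0 r \<Longrightarrow> i \<in> Basis \<Longrightarrow> j \<in> Basis \<Longrightarrow> ord0 0 (\<lambda>s. GP i j (s, y))"
  by (rule ord0_slice[OF GP r])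

section \<open>The components of the isometry equation\<close>

lemma isometry_normal:
  assumes y: "y \<in> ball y0 r"
  shows "ord0 m (\<lambda>s. s\<^sup>2 * (ds X (s, y) * ds X (s, y) +
    (\<Sum>i\<in>Basis. \<Sum>j\<in>Basis. GP i j (s, y) * (dsY i (s, y) * dsY j (s, y)))) - X (s, y) * X (s, y))"
proof -
  define E where "E = (\<lambda>z. fst z * fst z * (ds X z * ds X z +
    (\<Sum>i\<in>Basis. \<Sum>j\<in>Basis. GP i j z * (dsY i z * dsY j z))) - X z * X z)"
  have E: "Cinf_on (slab r y0) E" unfolding E_def
    by (intro Cinf_on_diff Cinf_on_add Cinf_on_mult Cinf_on_sum X GP dsY Cinf_on_ds open_slab
        Cinf_on_bounded_linear bounded_linear_fst)
  have "ord0 m (\<lambda>s. E (s, y))"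
  proof (rule ord0_flat[OF E r y])
    fix s :: real assume "0 < s" "(s, y) \<in> slab r y0"
    with isometry[of "(s, y)" "(1, 0)" "(1, 0)"] show "E (s, y) = 0"
      by (simp add: E_def GP_def dsY_def ds_def power2_eq_square mult.assoc)
  qed
  then show ?thesis by (simp add: E_def power2_eq_square)
qed

text \<open>Arranged as a linear system for \<open>Y\<^sub>s\<close>: the inner sums are its
  coefficients, and at \<open>s = 0\<close> they form the matrix of the boundary metric, which is
  invertible.\<close>

lemma isometry_mixed:
  assumes y: "y \<in> ball y0 r"
  shows "ord0 m (\<lambda>s. ds X (s, y) * DX u (s, y) +
    (\<Sum>i\<in>Basis. dsY i (s, y) * (\<Sum>j\<in>Basis. GP i j (s, y) * DY j u (s, y))))"
proof -
  define E where "E = (\<lambda>z. ds X z * DX u z + (\<Sum>i\<in>Basis. dsY i z * (\<Sum>j\<in>Basis. GP i j z * DY j u z)))"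
  have E: "Cinf_on (slab r y0) E" unfolding E_def
    by (intro Cinf_on_add Cinf_on_mult Cinf_on_sum X GP dsY DX DY Cinf_on_ds open_slab)
  have "ord0 m (\<lambda>s. E (s, y))"
  proof (rule ord0_flat[OF E r y])
    fix s :: real assume "0 < s" "(s, y) \<in> slab r y0"
    \<comment> \<open>On the right side the metric of the second collar has no mixed term, and the
      factor \<open>s\<^sup>2\<close> on the left is nonzero.\<close>
    with isometry[of "(s, y)" "(1, 0)" "(0, u)"] show "E (s, y) = 0"
      by (simp add: E_def GP_def dsY_def ds_def DX_def DY_def sum_distrib_left mult_ac)
  qed
  then show ?thesis by (simp add: E_def)
qed

lemma isometry_tangential:
  assumes y: "y \<in> ball y0 r" and ij: "i \<in> Basis" "j \<in> Basis"
  shows "ord0 m (\<lambda>s. s\<^sup>2 * (DX i (s, y) * DX j (s, y) +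
    (\<Sum>k\<in>Basis. \<Sum>l\<in>Basis. GP k l (s, y) * (DY k i (s, y) * DY l j (s, y)))) - X (s, y) * X (s, y) * K i j (s, y))"
proof -
  define E where "E = (\<lambda>z. fst z * fst z * (DX i z * DX j z +
    (\<Sum>k\<in>Basis. \<Sum>l\<in>Basis. GP k l z * (DY k i z * DY l j z))) - X z * X z * K i j z)"
  have E: "Cinf_on (slab r y0) E" unfolding E_def
    by (intro Cinf_on_diff Cinf_on_add Cinf_on_mult Cinf_on_sum X GP DX DY K ij open_slab
        Cinf_on_bounded_linear bounded_linear_fst)
  have "ord0 m (\<lambda>s. E (s, y))"
  proof (rule ord0_flat[OF E r y])
    fix s :: real assume "0 < s" "(s, y) \<in> slab r y0"
    with isometry[of "(s, y)" "(0, i)" "(0, j)"] show "E (s, y) = 0"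
      by (simp add: E_def GP_def DX_def DY_def power2_eq_square mult.assoc sum_Basis_Basis[OF ij, unfolded mult.assoc])
  qed
  then show ?thesis by (simp add: E_def power2_eq_square)
qed

lemma X_over_s_tendsto:
  assumes y: "y \<in> ball y0 r"
  shows "((\<lambda>s. X (s, y) / s) \<longlongrightarrow> ds X (0, y)) (at 0)"
  using has_real_derivative_ds[OF X, of 0 y] y r X0[OF y]
  by (simp add: slab_zero has_field_derivative_iff)

text \<open>Division by \<open>s\<^sup>2\<close> removes the degeneration at the boundary, since
  \<open>X / s\<close> has the limit \<open>ds X (0, y)\<close>.\<close>

lemma ord0_divide_square:
  assumes "ord0 (2 + m) (\<lambda>s. s\<^sup>2 * f s - X (s, y) * X (s, y) * g s)"
  shows "ord0 m (\<lambda>s. f s - (X (s, y) / s)\<^sup>2 * g s)"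
proof (rule ord0_cancel[of 2])
  show "ord0 (2 + m) (\<lambda>s. s\<^sup>2 * (f s - (X (s, y) / s)\<^sup>2 * g s))"
    by (rule ord0_cong[OF assms])
      (auto simp: eventually_at_filter power2_eq_square algebra_simps intro!: always_eventually)
qed

lemma slice_tendsto:
  "Cinf_on (slab r y0) F \<Longrightarrow> y \<in> ball y0 r \<Longrightarrow> ((\<lambda>s. F (s, y)) \<longlongrightarrow> F (0, y)) (at 0)"
proof -
  assume F: "Cinf_on (slab r y0) F" and y: "y \<in> ball y0 r"
  have "isCont F (0, y)" using Cinf_on_isCont[OF F] y r by (simp add: slab_zero)
  then show ?thesis
    by (rule isCont_tendsto_compose) (intro tendsto_Pair tendsto_ident_at tendsto_const)
qed

text \<open>Dividing the normal equation by \<open>s\<^sup>2\<close> and letting \<open>s\<close>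
  tend to 0, the two terms \<open>X\<^sub>s\<^sup>2\<close> and \<open>(X / s)\<^sup>2\<close> have
  the same limit and cancel. What remains is the boundary metric evaluated twice at
  \<open>Y\<^sub>s\<close>, which can vanish only for \<open>Y\<^sub>s = 0\<close>.\<close>

lemma dsY0:
  assumes y: "y \<in> ball y0 r" and i: "i \<in> Basis"
  shows "dsY i (0, y) = 0"
proof -
  let ?Q = "\<lambda>s. \<Sum>i\<in>Basis. \<Sum>j\<in>Basis. GP i j (s, y) * (dsY i (s, y) * dsY j (s, y))"
  define u where "u = (\<Sum>i\<in>Basis. dsY i (0, y) *\<^sub>R i)"
  have ui: "u \<bullet> i = dsY i (0, y)" if "i \<in> Basis" for i using that by (simp add: u_def)
  have "ord0 (Suc 0) (\<lambda>s. (ds X (s, y) * ds X (s, y) + ?Q s) - (X (s, y) / s)\<^sup>2 * 1)"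
    by (rule ord0_divide_square) (use isometry_normal[OF y, of 3] in \<open>simp add: eval_nat_numeral\<close>)
  from ord0_tendsto[OF this]
  have "((\<lambda>s. (ds X (s, y) * ds X (s, y) + ?Q s) - (X (s, y) / s)\<^sup>2 * 1) \<longlongrightarrow> 0) (at 0)" .
  moreover have "((\<lambda>s. (ds X (s, y) * ds X (s, y) + ?Q s) - (X (s, y) / s)\<^sup>2 * 1) \<longlongrightarrow>
      (ds X (0, y) * ds X (0, y) + ?Q 0) - (ds X (0, y))\<^sup>2 * 1) (at 0)"
    by (intro tendsto_intros X_over_s_tendsto[OF y] slice_tendsto[OF _ y] Cinf_on_ds X GP dsY)
  ultimately have "(ds X (0, y) * ds X (0, y) + ?Q 0) - (ds X (0, y))\<^sup>2 * 1 = 0"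
    using LIM_unique by blast
  then have "(\<Sum>i\<in>Basis. \<Sum>j\<in>Basis. G i j (0, y) * (u \<bullet> i) * (u \<bullet> j)) = 0"
    by (simp add: GP0[OF y] ui power2_eq_square mult.assoc)
  then have "u = 0" using posdef[OF ball_sub[OF y], of u] by force
  then show ?thesis using ui[OF i] by simp
qed

text \<open>The tangential equation divided by \<open>s\<^sup>2\<close>, in the limit and in one
  basis direction \<open>e\<close>, reads \<open>G e e = a\<^sup>2 exp (2 \<omega>) G e e\<close>
  with \<open>a = ds X (0, y)\<close>; this determines \<open>a\<close> up to sign.\<close>

lemma dsX0: assumes y: "y \<in> ball y0 r" shows "ds X (0, y) = exp (- \<omega> y)"
proof -
  obtain e :: 'e where e: "e \<in> Basis" using nonempty_Basis by blast
  let ?Q = "\<lambda>s. \<Sum>k\<in>Basis. \<Sum>l\<in>Basis. GP k l (s, y) * (DY k e (s, y) * DY l e (s, y))"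
  have "ord0 (Suc 0) (\<lambda>s. (DX e (s, y) * DX e (s, y) + ?Q s) - (X (s, y) / s)\<^sup>2 * K e e (s, y))"
    by (rule ord0_divide_square) (use isometry_tangential[OF y e e, of 3] in \<open>simp add: eval_nat_numeral\<close>)
  from ord0_tendsto[OF this]
  have "((\<lambda>s. (DX e (s, y) * DX e (s, y) + ?Q s) - (X (s, y) / s)\<^sup>2 * K e e (s, y)) \<longlongrightarrow> 0) (at 0)" .
  moreover have "((\<lambda>s. (DX e (s, y) * DX e (s, y) + ?Q s) - (X (s, y) / s)\<^sup>2 * K e e (s, y)) \<longlongrightarrow>
      (DX e (0, y) * DX e (0, y) + ?Q 0) - (ds X (0, y))\<^sup>2 * K e e (0, y)) (at 0)"
    by (intro tendsto_intros X_over_s_tendsto[OF y] slice_tendsto[OF _ y] DX GP DY K e)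
  ultimately have "(DX e (0, y) * DX e (0, y) + ?Q 0) - (ds X (0, y))\<^sup>2 * K e e (0, y) = 0"
    using LIM_unique by blast
  moreover have "?Q 0 = G e e (0, y)"
    using sum_Basis_Basis[OF e e, of "\<lambda>k l. G k l (0, y)"] by (simp add: GP0[OF y] DY0[OF y] mult.assoc)
  ultimately have eq: "G e e (0, y) = (ds X (0, y))\<^sup>2 * exp (2 * \<omega> y) * G e e (0, y)"
    using conformal[OF y e e] DX0[OF y] by simp
  have "e \<noteq> 0" using e nonzero_Basis by blast
  then have "0 < G e e (0, y)"
    using posdef[OF ball_sub[OF y]] sum_Basis_Basis[OF e e, of "\<lambda>k l. G k l (0, y)"] by fastforce
  then have "(ds X (0, y))\<^sup>2 * exp (2 * \<omega> y) = 1" using eq by simp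
  then have "(ds X (0, y) * exp (\<omega> y))\<^sup>2 = 1"
    by (simp add: power_mult_distrib exp_double)
  \<comment> \<open>The sign comes from the right, where \<open>X\<close> is positive; values at
    \<open>s < 0\<close> belong to the arbitrary extension.\<close>
  moreover have "0 \<le> ds X (0, y)"
  proof (rule tendsto_lowerbound)
    show "((\<lambda>s. X (s, y) / s) \<longlongrightarrow> ds X (0, y)) (at_right 0)"
      using X_over_s_tendsto[OF y] filterlim_at_split by blast
    show "\<forall>\<^sub>F s in at_right 0. 0 \<le> X (s, y) / s"
      unfolding eventually_at_right_field
      by (rule exI[of _ r]) (use r y Xpos in \<open>force simp: slab_def less_imp_le\<close>)
  qed simp
  ultimately have "ds X (0, y) * exp (\<omega> y) = 1"
    by (simp add: power2_eq_1_iff) (smt (verit) exp_gt_zero mult_nonneg_nonneg)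
  then show ?thesis by (simp add: exp_minus field_simps)
qed

lemma ord_dsY: "y \<in> ball y0 r \<Longrightarrow> i \<in> Basis \<Longrightarrow> ord0 1 (\<lambda>s. dsY i (s, y))"
  using ord0_slice_diff[OF dsY r, of y i] dsY0[of y i] by simp

section \<open>Parity of the metric along the transition\<close>

lemma filterlim_collar:
  assumes y: "y \<in> ball y0 r"
  shows "filterlim (\<lambda>s. (X (s, y), Y (s, y))) (nhds (0, y)) (at 0)"
proof -
  have "((\<lambda>s. (X (s, y), Y (s, y))) \<longlongrightarrow> (X (0, y), Y (0, y))) (at 0)"
    by (intro tendsto_Pair slice_tendsto[OF _ y] X Y)
  then show ?thesis by (simp add: X0[OF y] Y0[OF y])
qed

lemma filterlim_collar_uminus:
  assumes y: "y \<in> ball y0 r"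
  shows "filterlim (\<lambda>s. (X (- s, y), Y (- s, y))) (nhds (0, y)) (at 0)"
proof -
  have "((\<lambda>s::real. - s) \<longlongrightarrow> - 0) (at 0)" by (intro tendsto_intros)
  then have "filterlim uminus (at (0::real)) (at 0)"
    by (simp add: filterlim_at eventually_at_filter)
  from filterlim_compose[OF filterlim_collar[OF y] this] show ?thesis .
qed

text \<open>A bound uniform in the boundary point can be evaluated at \<open>(X, Y)\<close>, and
  powers of \<open>X\<close> become powers of \<open>s\<close> because
  \<open>X = O(s)\<close>.\<close>

lemma ord0_compose_collar:
  assumes y: "y \<in> ball y0 r" and R: "R \<in> O[nhds (0, y)](\<lambda>z. fst z ^ m)"
  shows "ord0 m (\<lambda>s. R (X (s, y), Y (s, y)))"
proof -
  have "(\<lambda>s. R (X (s, y), Y (s, y))) \<in> O[at 0](\<lambda>s. X (s, y) ^ m)"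
    using landau_o.big.compose[OF R filterlim_collar[OF y]] by simp
  also have "(\<lambda>s. X (s, y) ^ m) \<in> O[at 0](\<lambda>s. s ^ m)"
    using landau_o.big_power[of "\<lambda>s. X (s, y)" "at 0" "\<lambda>s. s" m] ord_X[OF y] by (simp add: ord0_def)
  finally show ?thesis by (simp add: ord0_def)
qed

text \<open>For even \<open>k\<close> the two terms of the defect cancel; for odd \<open>k\<close>
  the derivative itself is zero by \<open>evenG\<close>.\<close>

lemma parity_defect_G_vanishes:
  assumes y: "y \<in> ball y0 r'" and ij: "i \<in> Basis" "j \<in> Basis" and k: "k < n"
  shows "(ds ^^ k) (parity_defect 1 (G i j)) (0, y) = 0"
  using ds_pow_parity_defect[OF G[OF ij], of "(0, y)" k 1] evenG[OF y ij k] y r'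
  by (cases "odd k") (simp_all add: slab_zero parity_defect_def reflect_def)

text \<open>\<open>G i j\<close> at \<open>(X(- s), Y(- s))\<close> is replaced by its value at
  \<open>(- X(s), Y(s))\<close>. These points differ by the parity defects of \<open>X\<close> and
  \<open>Y\<close>, so the Lipschitz estimate makes the error \<open>O(s ^ m)\<close>; what is left
  is the defect of \<open>G i j\<close> itself at \<open>(X(s), Y(s))\<close>.\<close>

lemma ord_GP_swap:
  assumes y: "y \<in> ball y0 r" and ij: "i \<in> Basis" "j \<in> Basis"
    and pX: "parity_mod (-1) m (\<lambda>s. X (s, y))" and pY: "\<And>i. i \<in> Basis \<Longrightarrow> parity_mod 1 m (\<lambda>s. Y (s, y) \<bullet> i)"
  shows "ord0 m (\<lambda>s. GP i j (s, y) - GP i j (- s, y) - parity_defect 1 (G i j) (X (s, y), Y (s, y)))"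
proof -
  define \<gamma> where "\<gamma> = (\<lambda>s. (- X (s, y), Y (s, y)))"
  define \<delta> where "\<delta> = (\<lambda>s. (X (- s, y), Y (- s, y)))"
  have y': "(0, y) \<in> slab r' y0" using ball_sub[OF y] r' by (simp add: slab_zero)
  have "((\<lambda>s. (- X (s, y), Y (s, y))) \<longlongrightarrow> (- X (0, y), Y (0, y))) (at 0)"
    by (intro tendsto_Pair tendsto_minus slice_tendsto[OF _ y] X Y)
  then have \<gamma>: "filterlim \<gamma> (nhds (0, y)) (at 0)" by (simp add: \<gamma>_def X0[OF y] Y0[OF y])
  have \<delta>: "filterlim \<delta> (nhds (0, y)) (at 0)" unfolding \<delta>_def by (rule filterlim_collar_uminus[OF y])
  have "(\<lambda>s. G i j (\<gamma> s) - G i j (\<delta> s)) \<in> O[at 0](\<lambda>s. norm (\<gamma> s - \<delta> s))"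
    by (rule lipschitz_bigo[OF G[OF ij] y' \<gamma> \<delta>])
  also have "(\<lambda>s. norm (\<gamma> s - \<delta> s)) \<in> O[at 0](\<lambda>s. \<bar>X (s, y) + X (- s, y)\<bar> + (\<Sum>i\<in>Basis. \<bar>Y (s, y) \<bullet> i - Y (- s, y) \<bullet> i\<bar>))"
  proof (rule bigoI[where c = 1], rule always_eventually, rule allI)
    fix s
    have "norm (\<gamma> s - \<delta> s) \<le> norm (- X (s, y) - X (- s, y)) + norm (Y (s, y) - Y (- s, y))"
      unfolding \<gamma>_def \<delta>_def diff_Pair by (rule norm_Pair_le)
    also have "norm (Y (s, y) - Y (- s, y)) \<le> (\<Sum>i\<in>Basis. \<bar>Y (s, y) \<bullet> i - Y (- s, y) \<bullet> i\<bar>)"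
      using norm_le_l1[of "Y (s, y) - Y (- s, y)"] by (simp add: inner_diff_left)
    finally have "norm (\<gamma> s - \<delta> s) \<le> \<bar>X (s, y) + X (- s, y)\<bar> + (\<Sum>i\<in>Basis. \<bar>Y (s, y) \<bullet> i - Y (- s, y) \<bullet> i\<bar>)"
      by (simp add: abs_minus_commute[of "- X (s, y)"] add.commute)
    then show "norm (norm (\<gamma> s - \<delta> s)) \<le> 1 * norm (\<bar>X (s, y) + X (- s, y)\<bar> + (\<Sum>i\<in>Basis. \<bar>Y (s, y) \<bullet> i - Y (- s, y) \<bullet> i\<bar>))"
      by simp
  qed
  also have "(\<lambda>s. \<bar>X (s, y) + X (- s, y)\<bar> + (\<Sum>i\<in>Basis. \<bar>Y (s, y) \<bullet> i - Y (- s, y) \<bullet> i\<bar>)) \<in> O[at 0](\<lambda>s. s ^ m)"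
    using pX pY by (intro sum_in_bigo big_sum_in_bigo) (auto simp: parity_mod_def ord0_def)
  finally have "ord0 m (\<lambda>s. G i j (\<gamma> s) - G i j (\<delta> s))" by (simp only: ord0_def)
  then show ?thesis
    by (rule ord0_eq) (simp add: \<gamma>_def \<delta>_def GP_def parity_defect_def reflect_def)
qed

text \<open>The first \<open>n\<close> Taylor coefficients of the defect of \<open>G i j\<close>
  vanish at all boundary points near \<open>y\<close>, so the defect is uniformly
  \<open>O(x ^ n)\<close>. This is where the bound \<open>m \<le> n\<close> enters.\<close>

lemma parity_mod_GP:
  assumes y: "y \<in> ball y0 r" and ij: "i \<in> Basis" "j \<in> Basis" and m: "m \<le> n"
    and pX: "parity_mod (-1) m (\<lambda>s. X (s, y))" and pY: "\<And>i. i \<in> Basis \<Longrightarrow> parity_mod 1 m (\<lambda>s. Y (s, y) \<bullet> i)"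
  shows "parity_mod 1 m (\<lambda>s. GP i j (s, y))"
proof -
  let ?R = "parity_defect 1 (G i j)"
  have y': "(0, y) \<in> slab r' y0" using ball_sub[OF y] r' by (simp add: slab_zero)
  have "\<forall>\<^sub>F z in nhds (0, y). z \<in> slab r' y0" using open_slab y' eventually_nhds by blast
  then have "\<forall>\<^sub>F z in nhds (0, y). ?R z - (\<Sum>k<n. (ds ^^ k) ?R (0, snd z) / fact k * fst z ^ k) = ?R z"
  proof eventually_elim
    case (elim z)
    then have "snd z \<in> ball y0 r'" by (auto simp: slab_def)
    then show ?case by (simp add: parity_defect_G_vanishes[OF _ ij])
  qed
  then have "?R \<in> O[nhds (0, y)](\<lambda>z. fst z ^ n)"
    by (rule landau_o.big.in_cong[THEN iffD1, OF _ taylor_uniform[OF Cinf_on_parity_defect[OF G[OF ij]] y']])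
  then have "ord0 n (\<lambda>s. ?R (X (s, y), Y (s, y)))" by (rule ord0_compose_collar[OF y])
  then have R: "ord0 m (\<lambda>s. ?R (X (s, y), Y (s, y)))" using m by (rule ord0_mono)
  have "ord0 m (\<lambda>s. GP i j (s, y) - GP i j (- s, y) - ?R (X (s, y), Y (s, y)))"
    by (rule ord_GP_swap[OF y ij pX pY])
  from ord0_add[OF this R] show ?thesis unfolding parity_mod_def by (rule ord0_eq) simp
qed

section \<open>Raising the order of parity\<close>

text \<open>The oddness defect \<open>T\<close> of \<open>Y\<^sub>s\<close> satisfies a linear
  system with coefficients \<open>A\<close> and right side \<open>O(s ^ (m + 1))\<close>: in
  \<open>X\<^sub>s X\<^sub>u\<close> one order is gained from \<open>X\<^sub>u = O(s)\<close>, and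
  in the other term from \<open>Y\<^sub>s = O(s)\<close>. The system is then solved order by order
  with the boundary metric.\<close>

lemma parity_mod_dsY_improve:
  assumes m: "m \<le> n" and y: "y \<in> ball y0 r"
    and pX: "\<And>y. y \<in> ball y0 r \<Longrightarrow> parity_mod (-1) (Suc m) (\<lambda>s. X (s, y))"
    and pY: "\<And>y i. y \<in> ball y0 r \<Longrightarrow> i \<in> Basis \<Longrightarrow> parity_mod 1 m (\<lambda>s. Y (s, y) \<bullet> i)"
    and i: "i \<in> Basis"
  shows "parity_mod (-1) (Suc m) (\<lambda>s. dsY i (s, y))"
proof -
  define T where "T = (\<lambda>i s. dsY i (s, y) + dsY i (- s, y))"
  define A where "A = (\<lambda>i u s. \<Sum>k\<in>Basis. GP i k (s, y) * DY k u (s, y))"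
  have pDY: "parity_mod 1 m (\<lambda>s. DY k u (s, y))" if "k \<in> Basis" for k u
    unfolding DY_def by (rule parity_mod_tangential[OF Yi r _ y]) (use pY that in auto)
  have pGP: "parity_mod 1 m (\<lambda>s. GP i j (s, y))" if "i \<in> Basis" "j \<in> Basis" for i j
    by (rule parity_mod_GP[OF y that m]) (use pX y pY in \<open>auto intro: parity_mod_mono[of _ "Suc m"]\<close>)
  have pA: "parity_mod 1 m (A i u)" if "i \<in> Basis" for i u unfolding A_def
    by (intro parity_mod_sum parity_mod_mult[OF pGP[OF that] ord_GP[OF y that] pDY ord_DY[OF y]]) simp_all
  have A0: "ord0 1 (\<lambda>s. A i j s - G i j (0, y))" if ij: "i \<in> Basis" "j \<in> Basis" for i j
  proof -
    have "Cinf_on (slab r y0) (\<lambda>z. \<Sum>k\<in>Basis. GP i k z * DY k j z)"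
      by (intro Cinf_on_sum Cinf_on_mult GP DY ij open_slab)
    from ord0_slice_diff[OF this r y]
    have "ord0 1 (\<lambda>s. A i j s - (\<Sum>k\<in>Basis. GP i k (0, y) * DY k j (0, y)))" by (simp add: A_def)
    moreover have "(\<Sum>k\<in>Basis. GP i k (0, y) * DY k j (0, y)) = G i j (0, y)"
      using ij by (simp add: GP0[OF y] DY0[OF y] inner_Basis if_distrib[where f = "\<lambda>t. _ * t"] cong: if_cong)
    ultimately show ?thesis by simp
  qed
  have TA: "ord0 (Suc m) (\<lambda>s. \<Sum>i\<in>Basis. T i s * A i u s)" for u
  proof -
    let ?B = "\<lambda>s. \<Sum>i\<in>Basis. dsY i (s, y) * A i u s"
    have pDX: "parity_mod (-1) (Suc m) (\<lambda>s. DX u (s, y))"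
      unfolding DX_def by (rule parity_mod_tangential[OF X r pX y])
    have pdsX: "parity_mod 1 m (\<lambda>s. ds X (s, y))"
      using parity_mod_ds[OF X r y pX[OF y]] by simp
    have p1: "parity_mod (-1) (Suc m) (\<lambda>s. ds X (s, y) * DX u (s, y))"
      by (rule parity_mod_mult[OF pdsX ord0_slice[OF Cinf_on_ds[OF X] r y] pDX ord_DX[OF y]]) simp_all
    \<comment> \<open>The full left side is flat, so it has either parity to any order; the odd one
      is chosen in order to subtract \<open>p1\<close>.\<close>
    have p2: "parity_mod (-1) (Suc m) (\<lambda>s. ds X (s, y) * DX u (s, y) + ?B s)"
      by (rule ord0_imp_par) (use isometry_mixed[OF y, of "Suc m" u] in \<open>simp add: A_def\<close>)
    have "parity_mod (-1) (Suc m) ?B"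
      by (rule parity_mod_cong[OF parity_mod_diff[OF p2 p1]]) simp
    moreover have "ord0 (Suc m) (\<lambda>s. \<Sum>i\<in>Basis. dsY i (- s, y) * (A i u s - 1 * A i u (- s)))"
      using pA[of _ u] unfolding parity_mod_def
      by (intro ord0_sum ord0_mult[OF ord0_uminus[OF ord_dsY[OF y]]]) auto
    \<comment> \<open>Adding \<open>Y\<^sub>s(- s) (A(s) - A(- s))\<close> to
      \<open>?B(s) + ?B(- s)\<close> collects everything into \<open>T(s) A(s)\<close>.\<close>
    ultimately have "ord0 (Suc m) (\<lambda>s. ?B s - - 1 * ?B (- s) + (\<Sum>i\<in>Basis. dsY i (- s, y) * (A i u s - 1 * A i u (- s))))"
      unfolding parity_mod_def by (rule ord0_add)
    then show ?thesis
      by (rule ord0_eq) (simp add: T_def sum.distrib[symmetric] algebra_simps)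
  qed
  have "\<forall>i\<in>Basis. ord0 l (T i)" if "l \<le> Suc m" for l
    using that
  proof (induction l)
    case 0
    show ?case unfolding T_def
      by (intro ballI ord0_add ord0_uminus ord0_slice[OF dsY r y])
  next
    case (Suc l)
    then have T: "ord0 l (T i)" if "i \<in> Basis" for i using that by simp
    show ?case
    proof
      fix k :: 'e assume k: "k \<in> Basis"
      have sym: "\<exists>w. \<forall>i\<in>Basis. (\<Sum>j\<in>Basis. G i j (0, y) * (w \<bullet> j)) = k \<bullet> i"
        by (rule posdef_dual_vector) (use posdef[OF ball_sub[OF y]] in blast)
      \<comment> \<open>The coordinates of \<open>w\<close> form the column \<open>k\<close> of the
        inverse matrix; weighting the equations with them isolates \<open>T k\<close>.\<close>
      then obtain w where w: "\<And>i. i \<in> Basis \<Longrightarrow> (\<Sum>j\<in>Basis. G i j (0, y) * (w \<bullet> j)) = k \<bullet> i" by blast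
      have 1: "ord0 (Suc l) (\<lambda>s. \<Sum>i\<in>Basis. T i s * A i j s)" for j
        by (rule ord0_mono[OF TA]) (use Suc.prems in simp)
      have 2: "ord0 (Suc l) (\<lambda>s. \<Sum>i\<in>Basis. T i s * (A i j s - G i j (0, y)))" if "j \<in> Basis" for j
        by (intro ord0_sum ord0_mult[OF T A0]) (use that in auto)
      have 3: "ord0 (Suc l) (\<lambda>s. \<Sum>i\<in>Basis. T i s * G i j (0, y))" if "j \<in> Basis" for j
        by (rule ord0_eq[OF ord0_diff[OF 1[of j] 2[OF that]]]) (simp add: sum_subtractf[symmetric] algebra_simps)
      have "ord0 (Suc l) (\<lambda>s. \<Sum>j\<in>Basis. (w \<bullet> j) * (\<Sum>i\<in>Basis. T i s * G i j (0, y)))"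
        by (intro ord0_sum ord0_cmult 3)
      moreover have "(\<Sum>j\<in>Basis. (w \<bullet> j) * (\<Sum>i\<in>Basis. T i s * G i j (0, y))) = T k s" for s
      proof -
        have "(\<Sum>j\<in>Basis. (w \<bullet> j) * (\<Sum>i\<in>Basis. T i s * G i j (0, y))) =
            (\<Sum>i\<in>Basis. T i s * (\<Sum>j\<in>Basis. G i j (0, y) * (w \<bullet> j)))"
          by (simp add: sum_distrib_left mult_ac) (rule sum.swap)
        also have "\<dots> = (\<Sum>i\<in>Basis. T i s * (k \<bullet> i))" using w by simp
        also have "\<dots> = T k s"
          using k by (simp add: inner_Basis if_distrib[where f = "\<lambda>t. _ * t"] cong: if_cong)
        finally show ?thesis .
      qed
      ultimately show "ord0 (Suc l) (T k)" by (rule ord0_eq)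
    qed
  qed
  then have "ord0 (Suc m) (T i)" using i by blast
  then show ?thesis unfolding parity_mod_def T_def by (rule ord0_eq) simp
qed

text \<open>The term of the normal equation that contains \<open>h\<close> is even modulo
  \<open>s ^ (m + 2)\<close>, two orders being gained from the two factors \<open>Y\<^sub>s\<close>.
  Comparing the equation at \<open>s\<close> and at \<open>- s\<close> gives a linear equation for
  the oddness defect \<open>D\<close>; with \<open>P \<approx> 2 a\<close> and
  \<open>M \<approx> 2 a s\<close> it reduces to \<open>s D' - D = O(s ^ (m + 2))\<close>.\<close>

lemma parity_mod_X_improve:
  assumes m: "1 \<le> m" "m \<le> n" and y: "y \<in> ball y0 r"
    and pX: "\<And>y. y \<in> ball y0 r \<Longrightarrow> parity_mod (-1) (Suc m) (\<lambda>s. X (s, y))"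
    and pY: "\<And>y i. y \<in> ball y0 r \<Longrightarrow> i \<in> Basis \<Longrightarrow> parity_mod 1 m (\<lambda>s. Y (s, y) \<bullet> i)"
  shows "parity_mod (-1) (Suc (Suc m)) (\<lambda>s. X (s, y))"
proof -
  define a where "a = ds X (0, y)"
  define D where "D = (\<lambda>s. X (s, y) + X (- s, y))"
  define D' where "D' = (\<lambda>s. ds X (s, y) - ds X (- s, y))"
  define P where "P = (\<lambda>s. ds X (s, y) + ds X (- s, y))"
  define M where "M = (\<lambda>s. X (s, y) - X (- s, y))"
  let ?Q = "\<lambda>s. \<Sum>i\<in>Basis. \<Sum>j\<in>Basis. GP i j (s, y) * (dsY i (s, y) * dsY j (s, y))"
  have a: "a \<noteq> 0" using dsX0[OF y] by (simp add: a_def)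
  have D: "ord0 (Suc m) D"
    using pX[OF y] unfolding parity_mod_def D_def by (rule ord0_eq) simp
  have D': "ord0 m D'"
    using parity_mod_ds[OF X r y pX[OF y]] unfolding parity_mod_def D'_def by (rule ord0_eq) simp
  have dX1: "ord0 1 (\<lambda>s. ds X (s, y) - a)"
    unfolding a_def by (rule ord0_slice_diff[OF Cinf_on_ds[OF X] r y])
  have P: "ord0 1 (\<lambda>s. P s - 2 * a)"
    using ord0_add[OF dX1 ord0_uminus[OF dX1]] by (rule ord0_eq) (simp add: P_def)
  have X2: "ord0 2 (\<lambda>s. X (s, y) - a * s)" unfolding a_def by (rule ord_X2[OF y])
  have M: "ord0 2 (\<lambda>s. M s - 2 * a * s)"
    using ord0_diff[OF X2 ord0_uminus[OF X2]] by (rule ord0_eq) (simp add: M_def algebra_simps)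
  have pdsY: "parity_mod (-1) (Suc m) (\<lambda>s. dsY i (s, y))" if "i \<in> Basis" for i
    by (rule parity_mod_dsY_improve[OF m(2) y _ _ that]) (use pX pY in auto)
  have pGP: "parity_mod 1 m (\<lambda>s. GP i j (s, y))" if "i \<in> Basis" "j \<in> Basis" for i j
    by (rule parity_mod_GP[OF y that m(2)]) (use pX y pY in \<open>auto intro: parity_mod_mono[of _ "Suc m"]\<close>)
  have pQ: "parity_mod 1 (2 + m) ?Q"
  proof (intro parity_mod_sum)
    fix i j :: 'e assume ij: "i \<in> Basis" "j \<in> Basis"
    have 1: "parity_mod 1 (2 + m) (\<lambda>s. dsY i (s, y) * dsY j (s, y))"
      by (rule parity_mod_mult[OF pdsY[OF ij(1)] ord_dsY[OF y ij(1)] pdsY[OF ij(2)] ord_dsY[OF y ij(2)]]) simp_all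
    have 2: "ord0 2 (\<lambda>s. dsY i (s, y) * dsY j (s, y))"
      by (rule ord0_mult[OF ord_dsY[OF y ij(1)] ord_dsY[OF y ij(2)]]) simp
    show "parity_mod 1 (2 + m) (\<lambda>s. GP i j (s, y) * (dsY i (s, y) * dsY j (s, y)))"
      by (rule parity_mod_mult[OF pGP[OF ij] ord_GP[OF y ij] 1 2]) simp_all
  qed
  have "parity_mod 1 (4 + m) (\<lambda>s. s\<^sup>2 * ?Q s)"
  proof -
    have "ord0 (4 + m) (\<lambda>s. s\<^sup>2 * (?Q s - 1 * ?Q (- s)))"
      by (rule ord0_mult[OF ord0_power[of 2 2] pQ[unfolded parity_mod_def]]) simp_all
    then show ?thesis unfolding parity_mod_def by (rule ord0_eq) (simp add: right_diff_distrib)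
  qed
  \<comment> \<open>The defects of the squares factor as
    \<open>X\<^sub>s(s)\<^sup>2 - X\<^sub>s(- s)\<^sup>2 = D' P\<close> and
    \<open>X(s)\<^sup>2 - X(- s)\<^sup>2 = D M\<close>.\<close>
  from parity_mod_diff[OF ord0_imp_par[OF isometry_normal[OF y], of 1 "4 + m"] this]
  have "ord0 (4 + m) (\<lambda>s. s\<^sup>2 * (D' s * P s) - D s * M s)"
    unfolding parity_mod_def by (rule ord0_eq) (simp add: D_def D'_def P_def M_def algebra_simps)
  then have "ord0 (3 + m) (\<lambda>s. s\<^sup>2 * (D' s * P s) - D s * M s)" by (rule ord0_mono) simp
  moreover have "ord0 (3 + m) (\<lambda>s. s\<^sup>2 * (D' s * (P s - 2 * a)))"
    by (rule ord0_mult[OF ord0_power[of 2 2] ord0_mult[OF D' P, of "Suc m"]]) simp_all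
  moreover have "ord0 (3 + m) (\<lambda>s. D s * (M s - 2 * a * s))"
    by (rule ord0_mult[OF D M]) simp
  ultimately have "ord0 (3 + m) (\<lambda>s. s\<^sup>2 * (D' s * P s) - D s * M s - s\<^sup>2 * (D' s * (P s - 2 * a))
      + D s * (M s - 2 * a * s))" by (intro ord0_add[OF ord0_diff])
  then have "ord0 (1 + (Suc (Suc m))) (\<lambda>s. s ^ 1 * (2 * a * (s * D' s - D s)))"
    by (rule ord0_eq[OF ord0_mono]) (simp_all add: power2_eq_square algebra_simps)
  then have "ord0 (Suc (Suc m)) (\<lambda>s. 2 * a * (s * D' s - D s))" by (rule ord0_cancel)
  then have sD: "ord0 (Suc (Suc m)) (\<lambda>s. s * D' s - D s)"
    by (rule ord0_cancel_tendsto[OF tendsto_const, rotated]) (use a in simp)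
  let ?F = "parity_defect (-1) X"
  have F: "Cinf_on (slab r y0) ?F" by (rule Cinf_on_parity_defect[OF X])
  have y': "(0, y) \<in> slab r y0" using y r by (simp add: slab_zero)
  have FD: "?F (s, y) = D s" for s by (simp add: parity_defect_def reflect_def D_def)
  have van: "(ds ^^ k) ?F (0, y) = 0" if "k < Suc m" for k
    using ord0_iff_vanishes[OF F r y, of "Suc m"] D that by (simp add: FD vanishes_def)
  \<comment> \<open>The one coefficient of \<open>D\<close> below order \<open>m + 2\<close> that is
    not yet known to vanish.\<close>
  define d where "d = (ds ^^ Suc m) ?F (0, y) / fact (Suc m)"
  have "ord0 (Suc (Suc m)) (\<lambda>s. ?F (s, y) - (\<Sum>k<Suc (Suc m). (ds ^^ k) ?F (0, y) / fact k * s ^ k))"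
    unfolding ord0_def by (rule taylor_slice[OF F y'])
  then have TD: "ord0 (Suc (Suc m)) (\<lambda>s. D s - d * s ^ Suc m)"
    by (rule ord0_eq) (simp add: FD van d_def del: funpow.simps fact_Suc power_Suc)
  have "ord0 (Suc m) (\<lambda>s. ds ?F (s, y) - (\<Sum>k<Suc m. (ds ^^ k) (ds ?F) (0, y) / fact k * s ^ k))"
    unfolding ord0_def by (rule taylor_slice[OF Cinf_on_ds[OF F] y'])
  then have "ord0 (Suc m) (\<lambda>s. ds ?F (s, y) - real (Suc m) * d * s ^ m)"
  proof (rule ord0_eq)
    have "(ds ^^ k) (ds ?F) (0, y) = (ds ^^ Suc k) ?F (0, y)" for k
      by (simp add: funpow_swap1)
    then show "ds ?F (s, y) - (\<Sum>k<Suc m. (ds ^^ k) (ds ?F) (0, y) / fact k * s ^ k) =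
        ds ?F (s, y) - real (Suc m) * d * s ^ m" for s
      by (simp add: van d_def del: funpow.simps of_nat_Suc power_Suc)
  qed
  then have TD': "ord0 (Suc m) (\<lambda>s. D' s - real (Suc m) * d * s ^ m)"
  proof (rule ord0_cong)
    show "\<forall>\<^sub>F s in at 0. ds ?F (s, y) - real (Suc m) * d * s ^ m = D' s - real (Suc m) * d * s ^ m"
      using eventually_slab[OF r y]
      by eventually_elim (simp add: ds_parity_defect[OF X] D'_def parity_defect_def reflect_def)
  qed
  have "ord0 (Suc (Suc m)) (\<lambda>s. s ^ 1 * (D' s - real (Suc m) * d * s ^ m))"
    by (rule ord0_mult[OF ord0_power[OF order_refl] TD']) simp
  from ord0_diff[OF sD ord0_diff[OF this TD]]
  have "ord0 (Suc (Suc m)) (\<lambda>s. real m * d * s ^ Suc m)"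
    by (rule ord0_eq) (simp add: algebra_simps)
  moreover have "real m * d * s ^ Suc m = (\<Sum>k<Suc (Suc m). (if k = Suc m then real m * d else 0) * s ^ k)" for s
    by (simp del: power_Suc)
  ultimately have "ord0 (Suc (Suc m)) (\<lambda>s. \<Sum>k<Suc (Suc m). (if k = Suc m then real m * d else 0) * s ^ k)"
    by (simp only:)
  \<comment> \<open>The equation yields \<open>m d = 0\<close>. For \<open>m = 0\<close> it would be
    void: linear functions solve \<open>s D' = D\<close>, hence the hypothesis
    \<open>1 \<le> m\<close>.\<close>
  from ord0_polynomial_zero[OF this, of "Suc m"] have "d = 0" using m by simp
  then show ?thesis
    using TD unfolding parity_mod_def by (intro ord0_eq[OF TD]) (simp add: D_def)
qed

text \<open>The induction starts from smoothness and the boundary values: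
  \<open>X (0, y) = 0\<close> makes \<open>X\<close> odd modulo \<open>s\<^sup>2\<close>, and any
  smooth \<open>Y\<close> is even modulo \<open>s\<close>. It can go on up to \<open>m = n\<close>,
  as far as \<open>h\<close> is known to be even.\<close>

lemma parity_mod_collar:
  assumes "m \<le> n" and y: "y \<in> ball y0 r"
  shows "parity_mod (-1) (Suc (Suc m)) (\<lambda>s. X (s, y)) \<and> (\<forall>i\<in>Basis. parity_mod 1 (Suc m) (\<lambda>s. Y (s, y) \<bullet> i))"
  using assms
proof (induction m arbitrary: y)
  case 0
  note y = 0(2)
  have "parity_mod (-1) (Suc (Suc 0)) (\<lambda>s. X (s, y))"
  proof (rule parity_mod_ds_conv[OF X r y])
    show "parity_mod (- (- 1)) (Suc 0) (\<lambda>s. ds X (s, y))"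
      by (rule parity_mod_ds_conv[OF Cinf_on_ds[OF X] r y])
        (intro ord0_imp_par ord0_slice[OF Cinf_on_ds[OF Cinf_on_ds[OF X]] r y], simp)
  qed (simp add: X0[OF y])
  moreover have "parity_mod 1 (Suc 0) (\<lambda>s. Y (s, y) \<bullet> i)" for i
    by (rule parity_mod_ds_conv[OF Yi r y]) (intro ord0_imp_par ord0_slice[OF Cinf_on_ds[OF Yi] r y], simp)
  ultimately show ?case by blast
next
  case (Suc m)
  have m: "1 \<le> Suc m" "Suc m \<le> n" "m \<le> n" using Suc.prems by auto
  have pX: "parity_mod (-1) (Suc (Suc m)) (\<lambda>s. X (s, y))" if "y \<in> ball y0 r" for y
    using Suc.IH[OF m(3) that] by blast
  have pY: "parity_mod 1 (Suc m) (\<lambda>s. Y (s, y) \<bullet> i)" if "y \<in> ball y0 r" "i \<in> Basis" for y i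
    using Suc.IH[OF m(3) that(1)] that(2) by blast
  have "parity_mod (-1) (Suc (Suc (Suc m))) (\<lambda>s. X (s, y))"
    by (rule parity_mod_X_improve[OF m(1,2) Suc.prems(2) pX pY])
  moreover have "parity_mod 1 (Suc (Suc m)) (\<lambda>s. Y (s, y) \<bullet> i)" if i: "i \<in> Basis" for i
  proof -
    have "parity_mod (-1) (Suc (Suc m)) (\<lambda>s. dsY i (s, y))"
      by (rule parity_mod_dsY_improve[OF m(2) Suc.prems(2) pX pY i])
    then show ?thesis
      \<comment> \<open>Integrating \<open>dsY\<close> raises its order by one; the result is
        weakened to the order stated in the induction.\<close>
      by (intro parity_mod_mono[OF parity_mod_ds_conv[OF Yi r Suc.prems(2), of 1 "Suc (Suc m)" i]]) (simp_all add: dsY_def)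
  qed
  ultimately show ?case by blast
qed

section \<open>The odd coefficient of order n\<close>

text \<open>The reflection defect of \<open>G i j\<close> starts with the \<open>x ^ n\<close> term,
  doubled because \<open>n\<close> is odd. Along the transition \<open>x ^ n\<close> becomes
  \<open>a ^ n s ^ n\<close> up to higher order, and the base point \<open>Y\<close> moves away from
  \<open>y\<close> only by \<open>O(s)\<close>, so the coefficient may be taken at \<open>y\<close>.
  The parity of \<open>X\<close> and \<open>Y\<close> modulo \<open>s ^ (n + 1)\<close> keeps the
  swap of the argument from contributing.\<close>

lemma GP_leading:
  assumes y: "y \<in> ball y0 r" and ij: "i \<in> Basis" "j \<in> Basis"
  defines "\<rho> \<equiv> 2 * (ds ^^ n) (G i j) (0, y) / fact n * ds X (0, y) ^ n"
  shows "ord0 (Suc n) (\<lambda>s. GP i j (s, y) - GP i j (- s, y) - \<rho> * s ^ n)"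
proof -
  let ?R = "parity_defect 1 (G i j)"
  define c where "c = (\<lambda>y. 2 * (ds ^^ n) (G i j) (0, y) / fact n)"
  have y': "(0, y) \<in> slab r' y0" using ball_sub[OF y] r' by (simp add: slab_zero)
  have Rn: "(ds ^^ n) ?R (0, w) / fact n = c w" if "w \<in> ball y0 r'" for w
    using ds_pow_parity_defect[OF G[OF ij], of "(0, w)" n 1] that r' odd_n
    by (simp add: slab_zero parity_defect_def reflect_def c_def)
  have "\<forall>\<^sub>F z in nhds (0, y). z \<in> slab r' y0" using open_slab y' eventually_nhds by blast
  then have "\<forall>\<^sub>F z in nhds (0, y). ?R z - (\<Sum>k<Suc n. (ds ^^ k) ?R (0, snd z) / fact k * fst z ^ k) =
      ?R z - c (snd z) * fst z ^ n"
  proof eventually_elim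
    case (elim z)
    then have "snd z \<in> ball y0 r'" by (auto simp: slab_def)
    then show ?case by (simp add: parity_defect_G_vanishes[OF _ ij] Rn[symmetric])
  qed
  then have "(\<lambda>z. ?R z - c (snd z) * fst z ^ n) \<in> O[nhds (0, y)](\<lambda>z. fst z ^ Suc n)"
    by (rule landau_o.big.in_cong[THEN iffD1, OF _ taylor_uniform[OF Cinf_on_parity_defect[OF G[OF ij]] y']])
  from ord0_compose_collar[OF y this]
  have R: "ord0 (Suc n) (\<lambda>s. ?R (X (s, y), Y (s, y)) - c (Y (s, y)) * X (s, y) ^ n)" by simp
  have p: "parity_mod (-1) (Suc n) (\<lambda>s. X (s, y))" "parity_mod 1 (Suc n) (\<lambda>s. Y (s, y) \<bullet> i)" if "i \<in> Basis" for i
    using parity_mod_collar[OF order_refl y] that by (auto intro: parity_mod_mono[of _ "Suc (Suc n)"])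
  have sw: "ord0 (Suc n) (\<lambda>s. GP i j (s, y) - GP i j (- s, y) - ?R (X (s, y), Y (s, y)))"
    by (rule ord_GP_swap[OF y ij]) (use p ij in auto)
  have "Cinf_on (slab r y0) (\<lambda>z. c (Y z))"
  proof -
    have "(0, Y z) \<in> slab r' y0" if "z \<in> slab r y0" for z
      using maps[OF that] r' by (auto simp: slab_def)
    then have "Cinf_on (slab r y0) (\<lambda>z. (ds ^^ n) (G i j) (0, Y z))"
      by (intro Cinf_on_compose[OF Cinf_on_ds_pow[OF G[OF ij]] Cinf_on_Pair[OF Cinf_on_const[OF open_slab] Y]]) auto
    from Cinf_on_mult[OF Cinf_on_const[OF open_slab, where c = "2 / fact n"] this]
    show ?thesis by (simp add: c_def)
  qed
  from ord0_slice_diff[OF this r y] have c: "ord0 1 (\<lambda>s. c (Y (s, y)) - c y)" by (simp add: Y0[OF y])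
  define a where "a = ds X (0, y)"
  have Xn: "ord0 (Suc n) (\<lambda>s. X (s, y) ^ n - a ^ n * s ^ n)"
    unfolding a_def by (rule ord0_leading_power[OF ord_X2[OF y]])
  have Xn0: "ord0 n (\<lambda>s. X (s, y) ^ n)"
    by (rule ord0_eq[OF ord0_add[OF ord0_mono[OF Xn] ord0_cmult[OF ord0_power[OF order_refl], of n "a ^ n"]]]) simp_all
  have "ord0 (Suc n) (\<lambda>s. (c (Y (s, y)) - c y) * X (s, y) ^ n)"
    by (rule ord0_mult[OF c Xn0]) simp
  from ord0_add[OF ord0_add[OF ord0_add[OF sw R] this] ord0_cmult[OF Xn, of "c y"]]
  show ?thesis
    by (rule ord0_eq) (simp add: \<rho>_def c_def a_def algebra_simps)
qed

text \<open>In the tangential equation \<open>X\<^sup>2\<close> is even modulo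
  \<open>s ^ (n + 3)\<close> and the derivatives contribute no odd term up to order
  \<open>n\<close>. So the odd part of \<open>X\<^sup>2 K\<close> comes from
  \<open>GP_leading\<close> alone, and division by
  \<open>X\<^sup>2 \<approx> a\<^sup>2 s\<^sup>2\<close> lowers the power of \<open>a\<close> from
  \<open>n\<close> to \<open>n - 2\<close>.\<close>

lemma K_leading:
  assumes y: "y \<in> ball y0 r" and ij: "i \<in> Basis" "j \<in> Basis"
  defines "\<rho> \<equiv> 2 * (ds ^^ n) (G i j) (0, y) / fact n * ds X (0, y) ^ (n - 2)"
  shows "ord0 (Suc n) (\<lambda>s. K i j (s, y) - K i j (- s, y) - \<rho> * s ^ n)"
proof -
  define a where "a = ds X (0, y)"
  have a: "a \<noteq> 0" using dsX0[OF y] by (simp add: a_def)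
  define \<tau> where "\<tau> = (\<lambda>k l. 2 * (ds ^^ n) (G k l) (0, y) / fact n * a ^ n)"
  have \<tau>: "\<tau> i j = \<rho> * a\<^sup>2"
  proof -
    have "a ^ n = a ^ (n - 2) * a\<^sup>2" using n2 by (metis power_add le_add_diff_inverse2)
    then show ?thesis by (simp add: \<tau>_def \<rho>_def a_def)
  qed
  have pX: "parity_mod (-1) (Suc (Suc n)) (\<lambda>s. X (s, y))" if "y \<in> ball y0 r" for y
    using parity_mod_collar[OF order_refl that] by blast
  have pY: "parity_mod 1 (Suc n) (\<lambda>s. Y (s, y) \<bullet> k)" if "y \<in> ball y0 r" "k \<in> Basis" for k y
    using parity_mod_collar[OF order_refl that(1)] that(2) by blast
  have pDX: "parity_mod (-1) (Suc (Suc n)) (\<lambda>s. DX u (s, y))" for u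
    unfolding DX_def by (rule parity_mod_tangential[OF X r pX y])
  have pDY: "parity_mod 1 (Suc n) (\<lambda>s. DY k u (s, y))" if "k \<in> Basis" for k u
    unfolding DY_def by (rule parity_mod_tangential[OF Yi r pY[OF _ that] y])
  define V where "V = (\<lambda>s. DX i (s, y) * DX j (s, y) +
    (\<Sum>k\<in>Basis. \<Sum>l\<in>Basis. GP k l (s, y) * (DY k i (s, y) * DY l j (s, y))))"
  have V1: "ord0 (Suc n) (\<lambda>s. DX i (s, y) * DX j (s, y) - 1 * (DX i (- s, y) * DX j (- s, y)))"
  proof -
    have "parity_mod 1 (Suc n) (\<lambda>s. DX i (s, y) * DX j (s, y))"
      by (rule parity_mod_mult[OF pDX ord_DX[OF y] pDX ord_DX[OF y]]) simp_all
    then show ?thesis by (simp only: parity_mod_def)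
  qed
  \<comment> \<open>At the boundary \<open>DY k i\<close> and \<open>DY l j\<close> are coordinates
    of basis vectors; keeping them as \<open>i \<bullet> k\<close> and \<open>j \<bullet> l\<close>
    lets the double sum collapse to the entry \<tau> \<open>i j\<close> afterwards.\<close>
  have V2: "ord0 (Suc n) (\<lambda>s. GP k l (s, y) * (DY k i (s, y) * DY l j (s, y)) -
      GP k l (- s, y) * (DY k i (- s, y) * DY l j (- s, y)) - \<tau> k l * (i \<bullet> k) * (j \<bullet> l) * s ^ n)"
    if kl: "k \<in> Basis" "l \<in> Basis" for k l
  proof -
    define g where "g = (\<lambda>s. DY k i (s, y) * DY l j (s, y))"
    have pg: "ord0 (Suc n) (\<lambda>s. g s - 1 * g (- s))"
    proof -
      have "parity_mod 1 (Suc n) g" unfolding g_def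
        by (rule parity_mod_mult[OF pDY[OF kl(1)] ord_DY[OF y] pDY[OF kl(2)] ord_DY[OF y]]) simp_all
      then show ?thesis by (simp only: parity_mod_def)
    qed
    have g0: "ord0 0 g" unfolding g_def by (rule ord0_mult[OF ord_DY[OF y] ord_DY[OF y]]) simp
    have "ord0 1 (\<lambda>s. (DY k i (s, y) - i \<bullet> k) * DY l j (s, y))"
      by (rule ord0_mult[OF ord_DY_diff[OF y] ord_DY[OF y]]) simp
    from ord0_add[OF this ord0_cmult[OF ord_DY_diff[OF y, of l j], of "i \<bullet> k"]]
    have g1: "ord0 1 (\<lambda>s. g s - (i \<bullet> k) * (j \<bullet> l))"
      by (rule ord0_eq) (simp add: g_def algebra_simps)
    have "ord0 (Suc n) (\<lambda>s. (GP k l (s, y) - GP k l (- s, y) - \<tau> k l * s ^ n) * g s)"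
      unfolding \<tau>_def a_def by (rule ord0_mult[OF GP_leading[OF y kl] g0]) simp
    moreover have "ord0 (Suc n) (\<lambda>s. \<tau> k l * s ^ n * (g s - (i \<bullet> k) * (j \<bullet> l)))"
      by (rule ord0_mult[OF ord0_cmult[OF ord0_power[OF order_refl]] g1]) simp
    moreover have "ord0 (Suc n) (\<lambda>s. GP k l (- s, y) * (g s - 1 * g (- s)))"
      by (rule ord0_mult[OF ord0_uminus[OF ord_GP[OF y kl]] pg]) simp
    ultimately have "ord0 (Suc n) (\<lambda>s. (GP k l (s, y) - GP k l (- s, y) - \<tau> k l * s ^ n) * g s
      + \<tau> k l * s ^ n * (g s - (i \<bullet> k) * (j \<bullet> l)) + GP k l (- s, y) * (g s - 1 * g (- s)))"
      by (intro ord0_add)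
    then show ?thesis by (rule ord0_eq) (simp add: g_def algebra_simps)
  qed
  have V: "ord0 (Suc n) (\<lambda>s. V s - V (- s) - \<tau> i j * s ^ n)"
  proof (rule ord0_eq[OF ord0_add[OF V1 ord0_sum[OF ord0_sum[OF V2]]]])
    fix s
    have "(\<Sum>k\<in>Basis. \<Sum>l\<in>Basis. \<tau> k l * (i \<bullet> k) * (j \<bullet> l) * s ^ n) = \<tau> i j * s ^ n"
      using sum_Basis_Basis[OF ij, of \<tau>] by (simp add: sum_distrib_right[symmetric])
    then show "DX i (s, y) * DX j (s, y) - 1 * (DX i (- s, y) * DX j (- s, y)) +
        (\<Sum>k\<in>Basis. \<Sum>l\<in>Basis. GP k l (s, y) * (DY k i (s, y) * DY l j (s, y)) -
          GP k l (- s, y) * (DY k i (- s, y) * DY l j (- s, y)) - \<tau> k l * (i \<bullet> k) * (j \<bullet> l) * s ^ n) =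
        V s - V (- s) - \<tau> i j * s ^ n"
      by (simp add: V_def sum_subtractf)
  qed assumption+
  define Z where "Z = (\<lambda>s. K i j (s, y) - K i j (- s, y))"
  have XX: "parity_mod 1 (3 + n) (\<lambda>s. X (s, y) * X (s, y))"
    by (rule parity_mod_mult[OF pX[OF y] ord_X[OF y] pX[OF y] ord_X[OF y]]) simp_all
  have E: "parity_mod 1 (3 + n) (\<lambda>s. s\<^sup>2 * V s - X (s, y) * X (s, y) * K i j (s, y))"
    using ord0_imp_par[OF isometry_tangential[OF y ij, of "3 + n"]] by (simp add: V_def)
  have F1: "ord0 (3 + n) (\<lambda>s. s\<^sup>2 * (V s - V (- s) - \<tau> i j * s ^ n))"
    by (rule ord0_mult[OF ord0_power[of 2 2] V]) simp_all
  have F2: "ord0 (3 + n) (\<lambda>s. (X (s, y) * X (s, y) - 1 * (X (- s, y) * X (- s, y))) * K i j (- s, y))"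
    using XX unfolding parity_mod_def
    by (rule ord0_mult[OF _ ord0_uminus[OF ord0_slice[OF K[OF ij] r y]]]) simp
  \<comment> \<open>The equation at \<open>- s\<close> is subtracted from the one at
    \<open>s\<close>; exchanging \<open>X(- s)\<^sup>2\<close> for \<open>X(s)\<^sup>2\<close> in
    front of \<open>K(- s)\<close> leaves \<open>X\<^sup>2 Z\<close> with
    \<open>Z(s) = K(s) - K(- s)\<close>.\<close>
  have "ord0 (3 + n) (\<lambda>s. s\<^sup>2 * (V s - V (- s) - \<tau> i j * s ^ n)
      - (s\<^sup>2 * V s - X (s, y) * X (s, y) * K i j (s, y)
        - 1 * ((- s)\<^sup>2 * V (- s) - X (- s, y) * X (- s, y) * K i j (- s, y)))
      - (X (s, y) * X (s, y) - 1 * (X (- s, y) * X (- s, y))) * K i j (- s, y))"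
    by (rule ord0_diff[OF ord0_diff[OF F1 E[unfolded parity_mod_def]] F2])
  then have main: "ord0 (3 + n) (\<lambda>s. X (s, y) * X (s, y) * Z s - \<tau> i j * s ^ (2 + n))"
    by (rule ord0_eq) (simp add: Z_def power_add power2_eq_square algebra_simps)
  have "ord0 (2 + (Suc n)) (\<lambda>s. s\<^sup>2 * (- \<tau> i j * s ^ n) - X (s, y) * X (s, y) * (- Z s))"
    using main by (rule ord0_eq[OF ord0_mono]) (simp_all add: power_add power2_eq_square)
  from ord0_divide_square[OF this]
  have Z1: "ord0 (Suc n) (\<lambda>s. (X (s, y) / s)\<^sup>2 * Z s - \<tau> i j * s ^ n)"
    by (rule ord0_eq) simp
  have Xs: "((\<lambda>s. (X (s, y) / s)\<^sup>2) \<longlongrightarrow> a\<^sup>2) (at 0)"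
    unfolding a_def by (intro tendsto_power X_over_s_tendsto[OF y])
  \<comment> \<open>A crude bound comes before the precise one: once \<open>Z = O(s ^ n)\<close>,
    replacing \<open>X\<^sup>2\<close> by \<open>a\<^sup>2 s\<^sup>2\<close> costs only
    \<open>O(s ^ (n + 3))\<close>.\<close>
  have "ord0 n (\<lambda>s. (X (s, y) / s)\<^sup>2 * Z s)"
    by (rule ord0_eq[OF ord0_add[OF ord0_mono[OF Z1] ord0_cmult[OF ord0_power[OF order_refl], of n "\<tau> i j"]]]) simp_all
  then have Zn: "ord0 n Z" by (rule ord0_cancel_tendsto[OF Xs, rotated]) (use a in simp)
  have X2: "ord0 3 (\<lambda>s. X (s, y) ^ 2 - a ^ 2 * s ^ 2)"
    using ord0_leading_power[OF ord_X2[OF y], of 2] by (simp add: a_def eval_nat_numeral)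
  have "ord0 (3 + n) (\<lambda>s. (X (s, y) ^ 2 - a ^ 2 * s ^ 2) * Z s)"
    by (rule ord0_mult[OF X2 Zn]) simp
  from ord0_diff[OF main this]
  have "ord0 (2 + Suc n) (\<lambda>s. s ^ 2 * (a\<^sup>2 * (Z s - \<rho> * s ^ n)))"
    by (rule ord0_eq[OF ord0_mono]) (simp_all add: \<tau> power_add power2_eq_square algebra_simps)
  then have "ord0 (Suc n) (\<lambda>s. a\<^sup>2 * (Z s - \<rho> * s ^ n))" by (rule ord0_cancel)
  then have "ord0 (Suc n) (\<lambda>s. Z s - \<rho> * s ^ n)"
    by (rule ord0_cancel_tendsto[OF tendsto_const, rotated]) (use a in simp)
  then show ?thesis by (simp add: Z_def)
qed

text \<open>The reflection defect of \<open>K i j\<close> has Taylor coefficients twice the odd ones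
  of \<open>K i j\<close>; comparison with \<open>K_leading\<close> leaves none below order
  \<open>n\<close> and identifies the one of order \<open>n\<close>.\<close>

lemma K_coefficients:
  assumes y: "y \<in> ball y0 r" and ij: "i \<in> Basis" "j \<in> Basis"
  shows "k < n \<Longrightarrow> odd k \<Longrightarrow> (ds ^^ k) (K i j) (0, y) = 0"
    and "(ds ^^ n) (K i j) (0, y) = exp (- (real (n - 2) * \<omega> y)) * (ds ^^ n) (G i j) (0, y)"
proof -
  let ?F = "parity_defect 1 (K i j)"
  define \<rho> where "\<rho> = 2 * (ds ^^ n) (G i j) (0, y) / fact n * ds X (0, y) ^ (n - 2)"
  have F: "Cinf_on (slab r y0) ?F" by (rule Cinf_on_parity_defect[OF K[OF ij]])
  have y': "(0, y) \<in> slab r y0" using y r by (simp add: slab_zero)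
  have "ord0 (Suc n) (\<lambda>s. ?F (s, y) - (\<Sum>k<Suc n. (ds ^^ k) ?F (0, y) / fact k * s ^ k))"
    unfolding ord0_def by (rule taylor_slice[OF F y'])
  from ord0_diff[OF K_leading[OF y ij] this]
  have "ord0 (Suc n) (\<lambda>s. \<Sum>k<Suc n. ((ds ^^ k) ?F (0, y) / fact k - (if k = n then \<rho> else 0)) * s ^ k)"
    by (rule ord0_eq)
      (simp add: \<rho>_def parity_defect_def reflect_def sum_subtractf left_diff_distrib if_distrib[where f = "\<lambda>t. t * _"] cong: if_cong)
  from ord0_polynomial_zero[OF this]
  have eq: "(ds ^^ k) ?F (0, y) / fact k = (if k = n then \<rho> else 0)" if "k < Suc n" for k
    using that by simp
  have Fk: "(ds ^^ k) ?F (0, y) = 2 * (ds ^^ k) (K i j) (0, y)" if "odd k" for k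
    using ds_pow_parity_defect[OF K[OF ij] y', of k 1] that
    by (simp add: parity_defect_def reflect_def)
  show "(ds ^^ k) (K i j) (0, y) = 0" if "k < n" "odd k"
    using eq[of k] Fk[OF that(2)] that by simp
  have "exp (- \<omega> y) ^ (n - 2) = exp (- (real (n - 2) * \<omega> y))"
    by (simp add: exp_of_nat_mult[symmetric])
  then show "(ds ^^ n) (K i j) (0, y) = exp (- (real (n - 2) * \<omega> y)) * (ds ^^ n) (G i j) (0, y)"
    using eq[of n] Fk[OF odd_n] by (simp add: \<rho>_def dsX0[OF y])
qed

end

section \<open>Charts at the boundary\<close>

lemma smooth_on_Cinf_extension:
  assumes "smooth_on S f" "z \<in> S"
  obtains U F where "z \<in> U" "Cinf_on U F" "\<And>w. w \<in> S \<Longrightarrow> w \<in> U \<Longrightarrow> F w = f w"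
proof -
  from assms(1)[unfolded smooth_on_def, rule_format, OF assms(2)]
  obtain U F where UF: "open U" "z \<in> U" "\<forall>k. Ck_on k U F" "\<forall>w\<in>S \<inter> U. F w = f w" by (elim exE conjE)
  show ?thesis by (rule that[OF UF(2), of F]) (use UF in \<open>simp_all add: Cinf_on_def\<close>)
qed

lemma open_contains_slab:
  assumes "open U" "(0, y0) \<in> U"
  obtains e where "0 < e" "slab e y0 \<subseteq> U"
proof -
  obtain S T where ST: "open S" "open T" "(0::real) \<in> S" "y0 \<in> T" "S \<times> T \<subseteq> U"
    using open_prod_elim[OF assms] by (metis mem_Times_iff fst_conv snd_conv)
  obtain d1 where d1: "d1 > 0" "ball 0 d1 \<subseteq> S" using ST openE by blast
  obtain d2 where d2: "d2 > 0" "ball y0 d2 \<subseteq> T" using ST openE by blast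
  have "slab (min d1 d2) y0 \<subseteq> U"
  proof
    fix z assume "z \<in> slab (min d1 d2) y0"
    then have "fst z \<in> ball 0 d1" "snd z \<in> ball y0 d2" by (auto simp: slab_def dist_real_def)
    then show "z \<in> U" using d1 d2 ST(5) by (metis mem_Times_iff subsetD)
  qed
  then show ?thesis using that[of "min d1 d2"] d1 d2 by simp
qed

lemma slab_mono: "e \<le> e' \<Longrightarrow> slab e y0 \<subseteq> slab e' y0"
  by (auto simp: slab_def)

lemma at_within_half_space: "0 < fst z \<Longrightarrow> at z within half_space = at z"
proof -
  assume z: "0 < fst z"
  have "open {z :: real \<times> 'a. 0 < fst z}"
    by (intro open_Collect_less continuous_intros)
  then have "z \<in> interior half_space"
    by (rule interiorI) (use z in \<open>auto simp: half_space_def\<close>)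
  then show ?thesis by (rule at_within_interior)
qed

text \<open>If the first coordinate were positive, \<open>x\<close> would have an interior minimum at \<open>p\<close>, against \<open>dx \<noteq> 0\<close>.\<close>

lemma defining_function_boundary_coordinate:
  fixes A :: "('m::{t2_space, second_countable_topology}, real \<times> 'e::euclidean_space) chart set"
  assumes atlas: "smooth_atlas half_space A" and x: "defining_function A g x"
    and c: "c \<in> A" and p: "p \<in> dom_of c" "p \<in> boundary A"
  shows "fst (coord c p) = 0"
proof (rule ccontr)
  assume nz: "fst (coord c p) \<noteq> 0"
  let ?z = "coord c p" and ?f = "x \<circ> coord_inv c"
  have op: "openin (top_of_set half_space) (coord c ` dom_of c)"
    and hom: "homeomorphism (dom_of c) (coord c ` dom_of c) (coord c) (coord_inv c)"
    using atlas c unfolding smooth_atlas_def by auto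
  have dc: "dom_of c \<subseteq> carrier A" using c by (auto simp: carrier_def)
  have "?z \<in> half_space" using op p(1) openin_imp_subset by fastforce
  then have z: "0 < fst ?z" using nz by (simp add: half_space_def)
  obtain T where T: "open T" "coord c ` dom_of c = half_space \<inter> T"
    using op unfolding openin_open by blast
  have "smooth_on (coord c ` (dom_of c \<inter> carrier A)) ?f"
    using x c unfolding defining_function_def smooth_real_on_def by blast
  moreover have "dom_of c \<inter> carrier A = dom_of c" using dc by blast
  ultimately have sm: "smooth_on (coord c ` dom_of c) ?f" by simp
  obtain U F where U: "?z \<in> U" "Cinf_on U F" "\<And>w. w \<in> coord c ` dom_of c \<Longrightarrow> w \<in> U \<Longrightarrow> F w = ?f w"
    using smooth_on_Cinf_extension[OF sm imageI[OF p(1)]] by blast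
  let ?N = "T \<inter> U \<inter> {z. 0 < fst z}"
  have "open {z :: real \<times> 'e. 0 < fst z}"
    by (intro open_Collect_less continuous_intros)
  then have N: "open ?N" using T(1) Cinf_on_open[OF U(2)] by auto
  have zN: "?z \<in> ?N" using U(1) z p(1) T(2) by blast
  have NI: "w \<in> coord c ` dom_of c" if "w \<in> ?N" for w
    unfolding T(2) using that by (auto simp: half_space_def)
  have FN: "F w = ?f w" if "w \<in> ?N" for w using U(3)[OF NI[OF that]] that by blast
  have x0: "0 \<le> x q" if "q \<in> carrier A" for q
  proof (cases "q \<in> boundary A")
    case True
    then show ?thesis using x unfolding defining_function_def by simp
  next
    case False
    then show ?thesis using x that unfolding defining_function_def bulk_def by (simp add: less_imp_le)
  qed
  have fz: "?f ?z = 0"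
    using x p homeomorphism_apply1[OF hom p(1)] unfolding defining_function_def by simp
  have "\<forall>w\<in>?N. F ?z \<le> F w"
  proof
    fix w assume w: "w \<in> ?N"
    then obtain q where q: "q \<in> dom_of c" "w = coord c q" using NI by blast
    then have "?f w = x q" using homeomorphism_apply1[OF hom q(1)] by simp
    then show "F ?z \<le> F w" using FN[OF w] FN[OF zN] fz x0 q dc by auto
  qed
  then have "frechet_derivative F (at ?z) = (\<lambda>v. 0)"
    using differential_zero_maxmin[OF zN N Cinf_on_has_derivative[OF U(2,1)]] by blast
  moreover have "frechet_derivative F (at ?z) = frechet_derivative ?f (at ?z)"
    by (rule frechet_derivative_transform_within_open[OF
      differentiableI[OF Cinf_on_has_derivative[OF U(2,1)]] N zN FN])
  ultimately have "differential half_space c x p = (\<lambda>v. 0)"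
    unfolding differential_def at_within_half_space[OF z] by simp
  then show False using x c p unfolding defining_function_def by blast
qed

text \<open>\<open>boundary A\<close> only asks for some chart in which the first coordinate is
  zero. The assumption \<open>fst0\<close>, invariance of the boundary for the chart
  \<open>c\<close>, will be supplied by the defining function.\<close>

locale boundary_chart =
  fixes A :: "('m::{t2_space, second_countable_topology}, real \<times> 'e::euclidean_space) chart set"
    and c :: "('m, real \<times> 'e) chart"
  assumes atlas: "smooth_atlas half_space A" and c: "c \<in> A"
    and fst0: "p \<in> dom_of c \<Longrightarrow> p \<in> boundary A \<Longrightarrow> fst (coord c p) = 0"
begin

definition bc :: "('m, 'e) chart" where
  "bc = (dom_of c \<inter> boundary A, snd \<circ> coord c)"

definition img :: "'e set" where
  "img = {y. (0, y) \<in> coord c ` dom_of c}"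

definition param :: "'e \<Rightarrow> 'm" where
  "param y = coord_inv c (0, y)"

lemma bc: "bc \<in> boundary_atlas A"
  unfolding bc_def boundary_atlas_def using c by blast

lemma dom_bc: "dom_of bc = dom_of c \<inter> boundary A"
  by (simp add: bc_def)

lemma coord_bc: "coord bc p = snd (coord c p)"
  by (simp add: bc_def)

lemma hom: "homeomorphism (dom_of c) (coord c ` dom_of c) (coord c) (coord_inv c)"
  using atlas c unfolding smooth_atlas_def by blast

lemma dom_open: "openin (top_of_set (carrier A)) (dom_of c)"
  using atlas c unfolding smooth_atlas_def by blast

lemma img_open: "open img"
proof -
  have "openin (top_of_set half_space) (coord c ` dom_of c)"
    using atlas c unfolding smooth_atlas_def by blast
  then obtain T where T: "open T" "coord c ` dom_of c = half_space \<inter> T"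
    unfolding openin_open by blast
  have "img = (\<lambda>y. (0, y)) -` T" unfolding img_def T(2) by (auto simp: half_space_def)
  then show ?thesis using T(1) by (simp add: open_vimage continuous_on_Pair)
qed

lemma param:
  assumes "y \<in> img"
  shows "param y \<in> dom_of c" "param y \<in> boundary A" "coord c (param y) = (0, y)"
proof -
  have y: "(0, y) \<in> coord c ` dom_of c" using assms by (simp add: img_def)
  show "coord c (param y) = (0, y)" unfolding param_def using homeomorphism_apply2[OF hom y] .
  show d: "param y \<in> dom_of c" unfolding param_def using homeomorphism_image2[OF hom] y by blast
  show "param y \<in> boundary A" unfolding boundary_def using c d \<open>coord c (param y) = (0, y)\<close> by force
qed

lemma param_coord:
  assumes "p \<in> dom_of c" "p \<in> boundary A"
  shows "snd (coord c p) \<in> img" "param (snd (coord c p)) = p"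
proof -
  have "coord c p = (0, snd (coord c p))" using fst0[OF assms] by (simp add: prod_eq_iff)
  then show "snd (coord c p) \<in> img" "param (snd (coord c p)) = p"
    using assms homeomorphism_apply1[OF hom assms(1)] unfolding img_def param_def by (auto intro: rev_image_eqI)
qed

lemma coord_inv_bc: assumes "y \<in> img" shows "coord_inv bc y = param y"
proof -
  have inj: "inj_on (coord bc) (dom_of bc)"
    by (rule inj_on_inverseI[of _ param]) (use param_coord in \<open>simp add: dom_bc coord_bc\<close>)
  have "inv_into (dom_of bc) (coord bc) (coord bc (param y)) = param y"
    by (rule inv_into_f_f[OF inj]) (use param[OF assms] in \<open>simp add: dom_bc\<close>)
  then show ?thesis by (simp add: coord_inv_def coord_bc param[OF assms])
qed

lemma dom_cylinder: "dom_of (cylinder_chart bc) = {0..} \<times> (dom_of c \<inter> boundary A)"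
  by (simp add: cylinder_chart_def dom_bc)

lemma coord_cylinder: "coord (cylinder_chart bc) (s, p) = (s, snd (coord c p))"
  by (simp add: cylinder_chart_def coord_bc)

lemma coord_inv_cylinder:
  assumes "0 \<le> s" "y \<in> img"
  shows "coord_inv (cylinder_chart bc) (s, y) = (s, param y)"
proof -
  let ?cb = "cylinder_chart bc"
  have inj: "inj_on (coord ?cb) (dom_of ?cb)"
    by (rule inj_on_inverseI[of _ "\<lambda>(s, y). (s, param y)"])
      (use param_coord in \<open>auto simp: dom_cylinder coord_cylinder\<close>)
  have "inv_into (dom_of ?cb) (coord ?cb) (coord ?cb (s, param y)) = (s, param y)"
    by (rule inv_into_f_f[OF inj]) (use param[OF assms(2)] assms in \<open>simp add: dom_cylinder\<close>)
  then show ?thesis by (simp add: coord_inv_def coord_cylinder param[OF assms(2)])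
qed

lemma cylinder_chart_atlas: "cylinder_chart bc \<in> cylinder_atlas (boundary_atlas A)"
  unfolding cylinder_atlas_def using bc by blast

lemma param_continuous: "continuous_on img param"
proof -
  have "continuous_on (coord c ` dom_of c) (coord_inv c)" using hom by (simp add: homeomorphism_def)
  then have "continuous_on img (\<lambda>y. coord_inv c (0, y))"
    by (rule continuous_on_compose2) (auto simp: img_def intro: continuous_intros)
  then show ?thesis by (simp add: param_def[abs_def])
qed

text \<open>Only the half \<open>0 \<le> s\<close> of the slab has points of the collar domain over
  it; the full slab is used because derivatives and reflections need an open symmetric
  domain.\<close>

lemma collar_open_contains_slab:
  assumes V: "openin (top_of_set ({0..} \<times> boundary A)) V" and y0: "y0 \<in> img" "(0, param y0) \<in> V"
  obtains e where "0 < e" "\<And>s y. 0 \<le> s \<Longrightarrow> (s, y) \<in> slab e y0 \<Longrightarrow> y \<in> img \<and> (s, param y) \<in> V"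
proof -
  have cont: "continuous_on ({0..} \<times> img) (\<lambda>z. (fst z, param (snd z)))"
    by (intro continuous_on_Pair continuous_on_fst continuous_on_id
        continuous_on_compose2[OF param_continuous] continuous_on_snd) auto
  have "openin (top_of_set ({0..} \<times> img)) (({0..} \<times> img) \<inter> (\<lambda>z. (fst z, param (snd z))) -` V)"
    by (rule continuous_openin_preimage[OF cont _ V]) (use param in auto)
  then obtain T where T: "open T" "({0..} \<times> img) \<inter> (\<lambda>z. (fst z, param (snd z))) -` V = ({0..} \<times> img) \<inter> T"
    unfolding openin_open by blast
  have "(0, y0) \<in> T" using T(2) y0 by auto
  moreover have "open (T \<inter> (UNIV \<times> img))" using T(1) img_open by (intro open_Int open_Times) auto
  ultimately obtain e where e: "0 < e" "slab e y0 \<subseteq> T \<inter> (UNIV \<times> img)"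
    using open_contains_slab[of "T \<inter> (UNIV \<times> img)" y0] y0(1) by auto
  have "y \<in> img \<and> (s, param y) \<in> V" if "0 \<le> s" "(s, y) \<in> slab e y0" for s y
  proof -
    have "(s, y) \<in> T" "y \<in> img" using e(2) that(2) by auto
    then have "(s, y) \<in> ({0..} \<times> img) \<inter> (\<lambda>z. (fst z, param (snd z))) -` V"
      unfolding T(2) using that(1) by simp
    then show ?thesis using \<open>y \<in> img\<close> by simp
  qed
  then show ?thesis using that e(1) by blast
qed

text \<open>The collar in coordinates, extended smoothly across \<open>s = 0\<close>. The set
  \<open>V\<close> prescribes where the image must stay, so that the inverse of another collar can
  be applied to it. The last clause states the values in the form in which
  \<open>chart_deriv\<close> refers to them.\<close>

lemma collar_extension:
  assumes col: "collar A W \<Phi>" and y0: "y0 \<in> img"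
    and V: "openin (top_of_set (carrier A)) V" "param y0 \<in> V" "V \<subseteq> dom_of c"
  obtains e F where "0 < e" "Cinf_on (slab e y0) F"
    "\<And>s y. 0 \<le> s \<Longrightarrow> (s, y) \<in> slab e y0 \<Longrightarrow>
      y \<in> img \<and> (s, param y) \<in> W \<and> \<Phi> (s, param y) \<in> V \<and> F (s, y) = coord c (\<Phi> (s, param y)) \<and>
      (coord c \<circ> \<Phi> \<circ> coord_inv (cylinder_chart bc)) (s, y) = F (s, y)"
proof -
  let ?cb = "cylinder_chart bc"
  have W: "openin (top_of_set ({0..} \<times> boundary A)) W" "{0} \<times> boundary A \<subseteq> W"
    and sm: "smooth_map (cylinder_atlas (boundary_atlas A)) W A \<Phi>"
    and id: "\<And>p. p \<in> boundary A \<Longrightarrow> \<Phi> (0, p) = p"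
    using col unfolding collar_def diffeo_def by auto
  have cont: "continuous_on W \<Phi>" and im: "\<Phi> ` W \<subseteq> carrier A"
    and smc: "smooth_on (coord ?cb ` (dom_of ?cb \<inter> W \<inter> \<Phi> -` dom_of c)) (coord c \<circ> \<Phi> \<circ> coord_inv ?cb)"
    using sm c cylinder_chart_atlas unfolding smooth_map_def by auto
  note p0 = param[OF y0]
  have "openin (top_of_set W) (W \<inter> \<Phi> -` V)"
    by (rule continuous_openin_preimage[OF cont _ V(1)]) (use im in auto)
  then have WV: "openin (top_of_set ({0..} \<times> boundary A)) (W \<inter> \<Phi> -` V)"
    using openin_trans W(1) by blast
  have "(0, param y0) \<in> W \<inter> \<Phi> -` V" using W(2) p0 id V(2) by auto
  then obtain e1 where e1: "0 < e1"
    "\<And>s y. 0 \<le> s \<Longrightarrow> (s, y) \<in> slab e1 y0 \<Longrightarrow> y \<in> img \<and> (s, param y) \<in> W \<inter> \<Phi> -` V"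
    using collar_open_contains_slab[OF WV y0] by blast
  have inS: "(s, y) \<in> coord ?cb ` (dom_of ?cb \<inter> W \<inter> \<Phi> -` dom_of c)"
    if "0 \<le> s" "(s, y) \<in> slab e1 y0" for s y
  proof -
    have y: "y \<in> img" "(s, param y) \<in> W" "\<Phi> (s, param y) \<in> V" using e1(2)[OF that] by auto
    have "(s, y) = coord ?cb (s, param y)" by (simp add: coord_cylinder param[OF y(1)])
    moreover have "(s, param y) \<in> dom_of ?cb \<inter> W \<inter> \<Phi> -` dom_of c"
      using y V(3) that(1) param[OF y(1)] by (auto simp: dom_cylinder)
    ultimately show ?thesis by blast
  qed
  have "(0, y0) \<in> slab e1 y0" using e1(1) by (simp add: slab_def)
  from inS[OF order_refl this] obtain U F where U: "(0, y0) \<in> U" "Cinf_on U F"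
    "\<And>w. w \<in> coord ?cb ` (dom_of ?cb \<inter> W \<inter> \<Phi> -` dom_of c) \<Longrightarrow> w \<in> U \<Longrightarrow>
      F w = (coord c \<circ> \<Phi> \<circ> coord_inv ?cb) w"
    using smooth_on_Cinf_extension[OF smc] by blast
  obtain e2 where e2: "0 < e2" "slab e2 y0 \<subseteq> U"
    using open_contains_slab[OF Cinf_on_open[OF U(2)] U(1)] by blast
  define e where "e = min e1 e2"
  have sub: "slab e y0 \<subseteq> slab e1 y0" "slab e y0 \<subseteq> U"
    using e2(2) slab_mono[of e e1 y0] slab_mono[of e e2 y0] by (auto simp: e_def)
  show ?thesis
  proof (rule that)
    show "0 < e" using e1 e2 by (simp add: e_def)
    show "Cinf_on (slab e y0) F" by (rule Cinf_on_subset[OF U(2) open_slab sub(2)])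
    fix s y assume s: "0 \<le> s" and sy: "(s, y) \<in> slab e y0"
    have y: "y \<in> img \<and> (s, param y) \<in> W \<inter> \<Phi> -` V" using e1(2)[OF s] sub(1) sy by blast
    have "F (s, y) = (coord c \<circ> \<Phi> \<circ> coord_inv ?cb) (s, y)"
      using U(3) inS[OF s] sub sy by blast
    then show "y \<in> img \<and> (s, param y) \<in> W \<and> \<Phi> (s, param y) \<in> V \<and> F (s, y) = coord c (\<Phi> (s, param y)) \<and>
      (coord c \<circ> \<Phi> \<circ> coord_inv (cylinder_chart bc)) (s, y) = F (s, y)"
      using y s by (simp add: coord_inv_cylinder)
  qed
qed

text \<open>Smoothness of the inverse collar is given in charts, so \<open>V\<close> consists of
  those points of the chart \<open>c\<close> that are hit by the collar and whose boundary component
  again lies in \<open>c\<close>. Near \<open>param y0\<close> this is no restriction, because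
  collars fix the boundary.\<close>

lemma collar_inverse_extension:
  assumes col: "collar A W \<Phi>" and y0: "y0 \<in> img"
  obtains V U F where "openin (top_of_set (carrier A)) V" "param y0 \<in> V" "V \<subseteq> dom_of c"
    "(0, y0) \<in> U" "Cinf_on U F"
    "\<And>q. q \<in> V \<Longrightarrow> coord c q \<in> U \<Longrightarrow> \<exists>s p. (s, p) \<in> W \<and> 0 \<le> s \<and> p \<in> dom_of c \<and> p \<in> boundary A \<and>
      \<Phi> (s, p) = q \<and> F (coord c q) = (s, snd (coord c p))"
proof -
  let ?cb = "cylinder_chart bc" and ?i = "inv_into W \<Phi>"
  have W: "openin (top_of_set ({0..} \<times> boundary A)) W" "{0} \<times> boundary A \<subseteq> W"
    and oim: "openin (top_of_set (carrier A)) (\<Phi> ` W)"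
    and bij: "bij_betw \<Phi> W (\<Phi> ` W)"
    and sm: "smooth_map A (\<Phi> ` W) (cylinder_atlas (boundary_atlas A)) ?i"
    and id: "\<And>p. p \<in> boundary A \<Longrightarrow> \<Phi> (0, p) = p"
    using col unfolding collar_def diffeo_def by auto
  have cont: "continuous_on (\<Phi> ` W) ?i"
    and smc: "smooth_on (coord c ` (dom_of c \<inter> \<Phi> ` W \<inter> ?i -` dom_of ?cb)) (coord ?cb \<circ> ?i \<circ> coord_inv c)"
    using sm c cylinder_chart_atlas unfolding smooth_map_def by auto
  note p0 = param[OF y0]
  have WS: "W \<subseteq> {0..} \<times> boundary A" using W(1) openin_imp_subset by blast
  have inj: "inj_on \<Phi> W" using bij by (simp add: bij_betw_def)
  have bsub: "boundary A \<subseteq> carrier A" by (auto simp: boundary_def carrier_def)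
  obtain T where T: "open T" "dom_of c = carrier A \<inter> T" using dom_open unfolding openin_open by blast
  \<comment> \<open>Within \<open>W\<close> the domain of the cylinder chart is cut out by an open
    set \<open>T\<close> of the ambient space; this gives openness of \<open>V\<close> by continuity
    of the inverse.\<close>
  have cb: "W \<inter> dom_of ?cb = W \<inter> (UNIV \<times> T)"
    using WS bsub by (auto simp: dom_cylinder T(2))
  have "openin (top_of_set W) (W \<inter> (UNIV \<times> T))" using T(1) by (intro openin_open_Int open_Times) auto
  from continuous_openin_preimage[OF cont _ this]
  have "openin (top_of_set (\<Phi> ` W)) (\<Phi> ` W \<inter> ?i -` (W \<inter> (UNIV \<times> T)))"
    by (auto intro: inv_into_into)
  then have 1: "openin (top_of_set (carrier A)) (\<Phi> ` W \<inter> ?i -` (W \<inter> (UNIV \<times> T)))"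
    using openin_trans oim by blast
  define V where "V = dom_of c \<inter> \<Phi> ` W \<inter> ?i -` dom_of ?cb"
  have "V = dom_of c \<inter> (\<Phi> ` W \<inter> ?i -` (W \<inter> (UNIV \<times> T)))"
    unfolding V_def cb[symmetric] by (auto intro: inv_into_into)
  then have V: "openin (top_of_set (carrier A)) V" using openin_Int[OF dom_open 1] by simp
  have i0: "?i (param y0) = (0, param y0)"
    using inv_into_f_f[OF inj, of "(0, param y0)"] W(2) p0 id by auto
  have "param y0 \<in> \<Phi> ` W" using W(2) p0 id[OF p0(2)] by (auto intro!: rev_image_eqI[of "(0, param y0)"])
  then have pV: "param y0 \<in> V" using p0 i0 by (simp add: V_def dom_cylinder)
  have "(0, y0) \<in> coord c ` V" using pV p0(3) by (metis imageI)
  then obtain U F where U: "(0, y0) \<in> U" "Cinf_on U F"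
    "\<And>w. w \<in> coord c ` V \<Longrightarrow> w \<in> U \<Longrightarrow> F w = (coord ?cb \<circ> ?i \<circ> coord_inv c) w"
    using smooth_on_Cinf_extension[OF smc[folded V_def]] by blast
  show ?thesis
  proof (rule that[OF V pV _ U(1,2)])
    show "V \<subseteq> dom_of c" by (auto simp: V_def)
    fix q assume q: "q \<in> V" "coord c q \<in> U"
    obtain s p where sp: "?i q = (s, p)" by force
    have qd: "q \<in> dom_of c" "q \<in> \<Phi> ` W" "(s, p) \<in> dom_of ?cb" using q(1) sp by (auto simp: V_def)
    have "\<Phi> (s, p) = q" "(s, p) \<in> W"
      using f_inv_into_f[OF qd(2)] inv_into_into[OF qd(2)] by (simp_all add: sp)
    moreover have "F (coord c q) = (s, snd (coord c p))"
      using U(3)[OF imageI[OF q(1)] q(2)] homeomorphism_apply1[OF hom qd(1)]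
      by (simp add: sp coord_cylinder)
    ultimately show "\<exists>s p. (s, p) \<in> W \<and> 0 \<le> s \<and> p \<in> dom_of c \<and> p \<in> boundary A \<and>
      \<Phi> (s, p) = q \<and> F (coord c q) = (s, snd (coord c p))"
      using qd(3) by (auto simp: dom_cylinder)
  qed
qed

lemma metric_family_extension:
  assumes col: "collar A W \<Phi>" and fam: "metric_family A W h" and y0: "y0 \<in> img"
  obtains e G where "0 < e" "\<And>i j. i \<in> Basis \<Longrightarrow> j \<in> Basis \<Longrightarrow> Cinf_on (slab e y0) (G i j)"
    "\<And>s y i j. 0 \<le> s \<Longrightarrow> (s, y) \<in> slab e y0 \<Longrightarrow> i \<in> Basis \<Longrightarrow> j \<in> Basis \<Longrightarrow> G i j (s, y) = h s bc (param y) i j"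
    "\<And>s y. 0 \<le> s \<Longrightarrow> (s, y) \<in> slab e y0 \<Longrightarrow> y \<in> img \<and> (s, param y) \<in> W"
proof -
  let ?cb = "cylinder_chart bc"
  have W: "openin (top_of_set ({0..} \<times> boundary A)) W" "{0} \<times> boundary A \<subseteq> W"
    using col unfolding collar_def by auto
  have sm: "smooth_on (coord ?cb ` (dom_of ?cb \<inter> W)) (\<lambda>z. h (fst z) bc (coord_inv bc (snd z)) u v)" for u v
    using fam bc unfolding metric_family_def by blast
  note p0 = param[OF y0]
  have "(0, param y0) \<in> W" using W(2) p0 by auto
  from collar_open_contains_slab[OF W(1) y0 this] obtain e1 where e1: "0 < e1"
    "\<And>s y. 0 \<le> s \<Longrightarrow> (s, y) \<in> slab e1 y0 \<Longrightarrow> y \<in> img \<and> (s, param y) \<in> W" by blast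
  have inS: "(s, y) \<in> coord ?cb ` (dom_of ?cb \<inter> W)" if "0 \<le> s" "(s, y) \<in> slab e1 y0" for s y
  proof -
    have y: "y \<in> img" "(s, param y) \<in> W" using e1(2)[OF that] by auto
    have "(s, y) = coord ?cb (s, param y)" by (simp add: coord_cylinder param[OF y(1)])
    moreover have "(s, param y) \<in> dom_of ?cb \<inter> W"
      using y that(1) param[OF y(1)] by (auto simp: dom_cylinder)
    ultimately show ?thesis by blast
  qed
  have "(0, y0) \<in> slab e1 y0" using e1(1) by (simp add: slab_def)
  from inS[OF order_refl this] have z0: "(0, y0) \<in> coord ?cb ` (dom_of ?cb \<inter> W)" .
  \<comment> \<open>Each component has its own extension on its own neighbourhood. Packing both into
    a pair allows a choice for all index pairs; only the finitely many basis pairs are intersected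
    afterwards.\<close>
  have "\<forall>ij. \<exists>UF. (0, y0) \<in> fst UF \<and> Cinf_on (fst UF) (snd UF) \<and>
      (\<forall>w\<in>coord ?cb ` (dom_of ?cb \<inter> W) \<inter> fst UF. snd UF w = h (fst w) bc (coord_inv bc (snd w)) (fst ij) (snd ij))"
  proof
    fix ij :: "'e \<times> 'e"
    obtain U F where "(0, y0) \<in> U" "Cinf_on U F"
      "\<And>w. w \<in> coord ?cb ` (dom_of ?cb \<inter> W) \<Longrightarrow> w \<in> U \<Longrightarrow> F w = h (fst w) bc (coord_inv bc (snd w)) (fst ij) (snd ij)"
      using smooth_on_Cinf_extension[OF sm z0] by blast
    then show "\<exists>UF. (0, y0) \<in> fst UF \<and> Cinf_on (fst UF) (snd UF) \<and>
      (\<forall>w\<in>coord ?cb ` (dom_of ?cb \<inter> W) \<inter> fst UF. snd UF w = h (fst w) bc (coord_inv bc (snd w)) (fst ij) (snd ij))"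
      by (intro exI[of _ "(U, F)"]) auto
  qed
  from choice[OF this] obtain UF where UF: "\<And>ij. (0, y0) \<in> fst (UF ij)" "\<And>ij. Cinf_on (fst (UF ij)) (snd (UF ij))"
    "\<And>ij w. w \<in> coord ?cb ` (dom_of ?cb \<inter> W) \<Longrightarrow> w \<in> fst (UF ij) \<Longrightarrow>
      snd (UF ij) w = h (fst w) bc (coord_inv bc (snd w)) (fst ij) (snd ij)" by blast
  have "open (\<Inter>ij\<in>Basis \<times> Basis. fst (UF ij))"
    using Cinf_on_open[OF UF(2)] by (intro open_INT) auto
  then obtain e2 where e2: "0 < e2" "slab e2 y0 \<subseteq> (\<Inter>ij\<in>Basis \<times> Basis. fst (UF ij))"
    using open_contains_slab UF(1) by (metis (no_types, lifting) INT_I)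
  define e where "e = min e1 e2"
  have sub: "slab e y0 \<subseteq> slab e1 y0" "slab e y0 \<subseteq> slab e2 y0"
    using slab_mono[of e e1 y0] slab_mono[of e e2 y0] by (auto simp: e_def)
  have subU: "slab e y0 \<subseteq> fst (UF (i, j))" if "i \<in> Basis" "j \<in> Basis" for i j
    using sub(2) e2(2) that by blast
  show ?thesis
  proof (rule that[of e "\<lambda>i j. snd (UF (i, j))"])
    show "0 < e" using e1 e2 by (simp add: e_def)
    show "Cinf_on (slab e y0) (snd (UF (i, j)))" if "i \<in> Basis" "j \<in> Basis" for i j
      by (rule Cinf_on_subset[OF UF(2) open_slab subU[OF that]])
    show W1: "y \<in> img \<and> (s, param y) \<in> W" if "0 \<le> s" "(s, y) \<in> slab e y0" for s y
      using e1(2) that sub(1) by blast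
    show "snd (UF (i, j)) (s, y) = h s bc (param y) i j"
      if "0 \<le> s" "(s, y) \<in> slab e y0" "i \<in> Basis" "j \<in> Basis" for s y i j
    proof -
      have "y \<in> img" using W1[OF that(1,2)] by blast
      moreover have "(s, y) \<in> coord ?cb ` (dom_of ?cb \<inter> W)" using inS[OF that(1)] that(2) sub(1) by blast
      ultimately show ?thesis
        using UF(3)[of "(s, y)" "(i, j)"] subU[OF that(3,4)] that(2) by (auto simp: coord_inv_bc)
    qed
  qed
qed

end

section \<open>The transformed expansion\<close>

lemma bilinear_expand_Basis:
  fixes \<beta> :: "'e::euclidean_space \<Rightarrow> 'e \<Rightarrow> real"
  assumes "bilinear \<beta>"
  shows "\<beta> u v = (\<Sum>i\<in>Basis. \<Sum>j\<in>Basis. \<beta> i j * (u \<bullet> i) * (v \<bullet> j))"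
proof -
  have l: "linear (\<lambda>u. \<beta> u v)" "linear (\<beta> u)" for u v using assms by (auto simp: bilinear_def)
  have "\<beta> u v = \<beta> (\<Sum>i\<in>Basis. (u \<bullet> i) *\<^sub>R i) v" by (simp only: euclidean_representation)
  then have 1: "\<beta> u v = (\<Sum>i\<in>Basis. (u \<bullet> i) * \<beta> i v)"
    by (simp add: linear_sum[OF l(1)] linear_cmul[OF l(1)])
  have 2: "\<beta> i v = (\<Sum>j\<in>Basis. (v \<bullet> j) * \<beta> i j)" for i
  proof -
    have "\<beta> i v = \<beta> i (\<Sum>j\<in>Basis. (v \<bullet> j) *\<^sub>R j)" by (simp only: euclidean_representation)
    then show ?thesis by (simp add: linear_sum[OF l(2)] linear_cmul[OF l(2)])
  qed
  show ?thesis unfolding 1 by (subst 2) (simp add: sum_distrib_left mult_ac)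
qed

text \<open>Identifies coefficients of the abstract \<open>has_expansion\<close> with Taylor
  coefficients of a smooth extension, although the former are only known through a bound for
  \<open>s > 0\<close>.\<close>

lemma expansion_unique:
  fixes a b :: "nat \<Rightarrow> real"
  assumes "(\<lambda>s. f s - (\<Sum>k\<le>n. s ^ k * a k)) \<in> O[at_right 0](\<lambda>s. s ^ (n + 1))"
    and "(\<lambda>s. f s - (\<Sum>k\<le>n. s ^ k * b k)) \<in> O[at_right 0](\<lambda>s. s ^ (n + 1))"
    and k: "k \<le> n"
  shows "a k = b k"
proof -
  have "(\<lambda>s. (f s - (\<Sum>k\<le>n. s ^ k * b k)) - (f s - (\<Sum>k\<le>n. s ^ k * a k))) \<in> O[at_right 0](\<lambda>s. s ^ (n + 1))"
    using assms(2,1) by (rule sum_in_bigo)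
  moreover have "(f s - (\<Sum>k\<le>n. s ^ k * b k)) - (f s - (\<Sum>k\<le>n. s ^ k * a k)) =
      (\<Sum>k<Suc n. (a k - b k) * s ^ k)" for s
    by (simp only: lessThan_Suc_atMost) (simp add: sum_subtractf[symmetric] algebra_simps)
  ultimately have "(\<lambda>s. \<Sum>k<Suc n. (a k - b k) * s ^ k) \<in> O[at_right 0](\<lambda>s. s ^ Suc n)"
    by (simp only: Suc_eq_plus1)
  from polynomial_bigo_imp_zero[OF this, of k] show ?thesis using k by simp
qed

lemma expansion_taylor:
  assumes F: "Cinf_on (slab r y0) F" and r: "0 < r" and y: "y \<in> ball y0 r"
  shows "(\<lambda>s. F (s, y) - (\<Sum>k\<le>n. s ^ k * ((ds ^^ k) F (0, y) / fact k))) \<in> O[at_right 0](\<lambda>s. s ^ (n + 1))"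
proof -
  have "(0, y) \<in> slab r y0" using y r by (simp add: slab_zero)
  from bigo_at_imp_at_right[OF taylor_slice[OF F this, of "Suc n"]] show ?thesis
    by (simp only: lessThan_Suc_atMost mult.commute[of _ "_ ^ _"] Suc_eq_plus1[symmetric])
qed

lemma expansion_bilinear:
  fixes G :: "'e::euclidean_space \<Rightarrow> 'e \<Rightarrow> real \<times> 'e \<Rightarrow> real"
  assumes G: "\<And>i j. i \<in> Basis \<Longrightarrow> j \<in> Basis \<Longrightarrow> Cinf_on (slab r y0) (G i j)"
    and r: "0 < r" and y: "y \<in> ball y0 r"
    and f: "\<And>s. 0 \<le> s \<Longrightarrow> s < r \<Longrightarrow> f s = (\<Sum>i\<in>Basis. \<Sum>j\<in>Basis. G i j (s, y) * (u \<bullet> i) * (v \<bullet> j))"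
  shows "(\<lambda>s. f s - (\<Sum>k\<le>n. s ^ k *
      (\<Sum>i\<in>Basis. \<Sum>j\<in>Basis. (ds ^^ k) (G i j) (0, y) / fact k * (u \<bullet> i) * (v \<bullet> j)))) \<in> O[at_right 0](\<lambda>s. s ^ (n + 1))"
proof -
  have "(\<lambda>s. \<Sum>i\<in>Basis. \<Sum>j\<in>Basis. ((u \<bullet> i) * (v \<bullet> j)) *
      (G i j (s, y) - (\<Sum>k\<le>n. s ^ k * ((ds ^^ k) (G i j) (0, y) / fact k)))) \<in> O[at_right 0](\<lambda>s. s ^ (n + 1))"
  proof (intro big_sum_in_bigo)
    fix i j :: 'e assume ij: "i \<in> Basis" "j \<in> Basis"
    have "(\<lambda>s::real. (u \<bullet> i) * (v \<bullet> j)) \<in> O[at_right 0](\<lambda>s. 1)"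
      by (rule bigoI[where c = "\<bar>(u \<bullet> i) * (v \<bullet> j)\<bar>"]) simp
    from landau_o.big.mult[OF this expansion_taylor[OF G[OF ij] r y, of n]]
    show "(\<lambda>s. ((u \<bullet> i) * (v \<bullet> j)) * (G i j (s, y) - (\<Sum>k\<le>n. s ^ k * ((ds ^^ k) (G i j) (0, y) / fact k))))
        \<in> O[at_right 0](\<lambda>s. s ^ (n + 1))" by (simp only: mult_1)
  qed
  moreover have "\<forall>\<^sub>F s in at_right 0. (\<Sum>i\<in>Basis. \<Sum>j\<in>Basis. ((u \<bullet> i) * (v \<bullet> j)) *
      (G i j (s, y) - (\<Sum>k\<le>n. s ^ k * ((ds ^^ k) (G i j) (0, y) / fact k)))) =
      f s - (\<Sum>k\<le>n. s ^ k * (\<Sum>i\<in>Basis. \<Sum>j\<in>Basis. (ds ^^ k) (G i j) (0, y) / fact k * (u \<bullet> i) * (v \<bullet> j)))"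
    unfolding eventually_at_right_field
  proof (intro exI[of _ r] conjI allI impI r)
    fix s :: real assume s: "0 < s" "s < r"
    have "(\<Sum>k\<le>n. s ^ k * (\<Sum>i\<in>Basis. \<Sum>j\<in>Basis. (ds ^^ k) (G i j) (0, y) / fact k * (u \<bullet> i) * (v \<bullet> j))) =
      (\<Sum>k\<le>n. \<Sum>i\<in>Basis. \<Sum>j\<in>Basis. ((u \<bullet> i) * (v \<bullet> j)) * (s ^ k * ((ds ^^ k) (G i j) (0, y) / fact k)))"
      by (simp add: sum_distrib_left mult_ac)
    also have "\<dots> = (\<Sum>i\<in>Basis. \<Sum>k\<le>n. \<Sum>j\<in>Basis. ((u \<bullet> i) * (v \<bullet> j)) * (s ^ k * ((ds ^^ k) (G i j) (0, y) / fact k)))"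
      by (rule sum.swap)
    also have "\<dots> = (\<Sum>i\<in>Basis. \<Sum>j\<in>Basis. \<Sum>k\<le>n. ((u \<bullet> i) * (v \<bullet> j)) * (s ^ k * ((ds ^^ k) (G i j) (0, y) / fact k)))"
      by (intro sum.cong refl sum.swap)
    finally show "(\<Sum>i\<in>Basis. \<Sum>j\<in>Basis. ((u \<bullet> i) * (v \<bullet> j)) *
      (G i j (s, y) - (\<Sum>k\<le>n. s ^ k * ((ds ^^ k) (G i j) (0, y) / fact k)))) =
      f s - (\<Sum>k\<le>n. s ^ k * (\<Sum>i\<in>Basis. \<Sum>j\<in>Basis. (ds ^^ k) (G i j) (0, y) / fact k * (u \<bullet> i) * (v \<bullet> j)))"
      using f[of s] s by (simp add: right_diff_distrib sum_subtractf sum_distrib_left mult_ac)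
  qed
  ultimately show ?thesis
    by (rule landau_o.big.in_cong[THEN iffD1, rotated])
qed

text \<open>\<open>sharp\<close> is a definite description, so existence and uniqueness of the
  representing vector come first: the former from \<open>posdef_dual_vector\<close>, the latter from
  positivity. Scaling the form by \<open>l\<close> and the covector by \<open>m\<close> then just
  rescales that vector.\<close>

lemma sharp_scale:
  fixes \<beta> :: "'e::euclidean_space \<Rightarrow> 'e \<Rightarrow> real"
  assumes \<beta>: "bilinear \<beta>" "\<And>u v. \<beta> u v = \<beta> v u" "\<And>u. u \<noteq> 0 \<Longrightarrow> 0 < \<beta> u u"
    and \<alpha>: "linear \<alpha>" and l: "l \<noteq> 0"
  shows "sharp (\<lambda>u v. l * \<beta> u v) (\<lambda>v. m * \<alpha> v) = (m / l) *\<^sub>R sharp \<beta> \<alpha>"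
proof -
  have lin: "linear (\<lambda>u. \<beta> u v)" "linear (\<beta> u)" for u v using \<beta>(1) by (auto simp: bilinear_def)
  have "\<exists>w. \<forall>i\<in>Basis. (\<Sum>j\<in>Basis. \<beta> i j * (w \<bullet> j)) = (\<Sum>b\<in>Basis. \<alpha> b *\<^sub>R b) \<bullet> i"
    by (rule posdef_dual_vector) (use \<beta>(3) bilinear_expand_Basis[OF \<beta>(1)] in metis)
  then obtain w where w: "\<And>i. i \<in> Basis \<Longrightarrow> (\<Sum>j\<in>Basis. \<beta> i j * (w \<bullet> j)) = \<alpha> i" by auto
  have wv: "\<beta> w v = \<alpha> v" for v
  proof -
    have "\<beta> w v = (\<Sum>i\<in>Basis. \<Sum>j\<in>Basis. \<beta> i j * (v \<bullet> i) * (w \<bullet> j))"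
      by (subst \<beta>(2)) (rule bilinear_expand_Basis[OF \<beta>(1)])
    also have "\<dots> = (\<Sum>i\<in>Basis. (v \<bullet> i) * (\<Sum>j\<in>Basis. \<beta> i j * (w \<bullet> j)))"
      by (simp add: sum_distrib_left mult_ac)
    also have "\<dots> = (\<Sum>i\<in>Basis. (v \<bullet> i) * \<alpha> i)" using w by simp
    also have "\<dots> = \<alpha> (\<Sum>i\<in>Basis. (v \<bullet> i) *\<^sub>R i)"
      by (simp only: linear_sum[OF \<alpha>] linear_cmul[OF \<alpha>] real_scaleR_def)
    finally show ?thesis by (simp only: euclidean_representation)
  qed
  have uniq: "w1 = w2" if "\<And>v. \<beta> w1 v = \<beta> w2 v" for w1 w2
  proof (rule ccontr)
    assume "w1 \<noteq> w2"
    then have "0 < \<beta> (w1 - w2) (w1 - w2)" by (intro \<beta>(3)) simp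
    moreover have "\<beta> (w1 - w2) z = \<beta> w1 z - \<beta> w2 z" for z by (rule linear_diff[OF lin(1)])
    ultimately show False using that by simp
  qed
  have s: "sharp \<beta> \<alpha> = w" unfolding sharp_def
    by (rule the_equality) (use wv uniq[of _ w] in auto)
  show ?thesis unfolding s unfolding sharp_def
  proof (rule the_equality)
    show "\<forall>v. l * \<beta> ((m / l) *\<^sub>R w) v = m * \<alpha> v"
      using l wv by (simp add: linear_cmul[OF lin(1)])
    show "w' = (m / l) *\<^sub>R w" if "\<forall>v. l * \<beta> w' v = m * \<alpha> v" for w'
    proof (rule uniq)
      fix v
      have "l * \<beta> w' v = m * \<alpha> v" using that by blast
      then show "\<beta> w' v = \<beta> ((m / l) *\<^sub>R w) v"
        using l wv[of v] by (simp add: linear_cmul[OF lin(1)] field_simps)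
    qed
  qed
qed

lemma open_Cinf_preimage: "Cinf_on S F \<Longrightarrow> open T \<Longrightarrow> open (S \<inter> F -` T)"
  by (rule continuous_open_preimage)
    (auto simp: Cinf_on_open intro!: continuous_at_imp_continuous_on Cinf_on_isCont)

context boundary_chart
begin

text \<open>For \<open>s > 0\<close> the derivative within the half-space is the ordinary one, and
  \<open>F\<close> agrees with the coordinate expression on the open set where
  \<open>s > 0\<close>.\<close>

lemma chart_deriv_collar:
  assumes F: "Cinf_on (slab e y0) F" and z: "(s, y) \<in> slab e y0" "0 < s"
    and eq: "\<And>s y. 0 \<le> s \<Longrightarrow> (s, y) \<in> slab e y0 \<Longrightarrow>
      (coord c \<circ> \<Phi> \<circ> coord_inv (cylinder_chart bc)) (s, y) = F (s, y)"
    and p: "snd (coord c p) = y"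
  shows "chart_deriv half_space (cylinder_chart bc) c \<Phi> (s, p) = frechet_derivative F (at (s, y))"
proof -
  have "open {z :: real \<times> 'e. 0 < fst z}"
    by (intro open_Collect_less continuous_intros)
  then have op: "open (slab e y0 \<inter> {z. 0 < fst z})" using open_slab by blast
  have "frechet_derivative F (at (s, y)) =
      frechet_derivative (coord c \<circ> \<Phi> \<circ> coord_inv (cylinder_chart bc)) (at (s, y))"
  proof (rule frechet_derivative_transform_within_open[OF differentiableI[OF Cinf_on_has_derivative[OF F z(1)]] op])
    show "(s, y) \<in> slab e y0 \<inter> {z. 0 < fst z}" using z by simp
    show "F w = (coord c \<circ> \<Phi> \<circ> coord_inv (cylinder_chart bc)) w" if "w \<in> slab e y0 \<inter> {z. 0 < fst z}" for w
      using eq[of "fst w" "snd w"] that by (simp add: less_imp_le)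
  qed
  moreover have "at (s, y) within half_space = at (s, y)" by (rule at_within_half_space) (use z in simp)
  ultimately show ?thesis by (simp only: chart_deriv_def coord_cylinder p)
qed

text \<open>In coordinates the transition is the inverse of \<open>\<Phi>\<close> after
  \<open>\<Phi>h\<close>. Both collars pull back the same \<open>g\<close>, which makes it an
  isometry; a single chart \<open>c\<close> serves for source and target because near
  \<open>y0\<close> nothing leaves it.\<close>

lemma collar_change_exists:
  assumes dx: "defining_function A g x" and dxh: "defining_function A g xh"
    and nf: "normal_form A g x W \<Phi> h" and nfh: "normal_form A g xh Wh \<Phi>h hh"
    and n: "odd n" "2 \<le> n" and pe: "partially_even n (boundary_atlas A) h"
    and conf: "\<And>p u v. p \<in> dom_of bc \<Longrightarrow> hh 0 bc p u v = exp (2 * \<omega>0 p) * h 0 bc p u v"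
    and y0: "y0 \<in> img"
  obtains r r' X Y G K where
    "collar_change r r' y0 X Y G K n (\<lambda>y. \<omega>0 (param y))"
    "\<And>s y i j. 0 \<le> s \<Longrightarrow> (s, y) \<in> slab r' y0 \<Longrightarrow> i \<in> Basis \<Longrightarrow> j \<in> Basis \<Longrightarrow> G i j (s, y) = h s bc (param y) i j"
    "\<And>s y i j. 0 \<le> s \<Longrightarrow> (s, y) \<in> slab r y0 \<Longrightarrow> i \<in> Basis \<Longrightarrow> j \<in> Basis \<Longrightarrow> K i j (s, y) = hh s bc (param y) i j"
    "\<And>s y. 0 \<le> s \<Longrightarrow> (s, y) \<in> slab r' y0 \<Longrightarrow> y \<in> img \<and> (s, param y) \<in> W"
    "\<And>s y. 0 \<le> s \<Longrightarrow> (s, y) \<in> slab r y0 \<Longrightarrow> y \<in> img \<and> (s, param y) \<in> Wh"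
proof -
  let ?cb = "cylinder_chart bc"
  have col: "collar A W \<Phi>" and fam: "metric_family A W h" and x\<Phi>: "\<And>s p. (s, p) \<in> W \<Longrightarrow> x (\<Phi> (s, p)) = s"
    and iso: "\<And>s p \<sigma> u \<tau> v. (s, p) \<in> W \<Longrightarrow> 0 < s \<Longrightarrow> p \<in> dom_of bc \<Longrightarrow> \<Phi> (s, p) \<in> dom_of c \<Longrightarrow>
      g c (\<Phi> (s, p)) (chart_deriv half_space ?cb c \<Phi> (s, p) (\<sigma>, u)) (chart_deriv half_space ?cb c \<Phi> (s, p) (\<tau>, v)) =
      1 / s\<^sup>2 * (\<sigma> * \<tau> + h s bc p u v)"
    using nf c bc unfolding normal_form_def Let_def by auto
  have colh: "collar A Wh \<Phi>h" and famh: "metric_family A Wh hh" and xh\<Phi>: "\<And>s p. (s, p) \<in> Wh \<Longrightarrow> xh (\<Phi>h (s, p)) = s"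
    and isoh: "\<And>s p \<sigma> u \<tau> v. (s, p) \<in> Wh \<Longrightarrow> 0 < s \<Longrightarrow> p \<in> dom_of bc \<Longrightarrow> \<Phi>h (s, p) \<in> dom_of c \<Longrightarrow>
      g c (\<Phi>h (s, p)) (chart_deriv half_space ?cb c \<Phi>h (s, p) (\<sigma>, u)) (chart_deriv half_space ?cb c \<Phi>h (s, p) (\<tau>, v)) =
      1 / s\<^sup>2 * (\<sigma> * \<tau> + hh s bc p u v)"
    using nfh c bc unfolding normal_form_def Let_def by auto
  have inj: "inj_on \<Phi> W" and W0: "{0} \<times> boundary A \<subseteq> W" and id: "\<And>p. p \<in> boundary A \<Longrightarrow> \<Phi> (0, p) = p"
    and idh: "\<And>p. p \<in> boundary A \<Longrightarrow> \<Phi>h (0, p) = p"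
    using col colh unfolding collar_def diffeo_def bij_betw_def by auto
  have metric: "bilinear (h s bc p)" "u \<noteq> 0 \<Longrightarrow> 0 < h s bc p u u" if "(s, p) \<in> W" "p \<in> dom_of bc" for s p u
    using fam bc that unfolding metric_family_def metric_on_def by blast+
  have metrich: "bilinear (hh s bc p)" if "(s, p) \<in> Wh" "p \<in> dom_of bc" for s p
    using famh bc that unfolding metric_family_def metric_on_def by blast
  obtain V U2 F2 where V: "openin (top_of_set (carrier A)) V" "param y0 \<in> V" "V \<subseteq> dom_of c"
    and U2: "(0, y0) \<in> U2" "Cinf_on U2 F2"
    and F2: "\<And>q. q \<in> V \<Longrightarrow> coord c q \<in> U2 \<Longrightarrow> \<exists>s p. (s, p) \<in> W \<and> 0 \<le> s \<and> p \<in> dom_of c \<and> p \<in> boundary A \<and>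
      \<Phi> (s, p) = q \<and> F2 (coord c q) = (s, snd (coord c p))"
    using collar_inverse_extension[OF col y0] by metis
  obtain e1 F1 where e1: "0 < e1" "Cinf_on (slab e1 y0) F1"
    and F1: "\<And>s y. 0 \<le> s \<Longrightarrow> (s, y) \<in> slab e1 y0 \<Longrightarrow>
      y \<in> img \<and> (s, param y) \<in> Wh \<and> \<Phi>h (s, param y) \<in> V \<and> F1 (s, y) = coord c (\<Phi>h (s, param y)) \<and>
      (coord c \<circ> \<Phi>h \<circ> coord_inv ?cb) (s, y) = F1 (s, y)"
    using collar_extension[OF colh y0 V] by metis
  obtain e3 F3 where e3: "0 < e3" "Cinf_on (slab e3 y0) F3"
    and F3: "\<And>s y. 0 \<le> s \<Longrightarrow> (s, y) \<in> slab e3 y0 \<Longrightarrow>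
      y \<in> img \<and> (s, param y) \<in> W \<and> \<Phi> (s, param y) \<in> dom_of c \<and> F3 (s, y) = coord c (\<Phi> (s, param y)) \<and>
      (coord c \<circ> \<Phi> \<circ> coord_inv ?cb) (s, y) = F3 (s, y)"
    using collar_extension[OF col y0 dom_open param(1)[OF y0] order_refl] by metis
  obtain e4 G where e4: "0 < e4" and G: "\<And>i j. i \<in> Basis \<Longrightarrow> j \<in> Basis \<Longrightarrow> Cinf_on (slab e4 y0) (G i j)"
    and Gh: "\<And>s y i j. 0 \<le> s \<Longrightarrow> (s, y) \<in> slab e4 y0 \<Longrightarrow> i \<in> Basis \<Longrightarrow> j \<in> Basis \<Longrightarrow> G i j (s, y) = h s bc (param y) i j"
    using metric_family_extension[OF col fam y0] by metis
  obtain e5 K where e5: "0 < e5" and K: "\<And>i j. i \<in> Basis \<Longrightarrow> j \<in> Basis \<Longrightarrow> Cinf_on (slab e5 y0) (K i j)"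
    and Kh: "\<And>s y i j. 0 \<le> s \<Longrightarrow> (s, y) \<in> slab e5 y0 \<Longrightarrow> i \<in> Basis \<Longrightarrow> j \<in> Basis \<Longrightarrow> K i j (s, y) = hh s bc (param y) i j"
    using metric_family_extension[OF colh famh y0] by metis
  define r' where "r' = min e3 e4"
  have r': "0 < r'" using e3 e4 by (simp add: r'_def)
  have s3: "slab r' y0 \<subseteq> slab e3 y0" and s4: "slab r' y0 \<subseteq> slab e4 y0"
    by (auto simp: r'_def slab_def)
  \<comment> \<open>\<open>F1\<close> extends \<open>\<Phi>h\<close> and \<open>F2\<close> extends
    the inverse of \<open>\<Phi>\<close>. The function \<open>F3\<close>, extending
    \<open>\<Phi>\<close> itself, is kept for the chain rule.\<close>
  define \<Psi> where "\<Psi> = (\<lambda>z. F2 (F1 z))"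
  define X where "X = (\<lambda>z. fst (\<Psi> z))"
  define Y where "Y = (\<lambda>z. snd (\<Psi> z))"
  define S where "S = slab e1 y0 \<inter> F1 -` U2"
  have S: "open S" unfolding S_def by (rule open_Cinf_preimage[OF e1(2) Cinf_on_open[OF U2(2)]])
  have \<Psi>S: "Cinf_on S \<Psi>" unfolding \<Psi>_def
    by (rule Cinf_on_compose[OF U2(2) Cinf_on_subset[OF e1(2) S]]) (auto simp: S_def)
  have \<Psi>: "y \<in> img \<and> Y (s, y) \<in> img \<and> (s, param y) \<in> Wh \<and> \<Phi>h (s, param y) \<in> dom_of c \<and> 0 \<le> X (s, y) \<and>
      (X (s, y), param (Y (s, y))) \<in> W \<and> \<Phi> (X (s, y), param (Y (s, y))) = \<Phi>h (s, param y)"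
    if "0 \<le> s" "(s, y) \<in> S" for s y
  proof -
    have sy: "(s, y) \<in> slab e1 y0" "F1 (s, y) \<in> U2" using that(2) by (auto simp: S_def)
    note f1 = F1[OF that(1) sy(1)]
    have "\<exists>t p. (t, p) \<in> W \<and> 0 \<le> t \<and> p \<in> dom_of c \<and> p \<in> boundary A \<and>
      \<Phi> (t, p) = \<Phi>h (s, param y) \<and> F2 (coord c (\<Phi>h (s, param y))) = (t, snd (coord c p))"
      by (rule F2) (use f1 sy in auto)
    then obtain t p where tp: "(t, p) \<in> W" "0 \<le> t" "p \<in> dom_of c" "p \<in> boundary A"
      "\<Phi> (t, p) = \<Phi>h (s, param y)" "F2 (coord c (\<Phi>h (s, param y))) = (t, snd (coord c p))" by blast
    have XY: "X (s, y) = t" "Y (s, y) = snd (coord c p)"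
      using f1 tp(6) by (simp_all add: X_def Y_def \<Psi>_def)
    show ?thesis unfolding XY using tp f1 V(3) param_coord[OF tp(3,4)] by auto
  qed
  have XY0: "X (0, y) = 0" "Y (0, y) = y" if "(0, y) \<in> S" for y
  proof -
    note q = \<Psi>[OF order_refl that]
    have py: "param y \<in> boundary A" using q param by blast
    \<comment> \<open>Both collars are the identity on the boundary, and \<open>\<Phi>\<close> is
      injective on \<open>W\<close>.\<close>
    have "\<Phi> (X (0, y), param (Y (0, y))) = \<Phi> (0, param y)" using q idh[OF py] id[OF py] by simp
    moreover have "(0, param y) \<in> W" using W0 py by blast
    ultimately have eq: "(X (0, y), param (Y (0, y))) = (0, param y)" using inj_onD[OF inj] q by blast
    then show "X (0, y) = 0" by simp
    have "(0::real, Y (0, y)) = (0, y)"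
      using eq param(3)[of y] param(3)[of "Y (0, y)"] q by (metis Pair_inject)
    then show "Y (0, y) = y" by simp
  qed
  have z0S: "(0, y0) \<in> S"
  proof -
    have "(0, y0) \<in> slab e1 y0" using e1(1) by (simp add: slab_def)
    moreover have "F1 (0, y0) = (0, y0)"
      using F1[OF order_refl calculation] idh param[OF y0] by simp
    ultimately show ?thesis using U2(1) by (simp add: S_def)
  qed
  \<comment> \<open>The map \<open>\<Psi>\<close> fixes \<open>(0, y0)\<close>, so a small slab is
    mapped into the slab of radius \<open>r'\<close> while remaining in the domains of all
    extensions.\<close>
  have "open (S \<inter> \<Psi> -` slab r' y0 \<inter> slab e5 y0)"
    by (intro open_Int open_Cinf_preimage[OF \<Psi>S] open_slab)
  moreover have "(0, y0) \<in> S \<inter> \<Psi> -` slab r' y0 \<inter> slab e5 y0"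
  proof -
    have "\<Psi> (0, y0) = (0, y0)" using XY0[OF z0S] by (simp add: X_def Y_def prod_eq_iff)
    then show ?thesis using z0S r' e5 by (simp add: slab_def)
  qed
  ultimately obtain r where r: "0 < r" and rsub: "slab r y0 \<subseteq> S \<inter> \<Psi> -` slab r' y0 \<inter> slab e5 y0"
    using open_contains_slab by blast
  have rS: "slab r y0 \<subseteq> S" and r5: "slab r y0 \<subseteq> slab e5 y0" and r1: "slab r y0 \<subseteq> slab e1 y0" using rsub by (auto simp: S_def)
  have \<Psi>r: "Cinf_on (slab r y0) \<Psi>" by (rule Cinf_on_subset[OF \<Psi>S open_slab rS])
  have X: "Cinf_on (slab r y0) X" unfolding X_def
    by (rule Cinf_on_compose_bounded_linear[OF bounded_linear_fst \<Psi>r])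
  have Y: "Cinf_on (slab r y0) Y" unfolding Y_def
    by (rule Cinf_on_compose_bounded_linear[OF bounded_linear_snd \<Psi>r])
  have maps: "(X z, Y z) \<in> slab r' y0" if "z \<in> slab r y0" for z
    using rsub that by (auto simp: X_def Y_def)
  \<comment> \<open>\<open>X\<close> is the value of \<open>x\<close> at the point reached by
    \<open>\<Phi>h\<close>. That point is off the boundary because \<open>xh\<close> equals
    \<open>s > 0\<close> there.\<close>
  have Xpos: "0 < X z" if z: "z \<in> slab r y0" "0 < fst z" for z
  proof -
    obtain s y where sy: "z = (s, y)" by force
    have s: "0 \<le> s" "0 < s" "(s, y) \<in> S" using z rS by (auto simp: sy)
    note q = \<Psi>[OF s(1,3)]
    have "\<Phi>h (s, param y) \<notin> boundary A"
      using xh\<Phi>[of s "param y"] q s(2) dxh unfolding defining_function_def by force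
    moreover have "\<Phi>h (s, param y) \<in> carrier A" using q c by (auto simp: carrier_def)
    ultimately have "0 < x (\<Phi>h (s, param y))"
      using dx unfolding defining_function_def bulk_def by blast
    moreover have "x (\<Phi>h (s, param y)) = X (s, y)" using q x\<Phi> by metis
    ultimately show ?thesis by (simp add: sy)
  qed
  have hG: "h s bc (param y) u v = (\<Sum>i\<in>Basis. \<Sum>j\<in>Basis. G i j (s, y) * (u \<bullet> i) * (v \<bullet> j))"
    if "0 \<le> s" "(s, y) \<in> slab r' y0" for s y u v
  proof -
    have q: "y \<in> img" "(s, param y) \<in> W" using F3[OF that(1)] that(2) s3 by auto
    have "bilinear (h s bc (param y))" by (rule metric(1)[OF q(2)]) (use param[OF q(1)] in \<open>simp add: dom_bc\<close>)
    then show ?thesis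
      using bilinear_expand_Basis[of "h s bc (param y)" u v] Gh[OF that(1)] that(2) s4 by (simp add: subset_iff)
  qed
  have hK: "hh s bc (param y) u v = (\<Sum>i\<in>Basis. \<Sum>j\<in>Basis. K i j (s, y) * (u \<bullet> i) * (v \<bullet> j))"
    if "0 \<le> s" "(s, y) \<in> slab r y0" for s y u v
  proof -
    have q: "y \<in> img" "(s, param y) \<in> Wh" using F1[OF that(1)] that(2) r1 by auto
    have "bilinear (hh s bc (param y))" by (rule metrich[OF q(2)]) (use param[OF q(1)] in \<open>simp add: dom_bc\<close>)
    then show ?thesis
      using bilinear_expand_Basis[of "hh s bc (param y)" u v] Kh[OF that(1)] that(2) r5 by (simp add: subset_iff)
  qed
  have isometry: "(fst z)\<^sup>2 * (frechet_derivative X (at z) \<xi> * frechet_derivative X (at z) \<eta> +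
        (\<Sum>i\<in>Basis. \<Sum>j\<in>Basis. G i j (X z, Y z) *
          frechet_derivative (\<lambda>z. Y z \<bullet> i) (at z) \<xi> * frechet_derivative (\<lambda>z. Y z \<bullet> j) (at z) \<eta>)) =
      (X z)\<^sup>2 * (fst \<xi> * fst \<eta> + (\<Sum>i\<in>Basis. \<Sum>j\<in>Basis. K i j z * (snd \<xi> \<bullet> i) * (snd \<eta> \<bullet> j)))"
    if z: "z \<in> slab r y0" "0 < fst z" for z \<xi> \<eta>
  proof -
    obtain s y where sy: "z = (s, y)" by force
    have s: "0 \<le> s" "0 < s" "(s, y) \<in> S" "(s, y) \<in> slab r y0" "(s, y) \<in> slab e1 y0" using z rS r1 by (auto simp: sy)
    define t where "t = X z"
    define w where "w = Y z"
    note q = \<Psi>[OF s(1,3), folded sy t_def w_def]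
    have tw: "(t, w) \<in> slab r' y0" "(t, w) \<in> slab e3 y0" using maps[OF z(1)] s3 by (auto simp: t_def w_def)
    have t: "0 < t" using Xpos[OF z] by (simp add: t_def)
    define DF where "DF = frechet_derivative F3 (at (t, w))"
    define DX where "DX = frechet_derivative X (at z)"
    define DY where "DY = frechet_derivative Y (at z)"
    have L: "chart_deriv half_space ?cb c \<Phi> (t, param w) = DF"
      unfolding DF_def
      by (rule chart_deriv_collar[OF e3(2) tw(2) t]) (use F3 param q in auto)
    have Lh: "chart_deriv half_space ?cb c \<Phi>h (s, param y) = frechet_derivative F1 (at z)"
      unfolding sy by (rule chart_deriv_collar[OF e1(2) s(5,2)]) (use F1 param q in auto)
    have dX: "(X has_derivative DX) (at z)" and dY: "(Y has_derivative DY) (at z)"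
      unfolding DX_def DY_def using Cinf_on_has_derivative[OF X z(1)] Cinf_on_has_derivative[OF Y z(1)] by auto
    \<comment> \<open>For \<open>s > 0\<close> one has \<open>F3 (X, Y) = F1\<close>. The
      differential of \<open>\<Phi>h\<close> is therefore that of \<open>\<Phi>\<close> applied to
      \<open>(DX v, DY v)\<close>, and the two normal forms evaluate \<open>g\<close> on the same
      vectors.\<close>
    have "(F3 has_derivative DF) (at (X z, Y z))"
      using Cinf_on_has_derivative[OF e3(2) tw(2)] by (simp add: DF_def t_def w_def)
    from diff_chain_at[OF has_derivative_Pair[OF dX dY] this]
    have "((\<lambda>z. F3 (X z, Y z)) has_derivative (\<lambda>v. DF (DX v, DY v))) (at z)" by (simp add: o_def)
    moreover have "open {z :: real \<times> 'e. 0 < fst z}"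
      by (intro open_Collect_less continuous_intros)
    then have "open (slab r y0 \<inter> {z. 0 < fst z})" using open_slab by blast
    moreover have "F3 (X v, Y v) = F1 v" if v: "v \<in> slab r y0 \<inter> {z. 0 < fst z}" for v
    proof -
      obtain s y where sy: "v = (s, y)" by force
      have s: "0 \<le> s" "(s, y) \<in> S" "(s, y) \<in> slab e1 y0" using v rS r1 by (auto simp: sy)
      have "(X v, Y v) \<in> slab e3 y0" using maps[of v] s3 v by blast
      then show ?thesis using F3[of "X v" "Y v"] \<Psi>[OF s(1,2)] F1[OF s(1,3)] by (simp add: sy)
    qed
    ultimately have "(F1 has_derivative (\<lambda>v. DF (DX v, DY v))) (at z)"
      using has_derivative_transform_within_open[of "\<lambda>z. F3 (X z, Y z)" _ z UNIV "slab r y0 \<inter> {z. 0 < fst z}" F1] z by blast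
    then have Lh': "frechet_derivative F1 (at z) = (\<lambda>v. DF (DX v, DY v))"
      using frechet_derivative_at by metis
    have d: "param y \<in> dom_of bc" "param w \<in> dom_of bc" using param q by (auto simp: dom_bc)
    have 1: "1 / s\<^sup>2 * (fst \<xi> * fst \<eta> + hh s bc (param y) (snd \<xi>) (snd \<eta>)) =
        1 / t\<^sup>2 * (DX \<xi> * DX \<eta> + h t bc (param w) (DY \<xi>) (DY \<eta>))"
      using isoh[of s "param y" "fst \<xi>" "snd \<xi>" "fst \<eta>" "snd \<eta>"]
        iso[of t "param w" "DX \<xi>" "DY \<xi>" "DX \<eta>" "DY \<eta>"] q s(2) t d
      unfolding L Lh Lh' by simp
    have 2: "t\<^sup>2 * (fst \<xi> * fst \<eta> + hh s bc (param y) (snd \<xi>) (snd \<eta>)) =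
        s\<^sup>2 * (DX \<xi> * DX \<eta> + h t bc (param w) (DY \<xi>) (DY \<eta>))"
      using 1 s(2) t by (simp add: field_simps)
    have DYi: "frechet_derivative (\<lambda>z. Y z \<bullet> i) (at z) v = DY v \<bullet> i" for i v
    proof -
      have "((\<lambda>z. Y z \<bullet> i) has_derivative (\<lambda>v. DY v \<bullet> i)) (at z)"
        by (rule bounded_linear.has_derivative[OF bounded_linear_inner_left dY])
      from frechet_derivative_at[OF this] show ?thesis by metis
    qed
    show ?thesis
      using 2 hG[OF less_imp_le[OF t] tw(1), of "DY \<xi>" "DY \<eta>"] hK[OF s(1,4), of "snd \<xi>" "snd \<eta>"]
      unfolding DYi DX_def[symmetric] by (simp add: sy t_def w_def)
  qed
  have evenG: "(ds ^^ k) (G i j) (0, y) = 0"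
    if "y \<in> ball y0 r'" "i \<in> Basis" "j \<in> Basis" "k < n" "odd k" for y i j k
  proof -
    have y: "(0, y) \<in> slab r' y0" using that(1) r' by (simp add: slab_zero)
    then have yi: "y \<in> img" using F3[OF order_refl] s3 by blast
    then have d: "param y \<in> dom_of bc" using param by (simp add: dom_bc)
    obtain H where H: "has_expansion n (boundary_atlas A) h H"
      and H0: "\<And>k. k < n - 1 \<Longrightarrow> odd k \<Longrightarrow> H k bc (param y) i j = 0"
      using pe bc d unfolding partially_even_def by blast
    have "(\<lambda>s. h s bc (param y) i j - (\<Sum>k\<le>n. s ^ k * H k bc (param y) i j)) \<in> O[at_right 0](\<lambda>s. s ^ (n + 1))"
      using H bc d unfolding has_expansion_def by blast
    moreover have "(\<lambda>s. h s bc (param y) i j - (\<Sum>k\<le>n. s ^ k * (\<Sum>i'\<in>Basis. \<Sum>j'\<in>Basis.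
        (ds ^^ k) (G i' j') (0, y) / fact k * (i \<bullet> i') * (j \<bullet> j')))) \<in> O[at_right 0](\<lambda>s. s ^ (n + 1))"
      by (rule expansion_bilinear[OF Cinf_on_subset[OF G open_slab s4] r' that(1)])
        (use hG that(1) in \<open>auto simp: slab_def\<close>)
    ultimately have "H k bc (param y) i j = (\<Sum>i'\<in>Basis. \<Sum>j'\<in>Basis.
        (ds ^^ k) (G i' j') (0, y) / fact k * (i \<bullet> i') * (j \<bullet> j'))"
      by (rule expansion_unique) (use that in simp)
    then have "H k bc (param y) i j = (ds ^^ k) (G i j) (0, y) / fact k"
      using sum_Basis_Basis[OF that(2,3), of "\<lambda>i' j'. (ds ^^ k) (G i' j') (0, y) / fact k"] by simp
    \<comment> \<open>Partial evenness speaks of orders below \<open>n - 1\<close>; since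
      \<open>n\<close> is odd, \<open>n - 1\<close> is even, so every odd \<open>k < n\<close> is
      covered.\<close>
    moreover have "k \<noteq> n - 1" using n that(5) by auto
    then have "k < n - 1" using that(4) by linarith
    ultimately show ?thesis using H0 that(5) by simp
  qed
  show ?thesis
  proof (rule that)
    show "collar_change r r' y0 X Y G K n (\<lambda>y. \<omega>0 (param y))"
    proof (unfold_locales)
      show "0 < r" "0 < r'" "odd n" "2 \<le> n" by (fact r r' n)+
      show "Cinf_on (slab r y0) X" "Cinf_on (slab r y0) Y" by (fact X Y)+
      show "Cinf_on (slab r' y0) (G i j)" if "i \<in> Basis" "j \<in> Basis" for i j
        by (rule Cinf_on_subset[OF G[OF that] open_slab s4])
      show "Cinf_on (slab r y0) (K i j)" if "i \<in> Basis" "j \<in> Basis" for i j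
        by (rule Cinf_on_subset[OF K[OF that] open_slab r5])
      show "(X z, Y z) \<in> slab r' y0" if "z \<in> slab r y0" for z using maps[OF that] .
      show "X (0, y) = 0" "Y (0, y) = y" if "y \<in> ball y0 r" for y
        using XY0[of y] rS slab_zero[OF r, of y y0] that by auto
      show "0 < X z" if "z \<in> slab r y0" "0 < fst z" for z using Xpos[OF that] .
      show "0 < (\<Sum>i\<in>Basis. \<Sum>j\<in>Basis. G i j (0, y) * (u \<bullet> i) * (u \<bullet> j))"
        if y: "y \<in> ball y0 r'" and u: "u \<noteq> 0" for y u
      proof -
        have y': "(0, y) \<in> slab r' y0" using y r' by (simp add: slab_zero)
        then have yi: "y \<in> img" "(0, param y) \<in> W" using F3[OF order_refl] s3 by blast+
        have "0 < h 0 bc (param y) u u"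
          by (rule metric(2)[OF yi(2) _ u]) (use param[OF yi(1)] in \<open>simp add: dom_bc\<close>)
        then show ?thesis using hG[OF order_refl y'] by simp
      qed
      show "K i j (0, y) = exp (2 * \<omega>0 (param y)) * G i j (0, y)"
        if y: "y \<in> ball y0 r" and ij: "i \<in> Basis" "j \<in> Basis" for y i j
      proof -
        have y': "(0, y) \<in> slab r y0" using y r by (simp add: slab_zero)
        have "(0, y) \<in> slab r' y0" using maps[OF y'] XY0[of y] rS y' by auto
        moreover have "param y \<in> dom_of bc"
          using F1[OF order_refl] y' r1 param by (auto simp: dom_bc)
        ultimately show ?thesis
          using Kh[OF order_refl _ ij] Gh[OF order_refl _ ij] y' r5 s4 conf by (simp add: subset_iff)
      qed
    qed (fact evenG isometry)+
    show "G i j (s, y) = h s bc (param y) i j" if "0 \<le> s" "(s, y) \<in> slab r' y0" "i \<in> Basis" "j \<in> Basis" for s y i j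
      using Gh[OF that(1) _ that(3,4)] that(2) s4 by blast
    show "K i j (s, y) = hh s bc (param y) i j" if "0 \<le> s" "(s, y) \<in> slab r y0" "i \<in> Basis" "j \<in> Basis" for s y i j
      using Kh[OF that(1) _ that(3,4)] that(2) r5 by blast
    show "y \<in> img \<and> (s, param y) \<in> W" if "0 \<le> s" "(s, y) \<in> slab r' y0" for s y
      using F3[OF that(1)] that(2) s3 by blast
    show "y \<in> img \<and> (s, param y) \<in> Wh" if "0 \<le> s" "(s, y) \<in> slab r y0" for s y
      using F1[OF that(1)] that(2) r1 by blast
  qed
qed

text \<open>The coefficients \<open>C\<close> are assembled from the Taylor coefficients of
  \<open>K\<close> by bilinearity. The facts about \<open>H 0\<close> and \<open>H n\<close> are
  what the trace needs; \<open>has_expansion\<close> alone does not assert them, they follow from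
  uniqueness of the expansion.\<close>

lemma transformed_coefficients:
  assumes dx: "defining_function A g x" and dxh: "defining_function A g xh"
    and nf: "normal_form A g x W \<Phi> h" and nfh: "normal_form A g xh Wh \<Phi>h hh"
    and n: "odd n" "2 \<le> n" and pe: "partially_even n (boundary_atlas A) h"
    and H: "has_expansion n (boundary_atlas A) h H"
    and conf: "\<And>p u v. p \<in> dom_of bc \<Longrightarrow> hh 0 bc p u v = exp (2 * \<omega>0 p) * h 0 bc p u v"
    and p: "p \<in> dom_of bc"
  obtains C where
    "\<And>u v. (\<lambda>s. hh s bc p u v - (\<Sum>k\<le>n. s ^ k * C k u v)) \<in> O[at_right 0](\<lambda>s. s ^ (n + 1))"
    "\<And>k u v. k < n \<Longrightarrow> odd k \<Longrightarrow> C k u v = 0"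
    "\<And>u v. C 0 u v = exp (2 * \<omega>0 p) * H 0 bc p u v"
    "\<And>u v. C n u v = exp (- (real (n - 2) * \<omega>0 p)) * H n bc p u v"
    "bilinear (H 0 bc p)" "\<And>u v. H 0 bc p u v = H 0 bc p v u" "\<And>u. u \<noteq> 0 \<Longrightarrow> 0 < H 0 bc p u u"
    "\<And>u. linear (H n bc p u)"
proof -
  define y0 where "y0 = snd (coord c p)"
  have y0: "y0 \<in> img" "param y0 = p" using param_coord p by (auto simp: y0_def dom_bc)
  show ?thesis
  proof (rule collar_change_exists[OF dx dxh nf nfh n pe conf y0(1)])
    fix r r' X Y G K
    assume CC: "collar_change r r' y0 X Y G K n (\<lambda>y. \<omega>0 (param y))"
      and Gh: "\<And>s y i j. 0 \<le> s \<Longrightarrow> (s, y) \<in> slab r' y0 \<Longrightarrow> i \<in> Basis \<Longrightarrow> j \<in> Basis \<Longrightarrow> G i j (s, y) = h s bc (param y) i j"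
      and Kh: "\<And>s y i j. 0 \<le> s \<Longrightarrow> (s, y) \<in> slab r y0 \<Longrightarrow> i \<in> Basis \<Longrightarrow> j \<in> Basis \<Longrightarrow> K i j (s, y) = hh s bc (param y) i j"
      and inW: "\<And>s y. 0 \<le> s \<Longrightarrow> (s, y) \<in> slab r' y0 \<Longrightarrow> y \<in> img \<and> (s, param y) \<in> W"
      and inWh: "\<And>s y. 0 \<le> s \<Longrightarrow> (s, y) \<in> slab r y0 \<Longrightarrow> y \<in> img \<and> (s, param y) \<in> Wh"
    interpret collar_change r r' y0 X Y G K n "\<lambda>y. \<omega>0 (param y)" by (rule CC)
    have fam: "metric_family A W h" and famh: "metric_family A Wh hh"
      using nf nfh unfolding normal_form_def by auto
    have metric: "bilinear (h s bc p)" "h s bc p u v = h s bc p v u" "u \<noteq> 0 \<Longrightarrow> 0 < h s bc p u u"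
      if "(s, p) \<in> W" for s u v
      using fam bc that p unfolding metric_family_def metric_on_def by blast+
    have metrich: "bilinear (hh s bc p)" if "(s, p) \<in> Wh" for s
      using famh bc that p unfolding metric_family_def metric_on_def by blast
    have mem: "(s, y0) \<in> slab r' y0" if "0 \<le> s" "s < r'" for s using that by (simp add: slab_def)
    have memh: "(s, y0) \<in> slab r y0" if "0 \<le> s" "s < r" for s using that by (simp add: slab_def)
    have ball: "y0 \<in> ball y0 r" "y0 \<in> ball y0 r'" using r r' by auto
    define D where "D = (\<lambda>(F :: 'e \<Rightarrow> 'e \<Rightarrow> real \<times> 'e \<Rightarrow> real) k u v.
      \<Sum>i\<in>Basis. \<Sum>j\<in>Basis. (ds ^^ k) (F i j) (0, y0) / fact k * (u \<bullet> i) * (v \<bullet> j))"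
    have hG: "h s bc p u v = (\<Sum>i\<in>Basis. \<Sum>j\<in>Basis. G i j (s, y0) * (u \<bullet> i) * (v \<bullet> j))"
      if "0 \<le> s" "s < r'" for s u v
      using bilinear_expand_Basis[OF metric(1), of s u v] inW[OF that(1) mem[OF that]] Gh[OF that(1) mem[OF that]]
      by (simp add: y0)
    have hK: "hh s bc p u v = (\<Sum>i\<in>Basis. \<Sum>j\<in>Basis. K i j (s, y0) * (u \<bullet> i) * (v \<bullet> j))"
      if "0 \<le> s" "s < r" for s u v
      using bilinear_expand_Basis[OF metrich, of s u v] inWh[OF that(1) memh[OF that]] Kh[OF that(1) memh[OF that]]
      by (simp add: y0)
    have eG: "(\<lambda>s. h s bc p u v - (\<Sum>k\<le>n. s ^ k * D G k u v)) \<in> O[at_right 0](\<lambda>s. s ^ (n + 1))" for u v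
      unfolding D_def by (rule expansion_bilinear[OF G r' ball(2) hG])
    have eK: "(\<lambda>s. hh s bc p u v - (\<Sum>k\<le>n. s ^ k * D K k u v)) \<in> O[at_right 0](\<lambda>s. s ^ (n + 1))" for u v
      unfolding D_def by (rule expansion_bilinear[OF K r ball(1) hK])
    have HD: "H k bc p u v = D G k u v" if "k \<le> n" for k u v
    proof (rule expansion_unique[OF _ eG that])
      show "(\<lambda>s. h s bc p u v - (\<Sum>k\<le>n. s ^ k * H k bc p u v)) \<in> O[at_right 0](\<lambda>s. s ^ (n + 1))"
        using H bc p unfolding has_expansion_def by blast
    qed
    \<comment> \<open>The expansion concerns \<open>s > 0\<close> only; its constant term is the
      value at 0 because \<open>h\<close> is smooth up to the boundary.\<close>
    have H0: "H 0 bc p u v = h 0 bc p u v" for u v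
      using HD[of 0 u v] hG[of 0 u v] r' by (simp add: D_def)
    have W0: "(0, p) \<in> W" using inW[OF order_refl mem[OF order_refl r']] y0(2) by simp
    show ?thesis
    proof (rule that[of "D K"])
      show "D K k u v = 0" if "k < n" "odd k" for k u v
        using K_coefficients(1)[OF ball(1) _ _ that] by (simp add: D_def)
      show "D K 0 u v = exp (2 * \<omega>0 p) * H 0 bc p u v" for u v
        using hK[of 0 u v] r conf[OF p, of u v] H0[of u v] by (simp add: D_def)
      show "D K n u v = exp (- (real (n - 2) * \<omega>0 p)) * H n bc p u v" for u v
        using K_coefficients(2)[OF ball(1)] HD[of n u v]
        by (simp add: D_def y0 sum_distrib_left mult_ac)
      have "H 0 bc p = h 0 bc p" using H0 by blast
      then show "bilinear (H 0 bc p)" "H 0 bc p u v = H 0 bc p v u" "u \<noteq> 0 \<Longrightarrow> 0 < H 0 bc p u u" for u v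
        using metric[OF W0] by simp_all
      have "linear (D G n u)" for u
        by (rule linearI) (simp_all add: D_def inner_simps algebra_simps add_divide_distrib sum.distrib sum_distrib_left)
      then show "linear (H n bc p u)" for u
        using HD[OF order_refl] by (metis ext)
    qed (rule eK)
  qed
qed

end

lemma trace_wrt_scale:
  fixes \<beta> :: "'e::euclidean_space \<Rightarrow> 'e \<Rightarrow> real"
  assumes \<beta>: "bilinear \<beta>" "\<And>u v. \<beta> u v = \<beta> v u" "\<And>u. u \<noteq> 0 \<Longrightarrow> 0 < \<beta> u u"
    and k: "\<And>u. linear (k u)" and l: "l \<noteq> 0"
  shows "trace_wrt (\<lambda>u v. l * \<beta> u v) (\<lambda>u v. m * k u v) = m / l * trace_wrt \<beta> k"
proof -
  have "sharp (\<lambda>u v. l * \<beta> u v) (\<lambda>v. m * k i v) = (m / l) *\<^sub>R sharp \<beta> (k i)" for i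
    by (rule sharp_scale[OF \<beta> k l])
  then show ?thesis by (simp add: trace_wrt_def sum_distrib_left)
qed

theorem proposition2p6:
  fixes A :: "('m::{t2_space, second_countable_topology}, real \<times> 'e::euclidean_space) chart set"
    and g :: "('m, real \<times> 'e) tensor2"
    and x xh :: "'m \<Rightarrow> real"
    and W Wh :: "(real \<times> 'm) set"
    and \<Phi> \<Phi>h :: "real \<times> 'm \<Rightarrow> 'm"
    and h hh :: "real \<Rightarrow> ('m, 'e) tensor2"
    and H :: "nat \<Rightarrow> ('m, 'e) tensor2"
    and \<omega>0 :: "'m \<Rightarrow> real"
    and n :: nat
  assumes "n = DIM(real \<times> 'e)" and "n \<ge> 3" and "odd n"
    and "smooth_atlas half_space A"
    and "metric_on half_space A (bulk A) g"
    and "conformally_compactifiable A g"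
    and "asymptotically_hyperbolic A g"
    and "special_defining_function A g x"
    and "normal_form A g x W \<Phi> h"
    and "partially_even n (boundary_atlas A) h"
    and "has_expansion n (boundary_atlas A) h H"
    and "special_defining_function A g xh"
    and "normal_form A g xh Wh \<Phi>h hh"
    and "\<forall>b\<in>boundary_atlas A. \<forall>p\<in>dom_of b. \<forall>u v.
           hh 0 b p u v = exp (2 * \<omega>0 p) * h 0 b p u v"
  shows "partially_even n (boundary_atlas A) hh \<and>
         (\<forall>Hh. has_expansion n (boundary_atlas A) hh Hh \<longrightarrow>
            (\<forall>b\<in>boundary_atlas A. \<forall>p\<in>dom_of b.
               mu n Hh b p = exp (- (real n * \<omega>0 p)) * mu n H b p))"
proof -
  have dx: "defining_function A g x" and dxh: "defining_function A g xh"
    using assms(8,12) by (simp_all add: special_defining_function_def)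
  have n: "odd n" "2 \<le> n" using assms(2,3) by auto
  define P where "P = (\<lambda>b p C.
    (\<forall>u v. (\<lambda>s. hh s b p u v - (\<Sum>k\<le>n. s ^ k * C k u v)) \<in> O[at_right 0](\<lambda>s. s ^ (n + 1))) \<and>
    (\<forall>k u v. k < n \<longrightarrow> odd k \<longrightarrow> C k u v = 0) \<and>
    (\<forall>u v. C 0 u v = exp (2 * \<omega>0 p) * H 0 b p u v) \<and>
    (\<forall>u v. C n u v = exp (- (real (n - 2) * \<omega>0 p)) * H n b p u v) \<and>
    bilinear (H 0 b p) \<and> (\<forall>u v. H 0 b p u v = H 0 b p v u) \<and> (\<forall>u. u \<noteq> 0 \<longrightarrow> 0 < H 0 b p u u) \<and>
    (\<forall>u. linear (H n b p u)))"
  have P: "\<exists>C. P b p C" if b: "b \<in> boundary_atlas A" and p: "p \<in> dom_of b" for b p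
  proof -
    obtain c where cA: "c \<in> A" and b_eq: "b = (dom_of c \<inter> boundary A, snd \<circ> coord c)"
      using b unfolding boundary_atlas_def by blast
    \<comment> \<open>Every boundary chart is the restriction of some chart \<open>c\<close>, and
      the defining function \<open>x\<close> shows that points of the boundary have first coordinate
      zero in it.\<close>
    interpret boundary_chart A c
      by unfold_locales (use assms(4) cA defining_function_boundary_coordinate[OF assms(4) dx cA] in auto)
    have bc: "bc = b" by (simp only: bc_def b_eq)
    have conf: "hh 0 bc p u v = exp (2 * \<omega>0 p) * h 0 bc p u v" if "p \<in> dom_of bc" for p u v
      using assms(14) b that unfolding bc by blast
    show ?thesis
    proof (rule transformed_coefficients[OF dx dxh assms(9,13) n assms(10,11) conf p[folded bc]])
      fix C
      assume C: "\<And>u v. (\<lambda>s. hh s bc p u v - (\<Sum>k\<le>n. s ^ k * C k u v)) \<in> O[at_right 0](\<lambda>s. s ^ (n + 1))"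
        "\<And>k u v. k < n \<Longrightarrow> odd k \<Longrightarrow> C k u v = 0"
        "\<And>u v. C 0 u v = exp (2 * \<omega>0 p) * H 0 bc p u v"
        "\<And>u v. C n u v = exp (- (real (n - 2) * \<omega>0 p)) * H n bc p u v"
        and H: "bilinear (H 0 bc p)" "\<And>u v. H 0 bc p u v = H 0 bc p v u" "\<And>u. u \<noteq> 0 \<Longrightarrow> 0 < H 0 bc p u u"
        "\<And>u. linear (H n bc p u)"
      show ?thesis unfolding P_def
        by (rule exI[of _ C], intro conjI allI impI) (fact C[unfolded bc] H[unfolded bc] | erule (1) C(2) | erule H(3)[unfolded bc])+
    qed
  qed
  have even: "partially_even n (boundary_atlas A) hh"
    unfolding partially_even_def
  proof (intro exI conjI allI impI ballI)
    \<comment> \<open>\<open>has_expansion\<close> is a condition at each point of each chart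
      separately, so coefficients may be chosen there independently.\<close>
    define D where "D = (\<lambda>b p. SOME C. P b p C)"
    have D: "P b p (D b p)" if "b \<in> boundary_atlas A" "p \<in> dom_of b" for b p
      unfolding D_def using someI_ex[OF P[OF that]] .
    show "has_expansion n (boundary_atlas A) hh (\<lambda>k b p. D b p k)"
      unfolding has_expansion_def using D unfolding P_def by blast
    show "D b p k u v = 0" if "k < n - 1" "odd k" "b \<in> boundary_atlas A" "p \<in> dom_of b" for k b p u v
      using D[OF that(3,4)] that(1,2) unfolding P_def by simp
  qed
  have "mu n Hh b p = exp (- (real n * \<omega>0 p)) * mu n H b p"
    if Hh: "has_expansion n (boundary_atlas A) hh Hh" and b: "b \<in> boundary_atlas A" and p: "p \<in> dom_of b" for Hh b p
  proof -
    obtain C where C: "P b p C" using P[OF b p] by blast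
    have HC: "Hh k b p u v = C k u v" if "k \<le> n" for k u v
    proof (rule expansion_unique[OF _ _ that])
      show "(\<lambda>s. hh s b p u v - (\<Sum>k\<le>n. s ^ k * Hh k b p u v)) \<in> O[at_right 0](\<lambda>s. s ^ (n + 1))"
        using Hh b p unfolding has_expansion_def by blast
      show "(\<lambda>s. hh s b p u v - (\<Sum>k\<le>n. s ^ k * C k u v)) \<in> O[at_right 0](\<lambda>s. s ^ (n + 1))"
        using C unfolding P_def by blast
    qed
    have 0: "Hh 0 b p = (\<lambda>u v. exp (2 * \<omega>0 p) * H 0 b p u v)"
      using HC[of 0] C unfolding P_def by (intro ext) simp
    have n': "kappa n Hh b p = (\<lambda>u v. exp (- (real (n - 2) * \<omega>0 p)) * kappa n H b p u v)"
      using HC[OF order_refl] C unfolding P_def kappa_def by (intro ext) (simp add: mult_ac)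
    have lin: "linear (kappa n H b p u)" for u
      using C linear_compose_scale_right[of "H n b p u" "real n"] unfolding P_def kappa_def by simp
    have "mu n Hh b p = exp (- (real (n - 2) * \<omega>0 p)) / exp (2 * \<omega>0 p) * mu n H b p"
      unfolding mu_def 0 n' by (rule trace_wrt_scale) (use C lin in \<open>auto simp: P_def\<close>)
    \<comment> \<open>The weight \<open>- (n - 2)\<close> of the coefficient and the weight
      \<open>- 2\<close> of the inverse boundary metric add up to \<open>- n\<close>;
      \<open>2 \<le> n\<close> makes the natural subtraction exact.\<close>
    also have "exp (- (real (n - 2) * \<omega>0 p)) / exp (2 * \<omega>0 p) = exp (- (real n * \<omega>0 p))"
      using n(2) by (simp add: exp_diff[symmetric] of_nat_diff algebra_simps)
    finally show ?thesis .
  qed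
  with even show ?thesis by blast
qed

end
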